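(* Let $M=\{(z_1,z_2,z_3)\in\mathbb{C}^3 : |z_1|^2+|z_2|^2=1+|z_3|^2\}$ and $S^3=M\cap\{z_3=0\}$. Let $\omega$ be a non-empty open subset of $S^3$, put $K_\omega=S^3\setminus\omega$, and let $\Omega\subset M$ be a connected open set such that $K_\omega\subset\Omega$ and $\Omega\setminus K_\omega$ is connected and non-empty. Then there exists $\varepsilon=\varepsilon(\Omega,K_\omega)>0$ such that the H-principle holds for the pair $(\Omega,K_\omega^{\varepsilon})$, where $K_\omega^{\varepsilon}$ denotes the closed $\varepsilon$-neighborhood of $K_\omega$ in $M$.
   Context: $M$ is a smooth real hypersurface in $\mathbb{C}^3$, regarded as a generic CR submanifold of type $(2,1)$ (CR dimension 2, CR codimension 1). For an open set $D\subset M$, $CR(D)$ denotes the algebra of continuous CR functions on $D$, i.e. continuous complex-valued functions on $D$ satisfying the tangential Cauchy-Riemann equations on $M$ in the sense of distributions. For a pair $(\Omega,K)$, where $\Omega\subset M$ is a connected open set, $K\subset\Omega$ is compact, and $\Omega\setminus K$ is connected and non-empty, the H-principle is said to hold for $(\Omega,K)$ if the restriction map $CR(\Omega)\to CR(\Omega\setminus K)$ is surjective. The closed $\varepsilon$-neighborhood of $K_\omega$ in $M$ is the set of points of $M$ at Euclidean distance (in $\mathbb{C}^3$) at most $\varepsilon$ from $K_\omega$. *)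

theory Defs
  imports "HOL-Analysis.Analysis"
begin

text \<open>C^k and C^infinity maps on an open set \<open>S\<close> (all iterated directional derivatives exist
  and are continuous on \<open>S\<close>).\<close>

primrec Ck_on :: "nat \<Rightarrow> 'a::euclidean_space set \<Rightarrow> ('a \<Rightarrow> 'b::real_normed_vector) \<Rightarrow> bool" where
  "Ck_on 0 S f \<longleftrightarrow> continuous_on S f"
| "Ck_on (Suc k) S f \<longleftrightarrow> (\<forall>x\<in>S. f differentiable (at x)) \<and>
     (\<forall>v. Ck_on k S (\<lambda>x. frechet_derivative f (at x) v))"

definition smooth_on :: "'a::euclidean_space set \<Rightarrow> ('a \<Rightarrow> 'b::real_normed_vector) \<Rightarrow> bool" where
  "smooth_on S f \<longleftrightarrow> (\<forall>k. Ck_on k S f)"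

definition test_function :: "'a::euclidean_space set \<Rightarrow> ('a \<Rightarrow> complex) \<Rightarrow> bool" where
  "test_function V \<phi> \<longleftrightarrow> smooth_on UNIV \<phi> \<and>
     compact (closure {x. \<phi> x \<noteq> 0}) \<and> closure {x. \<phi> x \<noteq> 0} \<subseteq> V"

text \<open>Smooth local parametrizations (inverse charts) of a real hypersurface of C^3,
  which has real dimension 5.\<close>

definition local_param :: "(complex^3) set \<Rightarrow> (real^5) set \<Rightarrow> (real^5 \<Rightarrow> complex^3) \<Rightarrow> bool" where
  "local_param M V X \<longleftrightarrow> open V \<and> smooth_on V X \<and>
     openin (top_of_set M) (X ` V) \<and> (\<exists>Y. homeomorphism V (X ` V) X Y) \<and>
     (\<forall>x\<in>V. inj (frechet_derivative X (at x)))"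

definition partial_deriv :: "5 \<Rightarrow> (real^5 \<Rightarrow> 'b::real_normed_vector) \<Rightarrow> real^5 \<Rightarrow> 'b" where
  "partial_deriv i f x = frechet_derivative f (at x) (axis i 1)"

text \<open>A complex tangent vector of M is of type (0,1) iff it is annihilated by dz_1, dz_2, dz_3.
  In the coordinates given by \<open>X\<close>, the field \<open>L = (\<Sum>i. c\<^sub>i \<partial>/\<partial>x\<^sub>i)\<close> is thus a section of
  T^{0,1}M iff \<open>L\<close> kills the three components of \<open>X\<close>.\<close>

definition CR_vector_field ::
    "(real^5) set \<Rightarrow> (real^5 \<Rightarrow> complex^3) \<Rightarrow> (real^5 \<Rightarrow> complex^5) \<Rightarrow> bool" where
  "CR_vector_field V X c \<longleftrightarrow> smooth_on V c \<and>
     (\<forall>x\<in>V. \<forall>j. (\<Sum>i\<in>UNIV. c x $ i * partial_deriv i X x $ j) = 0)"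

text \<open>\<open>L g = 0\<close> on \<open>V\<close> in the sense of distributions, where \<open>L = (\<Sum>i. c\<^sub>i \<partial>/\<partial>x\<^sub>i)\<close>;
  the formal transpose of \<open>L\<close> is \<open>\<phi> \<mapsto> - (\<Sum>i. \<partial>(c\<^sub>i \<phi>)/\<partial>x\<^sub>i)\<close>.\<close>

definition weakly_annihilates ::
    "(real^5) set \<Rightarrow> (real^5 \<Rightarrow> complex^5) \<Rightarrow> (real^5 \<Rightarrow> complex) \<Rightarrow> bool" where
  "weakly_annihilates V c g \<longleftrightarrow> (\<forall>\<phi>. test_function V \<phi> \<longrightarrow>
     (LINT x:V|lborel. g x * (\<Sum>i\<in>UNIV. partial_deriv i (\<lambda>y. c y $ i * \<phi> y) x)) = 0)"

text \<open>The algebra CR(D) for \<open>D\<close> open in the hypersurface \<open>M\<close>. Functions on \<open>D\<close> are represented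
  by total functions that are \<open>undefined\<close> off \<open>D\<close>.\<close>

definition CR :: "(complex^3) set \<Rightarrow> (complex^3) set \<Rightarrow> (complex^3 \<Rightarrow> complex) set" where
  "CR M D = {f \<in> extensional D. continuous_on D f \<and>
     (\<forall>V X c. local_param M V X \<and> X ` V \<subseteq> D \<and> CR_vector_field V X c \<longrightarrow>
        weakly_annihilates V c (f \<circ> X))}"

definition H_pair :: "(complex^3) set \<Rightarrow> (complex^3) set \<Rightarrow> (complex^3) set \<Rightarrow> bool" where
  "H_pair M \<Omega> K \<longleftrightarrow> openin (top_of_set M) \<Omega> \<and> connected \<Omega> \<and> compact K \<and> K \<subseteq> \<Omega> \<and>
     connected (\<Omega> - K) \<and> \<Omega> - K \<noteq> {}"

definition H_principle :: "(complex^3) set \<Rightarrow> (complex^3) set \<Rightarrow> (complex^3) set \<Rightarrow> bool" where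
  "H_principle M \<Omega> K \<longleftrightarrow> H_pair M \<Omega> K \<and>
     (\<lambda>F. restrict F (\<Omega> - K)) ` CR M \<Omega> = CR M (\<Omega> - K)"

text \<open>The empty set needs separate treatment because \<open>infdist x {} = 0\<close>; its
  neighbourhoods are empty.\<close>

definition closed_nhd :: "'a::metric_space set \<Rightarrow> 'a set \<Rightarrow> real \<Rightarrow> 'a set" where
  "closed_nhd M K \<epsilon> = {x \<in> M. K \<noteq> {} \<and> infdist x K \<le> \<epsilon>}"

definition quadric :: "(complex^3) set" where
  "quadric = {z. (cmod (z $ 1))\<^sup>2 + (cmod (z $ 2))\<^sup>2 = 1 + (cmod (z $ 3))\<^sup>2}"

definition S3 :: "(complex^3) set" where
  "S3 = quadric \<inter> {z. z $ 3 = 0}"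

end

(* Away from S^3 = {z_3 = 0} the quadric is a circle bundle over {|z| > 1} in C^2, via
   (z, t) |-> (z, rho(z) e^{it}) with rho(z)^2 = |z|^2 - 1.  A CR function f expands along the circles
   as f = sum_m h_m(z) z_3^m, and the CR equations say exactly that each h_m is holomorphic where it is
   defined.  The neighbourhood K^eps is invariant under rotation of z_3, so the h_m live on the shell
   W around K in C^2.
   For m < 0, boundedness of f at points of S^3 off K^eps forces h_m -> 0 there, hence h_m = 0 near
   such points by uniqueness across the boundary; since K^eps does not contain S^3, which is connected,
   h_m = 0 on all of W.
   For m >= 0, a complex tangent disc {z + eta v}, v orthogonal to z, leaves the ball at rate
   |z|^2 + |eta|^2, so its boundary circle lies in W even for z near K.  The means of h_m over these
   circles extend h_m (independence of the choices follows by moving z radially outward until the whole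
   disc lies in W), and their decay makes sum_m h_m z_3^m converge up to S^3.  The extension is
   locally a uniform limit of polynomials in z_3 with holomorphic coefficients, hence CR. *)
theory Submission
  imports Defs "HOL-Complex_Analysis.Conformal_Mappings"
begin

subsection \<open>Calculus of \<open>Ck_on\<close>\<close>

text \<open>The coefficients h_m are at the outset only continuous, with weak Cauchy-Riemann
  equations. Regularity theory in two variables is avoided by working with \<open>hol2\<close>,
  uniform approximability on compact sets by C^1 functions with complex linear derivative:
  mollification produces it, it passes to complex lines and to circle means, and it approximates the
  extended series by functions that can be integrated by parts. Identity theorems then reduce to one
  variable along real segments. A chart of the circle bundle misses one angle, so the weak equation
  for h_m is a sum of two chart equations weighted by a partition of unity on the circle. Three
  demands limit eps: the circles of radius 2 eps used reach up to 9 eps away from K and must stay in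
  Omega; eps at most 1/2 absorbs fourth powers; and some point of S^3 is farther than eps from K,
  where the zeros of the negative coefficients start. The H-principle also asks for a connected
  complement of the thickened set; this follows from connectedness of Omega by pushing a
  neighbourhood of K into that complement.\<close>

lemma Ck_on_imp_continuous_on: "Ck_on k S f \<Longrightarrow> continuous_on S f"
proof (cases k)
  case (Suc n)
  assume "Ck_on k S f"
  then have "f differentiable_on S"
    unfolding Suc by (auto simp: differentiable_on_def intro: differentiable_at_withinI)
  then show ?thesis by (rule differentiable_imp_continuous_on)
qed auto

lemma Ck_on_SucD: "Ck_on (Suc k) S f \<Longrightarrow> Ck_on k S f"
proof (induction k arbitrary: f)
  case 0
  then show ?case using Ck_on_imp_continuous_on[OF 0] by simp
next
  case (Suc k)
  have "Ck_on k S (\<lambda>x. frechet_derivative f (at x) v)" for v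
    by (rule Suc.IH) (use Suc.prems in simp)
  with Suc.prems show ?case by simp
qed

lemma Ck_on_subset: "Ck_on k S f \<Longrightarrow> T \<subseteq> S \<Longrightarrow> Ck_on k T f"
  by (induction k arbitrary: f) (auto intro: continuous_on_subset)

text \<open>\<open>frechet_derivative\<close> is a choice among the maps satisfying the derivative
  predicate, and that predicate is local; the equality therefore also holds at points without a
  derivative.\<close>

lemma frechet_derivative_cong_open:
  assumes "open S" "x \<in> S" "\<And>y. y \<in> S \<Longrightarrow> f y = g y"
  shows "frechet_derivative f (at x) = frechet_derivative g (at x)"
proof -
  have "(f has_derivative D) (at x) \<longleftrightarrow> (g has_derivative D) (at x)" for D
    using has_derivative_transform_within_open[OF _ assms(1,2)] assms(3) by metis
  then show ?thesis unfolding frechet_derivative_def by simp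
qed

lemma Ck_on_cong:
  assumes "open S" "\<And>x. x \<in> S \<Longrightarrow> f x = g x"
  shows "Ck_on k S f \<longleftrightarrow> Ck_on k S g"
  using assms(2)
proof (induction k arbitrary: f g)
  case 0
  then show ?case by (auto cong: continuous_on_cong)
next
  case (Suc k)
  have "f differentiable at x \<longleftrightarrow> g differentiable at x" if "x \<in> S" for x
    unfolding differentiable_def
    using has_derivative_transform_within_open[OF _ assms(1) that] Suc.prems by metis
  moreover have "Ck_on k S (\<lambda>x. frechet_derivative f (at x) v)
      = Ck_on k S (\<lambda>x. frechet_derivative g (at x) v)" for v
    by (rule Suc.IH) (metis frechet_derivative_cong_open[OF assms(1)] Suc.prems)
  ultimately show ?case by simp
qed

text \<open>Replaces the choice term in \<open>Ck_on\<close> by an explicit derivative formula; most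
  closure rules below go through it.\<close>

lemma Ck_on_SucI:
  assumes "open S" "\<And>x. x \<in> S \<Longrightarrow> (f has_derivative f' x) (at x)"
    "\<And>v. Ck_on k S (\<lambda>x. f' x v)"
  shows "Ck_on (Suc k) S f"
proof -
  have "Ck_on k S (\<lambda>x. frechet_derivative f (at x) v) = Ck_on k S (\<lambda>x. f' x v)" for v
    by (rule Ck_on_cong[OF assms(1)]) (metis assms(2) frechet_derivative_at)
  with assms show ?thesis by (auto simp: differentiable_def)
qed

lemma Ck_on_Suc_has_derivative:
  "Ck_on (Suc k) S f \<Longrightarrow> x \<in> S \<Longrightarrow> (f has_derivative frechet_derivative f (at x)) (at x)"
  by (simp add: frechet_derivative_works)

lemma Ck_on_const: "open S \<Longrightarrow> Ck_on k S (\<lambda>x. c)"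
proof (induction k arbitrary: c)
  case (Suc k)
  show ?case by (rule Ck_on_SucI[where f'="\<lambda>x v. 0"]) (use Suc in auto)
qed auto

lemma Ck_on_bounded_linear_comp:
  assumes "open S" "bounded_linear L" "Ck_on k S f"
  shows "Ck_on k S (\<lambda>x. L (f x))"
  using assms(3)
proof (induction k arbitrary: f)
  case 0
  then show ?case using assms(2) by (auto intro: bounded_linear.continuous_on)
next
  case (Suc k)
  show ?case
    by (rule Ck_on_SucI[where f'="\<lambda>x v. L (frechet_derivative f (at x) v)"])
      (use Suc assms in \<open>auto intro!: bounded_linear.has_derivative[OF assms(2)] Ck_on_Suc_has_derivative\<close>)
qed

lemma Ck_on_linear:
  assumes "open S" "bounded_linear L"
  shows "Ck_on k S L"
proof (cases k)
  case 0
  then show ?thesis using assms linear_continuous_on by auto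
next
  case (Suc n)
  show ?thesis unfolding Suc
    by (rule Ck_on_SucI[where f'="\<lambda>x. L"])
      (use assms Ck_on_const in \<open>auto intro: bounded_linear_imp_has_derivative\<close>)
qed

lemma Ck_on_add:
  assumes "open S" "Ck_on k S f" "Ck_on k S g"
  shows "Ck_on k S (\<lambda>x. f x + g x)"
  using assms(2,3)
proof (induction k arbitrary: f g)
  case 0
  then show ?case by (auto intro: continuous_intros)
next
  case (Suc k)
  show ?case
    by (rule Ck_on_SucI[where f'="\<lambda>x v. frechet_derivative f (at x) v + frechet_derivative g (at x) v"])
      (use Suc assms in \<open>auto intro!: has_derivative_add Ck_on_Suc_has_derivative\<close>)
qed

lemma Ck_on_sum:
  assumes "open S" "\<And>i. i \<in> I \<Longrightarrow> Ck_on k S (f i)"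
  shows "Ck_on k S (\<lambda>x. \<Sum>i\<in>I. f i x)"
  using assms(2)
  by (induction I rule: infinite_finite_induct) (auto intro: Ck_on_const Ck_on_add assms(1))

text \<open>One Leibniz induction serves products, scalar multiples and inner products. It runs over
  all pairs \<open>f\<close>, \<open>g\<close>, because each term of the product rule pairs a
  derivative with an undifferentiated factor, whose order is lowered to \<open>k\<close>.\<close>

lemma Ck_on_bilinear:
  assumes "open S" "bounded_bilinear B" "Ck_on k S f" "Ck_on k S g"
  shows "Ck_on k S (\<lambda>x. B (f x) (g x))"
  using assms(3,4)
proof (induction k arbitrary: f g)
  case 0
  then show ?case using bounded_bilinear.continuous_on[OF assms(2)] by auto
next
  case (Suc k)
  show ?case
  proof (rule Ck_on_SucI[where f'="\<lambda>x v. B (f x) (frechet_derivative g (at x) v)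
        + B (frechet_derivative f (at x) v) (g x)"])
    show "((\<lambda>x. B (f x) (g x)) has_derivative (\<lambda>v. B (f x) (frechet_derivative g (at x) v)
        + B (frechet_derivative f (at x) v) (g x))) (at x)" if "x \<in> S" for x
      by (intro bounded_bilinear.FDERIV[OF assms(2)] Ck_on_Suc_has_derivative[OF _ that])
        (use Suc in auto)
    show "Ck_on k S (\<lambda>x. B (f x) (frechet_derivative g (at x) v)
        + B (frechet_derivative f (at x) v) (g x))" for v
      by (intro Ck_on_add assms(1) Suc.IH) (use Suc.prems Ck_on_SucD in auto)
  qed (fact assms(1))
qed

text \<open>The family \<open>g n\<close> consists of the iterated derivatives of \<open>g 0\<close>.\<close>

lemma Ck_on_compose_real:
  fixes f :: "'a::euclidean_space \<Rightarrow> real"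
  assumes "open S" "\<And>n t. t \<in> J \<Longrightarrow> (g n has_vector_derivative g (Suc n) t) (at t)"
    "f ` S \<subseteq> J" "\<And>k. Ck_on k S f"
  shows "Ck_on k S (\<lambda>x. g n (f x))"
proof (induction k arbitrary: n)
  case 0
  have "continuous_on (f ` S) (g n)"
    using assms(3) has_vector_derivative_continuous[OF assms(2)]
    by (intro continuous_at_imp_continuous_on) blast
  then show ?case using assms(4)[of 0] continuous_on_compose[of S f "g n"] by (auto simp: o_def)
next
  case (Suc k)
  show ?case
  proof (rule Ck_on_SucI[where f'="\<lambda>x v. frechet_derivative f (at x) v *\<^sub>R g (Suc n) (f x)"])
    show "((\<lambda>x. g n (f x)) has_derivative (\<lambda>v. frechet_derivative f (at x) v *\<^sub>R g (Suc n) (f x))) (at x)"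
      if "x \<in> S" for x
      using has_derivative_compose[OF Ck_on_Suc_has_derivative[OF assms(4) that]]
        assms(2)[of "f x" n] assms(3) that
      by (auto simp: has_vector_derivative_def)
    show "Ck_on k S (\<lambda>x. frechet_derivative f (at x) v *\<^sub>R g (Suc n) (f x))" for v
      by (rule Ck_on_bilinear[OF assms(1) bounded_bilinear_scaleR])
        (use assms(4)[of "Suc k"] Suc in auto)
  qed (fact assms(1))
qed

lemma Ck_on_Un:
  assumes "open S" "open T" "Ck_on k S f" "Ck_on k T f"
  shows "Ck_on k (S \<union> T) f"
  using assms(3,4) by (induction k arbitrary: f) (auto intro: continuous_on_open_Un assms)

lemma smooth_on_const: "open S \<Longrightarrow> smooth_on S (\<lambda>x. c)"
  by (simp add: smooth_on_def Ck_on_const)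

lemma smooth_on_linear: "open S \<Longrightarrow> bounded_linear L \<Longrightarrow> smooth_on S L"
  by (simp add: smooth_on_def Ck_on_linear)

lemma smooth_on_bounded_linear_comp:
  "open S \<Longrightarrow> bounded_linear L \<Longrightarrow> smooth_on S f \<Longrightarrow> smooth_on S (\<lambda>x. L (f x))"
  by (simp add: smooth_on_def Ck_on_bounded_linear_comp)

lemma smooth_on_add:
  "open S \<Longrightarrow> smooth_on S f \<Longrightarrow> smooth_on S g \<Longrightarrow> smooth_on S (\<lambda>x. f x + g x)"
  by (simp add: smooth_on_def Ck_on_add)

lemma smooth_on_sum:
  "open S \<Longrightarrow> (\<And>i. i \<in> I \<Longrightarrow> smooth_on S (f i)) \<Longrightarrow> smooth_on S (\<lambda>x. \<Sum>i\<in>I. f i x)"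
  by (simp add: smooth_on_def Ck_on_sum)

lemma smooth_on_mult:
  fixes f :: "'a::euclidean_space \<Rightarrow> 'b::real_normed_algebra"
  shows "open S \<Longrightarrow> smooth_on S f \<Longrightarrow> smooth_on S g \<Longrightarrow> smooth_on S (\<lambda>x. f x * g x)"
  by (simp add: smooth_on_def Ck_on_bilinear[OF _ bounded_bilinear_mult])

lemma smooth_on_diff:
  assumes "open S" "smooth_on S f" "smooth_on S g"
  shows "smooth_on S (\<lambda>x. f x - g x)"
  using smooth_on_add[OF assms(1,2) smooth_on_bounded_linear_comp[OF assms(1)
      bounded_linear_minus[OF bounded_linear_ident] assms(3)]] by simp

lemma smooth_on_compose_real:
  fixes f :: "'a::euclidean_space \<Rightarrow> real"
  assumes "open S" "\<And>n t. t \<in> J \<Longrightarrow> (g n has_vector_derivative g (Suc n) t) (at t)"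
    "f ` S \<subseteq> J" "smooth_on S f"
  shows "smooth_on S (\<lambda>x. g 0 (f x))"
  using Ck_on_compose_real[of S J g f _ 0] assms by (auto simp: smooth_on_def)

lemma smooth_on_subset: "smooth_on S f \<Longrightarrow> T \<subseteq> S \<Longrightarrow> smooth_on T f"
  by (auto simp: smooth_on_def intro: Ck_on_subset)

lemma smooth_on_cong:
  assumes "open S" "\<And>x. x \<in> S \<Longrightarrow> f x = g x"
  shows "smooth_on S f \<longleftrightarrow> smooth_on S g"
  using Ck_on_cong[OF assms] by (simp add: smooth_on_def)

lemma smooth_on_Un:
  "open S \<Longrightarrow> open T \<Longrightarrow> smooth_on S f \<Longrightarrow> smooth_on T f \<Longrightarrow> smooth_on (S \<union> T) f"
  by (simp add: smooth_on_def Ck_on_Un)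

text \<open>\<open>V\<close> and the complement of \<open>C\<close> are open and cover the space,
  and on the second set the extended function is identically zero. This turns functions given in
  coordinates into global test functions.\<close>

lemma smooth_on_extend_zero:
  assumes "open V" "closed C" "C \<subseteq> V" "smooth_on V f" "\<And>x. x \<in> V - C \<Longrightarrow> f x = 0"
  shows "smooth_on UNIV (\<lambda>x. if x \<in> V then f x else 0)" (is "smooth_on _ ?g")
proof -
  have "smooth_on (V \<union> - C) ?g"
  proof (rule smooth_on_Un)
    show "smooth_on V ?g" using assms smooth_on_cong[of V f ?g] by auto
    show "smooth_on (- C) ?g"
      using smooth_on_cong[of "- C" "\<lambda>x. 0" ?g] smooth_on_const[of "-C" 0] assms by force
  qed (use assms in auto)
  moreover have "V \<union> - C = UNIV" using assms by auto
  ultimately show ?thesis by simp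
qed

lemma smooth_on_has_derivative:
  "smooth_on S f \<Longrightarrow> x \<in> S \<Longrightarrow> (f has_derivative frechet_derivative f (at x)) (at x)"
  unfolding smooth_on_def by (rule Ck_on_Suc_has_derivative) (erule spec)

lemma smooth_on_frechet_derivative:
  "smooth_on S f \<Longrightarrow> smooth_on S (\<lambda>x. frechet_derivative f (at x) v)"
  unfolding smooth_on_def
proof
  fix k assume "\<forall>k. Ck_on k S f"
  then have "Ck_on (Suc k) S f" ..
  then show "Ck_on k S (\<lambda>x. frechet_derivative f (at x) v)" by simp
qed

lemma smooth_on_imp_continuous_on: "smooth_on S f \<Longrightarrow> continuous_on S f"
  unfolding smooth_on_def by (rule Ck_on_imp_continuous_on) (erule spec)

lemma bounded_linear_axis: "bounded_linear (axis i :: 'b::euclidean_space \<Rightarrow> 'b^'n)"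
  by (rule linear_conv_bounded_linear[THEN iffD1], rule linearI) (auto simp: vec_eq_iff axis_def)

lemma vec_eq_sum_axis: "(v :: 'b::euclidean_space^'n) = (\<Sum>i\<in>UNIV. axis i (v $ i))"
proof -
  have "(\<Sum>i\<in>UNIV. axis i (v $ i) $ j) = (\<Sum>i\<in>UNIV. if i = j then v $ i else 0)" for j
    by (rule sum.cong) (auto simp: axis_def)
  then show ?thesis by (simp add: vec_eq_iff)
qed

lemma smooth_on_vec:
  fixes f :: "'a::euclidean_space \<Rightarrow> 'b::euclidean_space ^ 'n"
  assumes "open S" "\<And>i. smooth_on S (\<lambda>x. f x $ i)"
  shows "smooth_on S f"
proof -
  have "smooth_on S (\<lambda>x. \<Sum>i\<in>UNIV. axis i (f x $ i))"
    by (rule smooth_on_sum[OF assms(1) smooth_on_bounded_linear_comp[OF assms(1) bounded_linear_axis assms(2)]])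
  then show ?thesis unfolding vec_eq_sum_axis[symmetric] .
qed

subsection \<open>Smooth cutoff functions\<close>

text \<open>The functions p(1/t) exp(-1/t), continued by 0, form a family closed under
  differentiation, so one derivative computation makes the classical flat function smooth.\<close>

definition flat :: "real poly \<Rightarrow> real \<Rightarrow> real" where
  "flat p t = (if t > 0 then poly p (inverse t) * exp (- inverse t) else 0)"

text \<open>With s = 1/t one has ds/dt = -s^2, so p(s) exp(-s) differentiates to s^2 (p - p')(s)
  exp(-s); the two \<open>pCons 0\<close> are the factor s^2.\<close>

definition flat_pderiv :: "real poly \<Rightarrow> real poly" where
  "flat_pderiv p = pCons 0 (pCons 0 (p - pderiv p))"

lemma poly_exp_tendsto_0: "((\<lambda>x::real. poly p x * exp (- x)) \<longlongrightarrow> 0) at_top"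
proof -
  have "((\<lambda>x::real. (\<Sum>i\<le>degree p. coeff p i * (x ^ i / exp x))) \<longlongrightarrow> (\<Sum>i\<le>degree p. coeff p i * 0)) at_top"
    by (intro tendsto_intros tendsto_power_div_exp_0)
  then show ?thesis by (simp add: poly_altdef sum_distrib_right exp_minus divide_inverse mult.assoc)
qed

lemma flat_has_vector_derivative:
  "(flat p has_vector_derivative flat (flat_pderiv p) t) (at t)"
proof (cases t "0::real" rule: linorder_cases)
  case less
  have "((\<lambda>t. 0) has_vector_derivative 0) (at t)" by simp
  then have "(flat p has_vector_derivative 0) (at t)"
    by (rule has_vector_derivative_transform_within_open[of _ _ _ "{..<0}"]) (use less in \<open>auto simp: flat_def\<close>)
  then show ?thesis using less by (simp add: flat_def)
next
  case greater
  have "((\<lambda>t. poly p (inverse t) * exp (- inverse t)) has_real_derivative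
      flat (flat_pderiv p) t) (at t)"
    by (rule DERIV_cong[OF DERIV_mult[OF DERIV_chain2[OF poly_DERIV DERIV_inverse]
          DERIV_chain2[OF DERIV_exp DERIV_minus[OF DERIV_inverse]]]])
      (use greater in \<open>simp_all add: flat_def flat_pderiv_def algebra_simps power2_eq_square\<close>)
  then have "((\<lambda>t. poly p (inverse t) * exp (- inverse t)) has_vector_derivative flat (flat_pderiv p) t) (at t)"
    by (simp add: has_real_derivative_iff_has_vector_derivative)
  then show ?thesis
    by (rule has_vector_derivative_transform_within_open[of _ _ _ "{0<..}"]) (use greater in \<open>auto simp: flat_def\<close>)
next
  case equal
  \<comment> \<open>The difference quotient at 0 has the same shape, with the polynomial multiplied
    by its variable, and the exponential wins.\<close>
  have R: "((\<lambda>y. flat p y / y) \<longlongrightarrow> 0) (at_right 0)"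
  proof -
    have "((\<lambda>y::real. poly (pCons 0 p) (inverse y) * exp (- inverse y)) \<longlongrightarrow> 0) (at_right 0)"
      using filterlim_compose[OF poly_exp_tendsto_0 filterlim_inverse_at_top_right] .
    then show ?thesis
      by (rule Lim_transform_eventually)
        (rule eventually_mono[OF eventually_at_right_less], simp add: flat_def field_simps)
  qed
  have L: "((\<lambda>y. flat p y / y) \<longlongrightarrow> 0) (at_left 0)"
    by (rule tendsto_eventually) (simp add: flat_def eventually_at_filter)
  have "(flat p has_real_derivative 0) (at 0)"
    unfolding has_field_derivative_iff using R L
    by (simp add: filterlim_at_split flat_def[of p 0])
  then show ?thesis using equal by (simp add: has_real_derivative_iff_has_vector_derivative flat_def)
qed

lemma smooth_on_flat_compose:
  fixes f :: "'a::euclidean_space \<Rightarrow> real"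
  assumes "open S" "smooth_on S f"
  shows "smooth_on S (\<lambda>x. flat p (f x))"
  using smooth_on_compose_real[of S UNIV "\<lambda>n. flat ((flat_pderiv ^^ n) p)" f] assms
    flat_has_vector_derivative by auto

definition bump :: "real \<Rightarrow> real" where "bump t = flat 1 t"

lemma bump_pos: "t > 0 \<Longrightarrow> bump t > 0" and bump_0: "t \<le> 0 \<Longrightarrow> bump t = 0"
  and bump_nonneg: "bump t \<ge> 0"
  by (auto simp: bump_def flat_def)

text \<open>Nesting \<open>bump\<close> in itself gives a smooth step from 1 to 0 over the unit
  interval with only a constant in the denominator.\<close>

definition cutoff :: "real \<Rightarrow> real" where
  "cutoff t = bump (bump 1 - bump t) / bump (bump 1)"

lemma cutoff_eq_1: "t \<le> 0 \<Longrightarrow> cutoff t = 1"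
  using bump_pos[of "bump 1"] bump_pos[of 1] by (auto simp: cutoff_def bump_0)

lemma cutoff_eq_0: "t \<ge> 1 \<Longrightarrow> cutoff t = 0"
proof -
  assume "t \<ge> 1"
  then have "bump t \<ge> bump 1" by (auto simp: bump_def flat_def field_simps)
  then show ?thesis by (simp add: cutoff_def bump_0)
qed

lemma smooth_on_bump:
  "open S \<Longrightarrow> smooth_on S f \<Longrightarrow> smooth_on S (\<lambda>x. bump (f x))"
  unfolding bump_def by (rule smooth_on_flat_compose)

lemma smooth_on_cutoff:
  assumes "open S" "smooth_on S f"
  shows "smooth_on S (\<lambda>x. cutoff (f x))"
  unfolding cutoff_def divide_inverse
  by (intro smooth_on_mult smooth_on_bump smooth_on_diff smooth_on_const assms)

lemma smooth_on_of_real: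
  "open S \<Longrightarrow> smooth_on S f \<Longrightarrow> smooth_on S (\<lambda>x. complex_of_real (f x))"
  by (rule smooth_on_bounded_linear_comp[OF _ bounded_linear_of_real])

lemma smooth_on_dist_square:
  fixes a :: "'a::euclidean_space"
  assumes "open S"
  shows "smooth_on S (\<lambda>x. (norm (x - a))\<^sup>2)"
proof -
  have "smooth_on S (\<lambda>x. x - a)"
    by (intro smooth_on_diff smooth_on_linear smooth_on_const assms bounded_linear_ident)
  then show ?thesis
    unfolding smooth_on_def power2_norm_eq_inner
    by (auto intro: Ck_on_bilinear[OF assms bounded_bilinear_inner])
qed

lemma smooth_on_powr:
  fixes f :: "'a::euclidean_space \<Rightarrow> real"
  assumes "open S" "smooth_on S f" "\<And>x. x \<in> S \<Longrightarrow> f x > 0"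
  shows "smooth_on S (\<lambda>x. f x powr a)"
proof -
  \<comment> \<open>The iterated derivatives of t^a in closed form: a falling factorial times t^(a -
    n).\<close>
  define g where "g n t = (\<Prod>i<n. a - real i) * t powr (a - real n)" for n t
  have "(g n has_vector_derivative g (Suc n) t) (at t)" if "t \<in> {0<..}" for n t
    unfolding g_def has_real_derivative_iff_has_vector_derivative[symmetric] using that
    by (auto intro!: derivative_eq_intros simp: algebra_simps)
  with smooth_on_compose_real[of S "{0<..}" g f] assms have "smooth_on S (\<lambda>x. g 0 (f x))"
    by auto
  then show ?thesis by (simp add: g_def)
qed

lemma smooth_on_cis:
  fixes f :: "'a::euclidean_space \<Rightarrow> real"
  assumes "open S" "smooth_on S f"
  shows "smooth_on S (\<lambda>x. cis (f x))"
proof -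
  have "((\<lambda>t. \<i> ^ n * cis t) has_vector_derivative \<i> ^ Suc n * cis t) (at t)" for n t
  proof -
    have "((\<lambda>t. \<i> ^ n * exp (\<i> * of_real t)) has_vector_derivative \<i> ^ Suc n * exp (\<i> * of_real t)) (at t)"
      by (rule has_vector_derivative_real_field) (auto intro!: derivative_eq_intros)
    then show ?thesis by (simp add: cis_conv_exp)
  qed
  from smooth_on_compose_real[of S UNIV "\<lambda>n t. \<i> ^ n * cis t" f] this assms show ?thesis by auto
qed

lemma smooth_on_cos:
  fixes f :: "'a::euclidean_space \<Rightarrow> real"
  shows "open S \<Longrightarrow> smooth_on S f \<Longrightarrow> smooth_on S (\<lambda>x. cos (f x))"
  using smooth_on_bounded_linear_comp[OF _ bounded_linear_Re smooth_on_cis, of S f] by simp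



subsection \<open>The transposed operator on test functions\<close>

definition transposed :: "(real^5 \<Rightarrow> complex^5) \<Rightarrow> (real^5 \<Rightarrow> complex) \<Rightarrow> real^5 \<Rightarrow> complex" where
  "transposed c \<phi> x = (\<Sum>i\<in>UNIV. partial_deriv i (\<lambda>y. c y $ i * \<phi> y) x)"

definition tsupp :: "('a::euclidean_space \<Rightarrow> complex) \<Rightarrow> 'a set" where
  "tsupp \<phi> = closure {x. \<phi> x \<noteq> 0}"

lemma weakly_annihilates_iff:
  "weakly_annihilates V c g \<longleftrightarrow>
    (\<forall>\<phi>. test_function V \<phi> \<longrightarrow> (LINT x:V|lborel. g x * transposed c \<phi> x) = 0)"
  by (simp add: weakly_annihilates_def transposed_def)

lemma closed_tsupp [simp]: "closed (tsupp \<phi>)"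
  by (simp add: tsupp_def)

lemma tsupp_zero: "x \<notin> tsupp \<phi> \<Longrightarrow> \<phi> x = 0"
  unfolding tsupp_def using closure_subset[of "{x. \<phi> x \<noteq> 0}"] by blast

lemma tsupp_subset_closed: "closed C \<Longrightarrow> (\<And>x. x \<notin> C \<Longrightarrow> \<phi> x = 0) \<Longrightarrow> tsupp \<phi> \<subseteq> C"
  unfolding tsupp_def by (intro closure_minimal) auto

lemma test_functionD:
  assumes "test_function V \<phi>"
  shows "smooth_on S \<phi>" "compact (tsupp \<phi>)" "tsupp \<phi> \<subseteq> V"
  using assms smooth_on_subset by (auto simp: test_function_def tsupp_def)

lemma test_functionI:
  "smooth_on UNIV \<phi> \<Longrightarrow> compact C \<Longrightarrow> C \<subseteq> V \<Longrightarrow> (\<And>x. x \<notin> C \<Longrightarrow> \<phi> x = 0) \<Longrightarrow> test_function V \<phi>"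
  using compact_Int_closed[of C "tsupp \<phi>"] tsupp_subset_closed[of C \<phi>] compact_imp_closed[of C]
  by (auto simp: test_function_def tsupp_def Int_absorb1)

lemma test_function_times:
  assumes "test_function V \<phi>" "smooth_on UNIV \<theta>"
  shows "test_function V (\<lambda>x. \<theta> x * \<phi> x)" "tsupp (\<lambda>x. \<theta> x * \<phi> x) \<subseteq> tsupp \<phi>"
proof -
  show "tsupp (\<lambda>x. \<theta> x * \<phi> x) \<subseteq> tsupp \<phi>"
    by (rule tsupp_subset_closed) (auto simp: tsupp_zero)
  show "test_function V (\<lambda>x. \<theta> x * \<phi> x)"
    by (rule test_functionI[of _ "tsupp \<phi>"])
      (use test_functionD[OF assms(1)] assms(2) in \<open>auto simp: tsupp_zero intro!: smooth_on_mult\<close>)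
qed

lemma smooth_on_coeff_times:
  assumes "open V" "smooth_on V c" "test_function V \<phi>"
  shows "smooth_on V (\<lambda>y. c y $ i * \<phi> y :: complex)"
  by (intro smooth_on_mult smooth_on_bounded_linear_comp[OF _ bounded_linear_vec_nth] assms
      test_functionD[OF assms(3)])

lemma transposed_continuous:
  assumes "open V" "smooth_on V c" "test_function V \<phi>"
  shows "continuous_on V (transposed c \<phi>)"
  unfolding transposed_def partial_deriv_def
  by (intro continuous_intros smooth_on_imp_continuous_on smooth_on_frechet_derivative
      smooth_on_coeff_times assms)

lemma transposed_eq_0:
  assumes "x \<notin> tsupp \<phi>"
  shows "transposed c \<phi> x = 0"
proof -
  have "frechet_derivative (\<lambda>y. c y $ i * \<phi> y) (at x) = frechet_derivative (\<lambda>y. 0::complex) (at x)" for i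
    by (rule frechet_derivative_cong_open[of "- tsupp \<phi>"]) (use assms tsupp_zero[of _ \<phi>] in auto)
  then show ?thesis by (simp add: transposed_def partial_deriv_def)
qed

lemma transposed_add:
  assumes "open V" "smooth_on V c" "test_function V \<phi>" "test_function V \<psi>" "x \<in> V"
  shows "transposed c (\<lambda>y. \<phi> y + \<psi> y) x = transposed c \<phi> x + transposed c \<psi> x"
proof -
  have "frechet_derivative (\<lambda>y. c y $ i * (\<phi> y + \<psi> y)) (at x) v =
      frechet_derivative (\<lambda>y. c y $ i * \<phi> y) (at x) v + frechet_derivative (\<lambda>y. c y $ i * \<psi> y) (at x) v" for i v
  proof -
    have "((\<lambda>y. c y $ i * (\<phi> y + \<psi> y)) has_derivative (\<lambda>v. frechet_derivative (\<lambda>y. c y $ i * \<phi> y) (at x) v + frechet_derivative (\<lambda>y. c y $ i * \<psi> y) (at x) v)) (at x)"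
      unfolding distrib_left
      by (intro has_derivative_add smooth_on_has_derivative[OF smooth_on_coeff_times[OF assms(1,2,3)] assms(5)]
          smooth_on_has_derivative[OF smooth_on_coeff_times[OF assms(1,2,4)] assms(5)])
    from fun_cong[OF frechet_derivative_at[OF this], of v] show ?thesis by (rule sym)
  qed
  then show ?thesis by (simp add: transposed_def partial_deriv_def sum.distrib)
qed

lemma set_integrable_compact_support:
  fixes f :: "'a::euclidean_space \<Rightarrow> complex"
  assumes "compact S" "S \<subseteq> V" "continuous_on V f" "\<And>x. x \<in> V - S \<Longrightarrow> f x = 0"
  shows "set_integrable lborel V f" "(LINT x:V|lborel. f x) = (LINT x:S|lborel. f x)"
    "set_integrable lborel S f"
proof -
  have eq: "(\<lambda>x. indicator V x *\<^sub>R f x) = (\<lambda>x. indicator S x *\<^sub>R f x)"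
    using assms by (auto simp: fun_eq_iff indicator_def)
  show "set_integrable lborel S f"
    unfolding set_integrable_def
    using borel_integrable_compact[OF assms(1) continuous_on_subset[OF assms(3,2)]] .
  then show "set_integrable lborel V f" by (simp add: set_integrable_def eq)
  show "(LINT x:V|lborel. f x) = (LINT x:S|lborel. f x)"
    by (simp add: set_lebesgue_integral_def eq)
qed

lemma integrand_props:
  assumes "open V" "smooth_on V c" "test_function V \<phi>" "continuous_on V g"
  shows "set_integrable lborel V (\<lambda>x. g x * transposed c \<phi> x)"
    "(LINT x:V|lborel. g x * transposed c \<phi> x) = (LINT x:tsupp \<phi>|lborel. g x * transposed c \<phi> x)"
    "set_integrable lborel (tsupp \<phi>) (\<lambda>x. g x * transposed c \<phi> x)"
  using set_integrable_compact_support[OF test_functionD(2,3)[OF assms(3)], of "\<lambda>x. g x * transposed c \<phi> x"]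
    continuous_on_mult[OF assms(4) transposed_continuous[OF assms(1-3)]] transposed_eq_0[of _ \<phi> c]
  by auto

section \<open>Integration by parts, uniform limits and localisation for weak equations\<close>

lemma lborel_integral_eq_integral_cbox:
  fixes f :: "'a::euclidean_space \<Rightarrow> 'b::euclidean_space"
  assumes "continuous_on UNIV f" "\<And>x. x \<notin> cbox a b \<Longrightarrow> f x = 0"
  shows "(LINT x|lborel. f x) = integral (cbox a b) f" "integrable lborel f"
proof -
  have si: "set_integrable lborel (cbox a b) f"
    unfolding set_integrable_def
    using borel_integrable_compact[OF compact_cbox continuous_on_subset[OF assms(1)]] by simp
  have e: "(\<lambda>x. indicator (cbox a b) x *\<^sub>R f x) = f"
    using assms(2) by (auto simp: fun_eq_iff indicator_def)
  show "integrable lborel f" using si by (simp add: set_integrable_def e)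
  show "(LINT x|lborel. f x) = integral (cbox a b) f"
    using set_borel_integral_eq_integral(2)[OF si] by (simp add: set_lebesgue_integral_def e)
qed

text \<open>By translation invariance the integral of g(x + t e) does not depend on t;
  differentiation under the integral sign at t = 0 gives the claim.\<close>

lemma integral_derivative_compact_support:
  fixes g :: "'a::euclidean_space \<Rightarrow> complex"
  assumes der: "\<And>x. (g has_derivative g' x) (at x)"
    and cont: "continuous_on UNIV (\<lambda>x. g' x e)"
    and S: "compact S" "\<And>x. x \<notin> S \<Longrightarrow> g x = 0"
  shows "integrable lborel (\<lambda>x. g' x e)" "(LINT x|lborel. g' x e) = 0"
proof -
  have gc: "continuous_on UNIV g"
    using der has_derivative_continuous by (blast intro: continuous_at_imp_continuous_on)
  have g'0: "g' x e = 0" if "x \<notin> S" for x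
  proof -
    have "((\<lambda>x. 0) has_derivative g' x) (at x)"
      by (rule has_derivative_transform_within_open[OF der, of "- S"])
        (use that S compact_imp_closed in auto)
    then have "g' x = (\<lambda>v. 0)" by (metis has_derivative_unique has_derivative_const)
    then show ?thesis by simp
  qed
  \<comment> \<open>\<open>T\<close> collects the supports of all translates with |t| at most 1, so
    that one box serves every t near 0.\<close>
  define T where "T = (\<lambda>(x,t). x - t *\<^sub>R e) ` (S \<times> {-1..1::real})"
  have "compact T" unfolding T_def
    by (intro compact_continuous_image compact_Times S) (auto simp: split_beta intro!: continuous_intros)
  then obtain a where a: "T \<subseteq> cbox (-a) a"
    using bounded_subset_cbox_symmetric compact_imp_bounded by metis
  have inT: "x \<in> cbox (-a) a" if "x + t *\<^sub>R e \<in> S" "t \<in> {-1..1}" for x t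
    using a that unfolding T_def by (force intro!: image_eqI[of _ _ "(x + t *\<^sub>R e, t)"])
  note eq = lborel_integral_eq_integral_cbox[where a="-a" and b=a]
  have inS: "S \<subseteq> cbox (-a) a" using inT[of _ 0] by auto
  show "integrable lborel (\<lambda>x. g' x e)" using eq(2)[OF cont] g'0 inS by blast
  define F where "F t = integral (cbox (-a) a) (\<lambda>x. g (x + t *\<^sub>R e))" for t
  have F: "F t = F 0" if "t \<in> {-1..1}" for t
  proof -
    have ct: "continuous_on UNIV (\<lambda>x. g (x + t *\<^sub>R e))"
      by (rule continuous_on_compose2[OF gc]) (auto intro!: continuous_intros)
    have "F t = (LINT x|lborel. g (x + t *\<^sub>R e))"
      unfolding F_def by (rule eq(1)[OF ct, symmetric]) (use inT[of _ t] that S(2) in blast)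
    also have "\<dots> = (LINT x|distr lborel borel ((+) (t *\<^sub>R e)). g x)"
      by (subst integral_distr) (auto simp: add.commute intro!: borel_measurable_continuous_onI gc)
    also have "\<dots> = (LINT x|lborel. g x)" by (simp add: lborel_distr_plus)
    also have "\<dots> = F 0"
      unfolding F_def using eq(1)[OF gc] S(2) inS by auto
    finally show ?thesis .
  qed
  have "(F has_vector_derivative integral (cbox (-a) a) (\<lambda>x. g' (x + 0 *\<^sub>R e) e)) (at 0 within {-1..1})"
    unfolding F_def
  proof (rule leibniz_rule_vector_derivative)
    show "((\<lambda>t. g (x + t *\<^sub>R e)) has_vector_derivative g' (x + t *\<^sub>R e) e) (at t within {- 1..1})" for x t
    proof -
      have "((\<lambda>t. g (x + t *\<^sub>R e)) has_derivative (\<lambda>s. g' (x + t *\<^sub>R e) (s *\<^sub>R e))) (at t within {- 1..1})"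
        by (rule has_derivative_compose[OF _ der]) (auto intro!: derivative_eq_intros)
      moreover have "g' (x + t *\<^sub>R e) (s *\<^sub>R e) = s *\<^sub>R g' (x + t *\<^sub>R e) e" for s
        using linear_scale[OF has_derivative_linear[OF der]] by blast
      ultimately show ?thesis by (simp add: has_vector_derivative_def)
    qed
    show "(\<lambda>x. g (x + t *\<^sub>R e)) integrable_on cbox (- a) a" for t
      by (intro integrable_continuous continuous_on_compose2[OF gc]) (auto intro!: continuous_intros)
    show "continuous_on ({- 1..1} \<times> cbox (- a) a) (\<lambda>(t, x). g' (x + t *\<^sub>R e) e)"
      unfolding split_beta by (rule continuous_on_compose2[OF cont]) (auto intro!: continuous_intros)
  qed auto
  moreover have "(F has_vector_derivative 0) (at 0 within {-1..1})"
    by (rule has_vector_derivative_transform[OF _ F has_vector_derivative_const]) simp_all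
  ultimately have "integral (cbox (-a) a) (\<lambda>x. g' x e) = 0"
    using at_within_Icc_at[of "-1" "0::real" 1]
      vector_derivative_unique_at[of F "integral (cbox (-a) a) (\<lambda>x. g' x e)" 0 0] by simp
  then show "(LINT x|lborel. g' x e) = 0" using eq(1)[OF cont] g'0 inS by auto
qed

text \<open>Integration by parts: the divergence of c phi w is w times the transposed operator on
  phi plus phi times L w. The last term is zero, and a compactly supported divergence has integral
  zero. Only a neighbourhood \<open>U\<close> of the support has to carry the derivative of
  \<open>w\<close>.\<close>

lemma weak_of_strong:
  assumes V: "open V" "smooth_on V c" "test_function V \<phi>" and U: "open U" "tsupp \<phi> \<subseteq> U" "U \<subseteq> V"
    and w: "\<And>x. x \<in> U \<Longrightarrow> (w has_derivative w' x) (at x)" "\<And>v. continuous_on U (\<lambda>x. w' x v)"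
    and Lw: "\<And>x. x \<in> U \<Longrightarrow> (\<Sum>i\<in>UNIV. c x $ i * w' x (axis i 1)) = 0"
  shows "(LINT x:V|lborel. w x * transposed c \<phi> x) = 0"
proof -
  define D where "D i x = frechet_derivative (\<lambda>y. c y $ i * \<phi> y) (at x)" for i x
  have D: "((\<lambda>y. c y $ i * \<phi> y) has_derivative D i x) (at x)" if "x \<in> U" for i x
    unfolding D_def using smooth_on_has_derivative[OF smooth_on_coeff_times[OF V]] that U by auto
  define g where "g i x = (if x \<in> U then c x $ i * \<phi> x * w x else 0)" for i x
  \<comment> \<open>The derivative is gated by the support instead of \<open>U\<close>. On
    \<open>U\<close> both forms agree, since phi and the derivatives of c phi vanish off the
    support, and this form stays continuous across the edge of \<open>U\<close>.\<close>
  define g' where "g' i x v = (if x \<in> tsupp \<phi> then c x $ i * \<phi> x * w' x v + D i x v * w x else 0)" for i x v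
  have phi0: "D i x v = 0" "\<phi> x = 0" if "x \<in> U - tsupp \<phi>" for i x v
  proof -
    have "frechet_derivative (\<lambda>y. c y $ i * \<phi> y) (at x) = frechet_derivative (\<lambda>y. 0::complex) (at x)" for i
      by (rule frechet_derivative_cong_open[of "- tsupp \<phi>"]) (use that tsupp_zero[of _ \<phi>] in auto)
    then show "D i x v = 0" by (simp add: D_def)
    show "\<phi> x = 0" using that tsupp_zero[of _ \<phi>] by blast
  qed
  have g'U: "g' i x v = c x $ i * \<phi> x * w' x v + D i x v * w x" if "x \<in> U" for i x v
    using that phi0[of x] by (auto simp: g'_def)
  have der: "(g i has_derivative g' i x) (at x)" for i x
  proof (cases "x \<in> U")
    case True
    have "((\<lambda>x. c x $ i * \<phi> x * w x) has_derivative g' i x) (at x)"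
      by (rule has_derivative_eq_rhs[OF has_derivative_mult[OF D[OF True] w(1)[OF True]]])
        (use g'U[OF True] in \<open>auto simp: fun_eq_iff\<close>)
    then show ?thesis
      by (rule has_derivative_transform_within_open[OF _ U(1) True]) (simp add: g_def)
  next
    case False
    then have x: "x \<in> - tsupp \<phi>" using U by auto
    have "g' i x = (\<lambda>v. 0)" using x by (auto simp: g'_def)
    then have "((\<lambda>x. 0) has_derivative g' i x) (at x)" by simp
    then show ?thesis
      by (rule has_derivative_transform_within_open[OF _ _ x])
        (use tsupp_zero[of _ \<phi>] in \<open>auto simp: g_def\<close>)
  qed
  have "continuous_on U w"
    using w(1) has_derivative_continuous by (blast intro: continuous_at_imp_continuous_on)
  moreover have "continuous_on U (\<lambda>x. c x $ i * \<phi> x)" "continuous_on U (\<lambda>x. D i x v)" for i v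
    unfolding D_def using smooth_on_subset[OF smooth_on_coeff_times[OF V] U(3)]
    by (auto intro!: smooth_on_imp_continuous_on smooth_on_frechet_derivative)
  ultimately have "continuous_on U (\<lambda>x. c x $ i * \<phi> x * w' x v + D i x v * w x)" for i v
    by (intro continuous_on_add continuous_on_mult[where f="\<lambda>x. c x $ i * \<phi> x"]
        continuous_on_mult[where f="\<lambda>x. D i x v"] w(2))
  then have "continuous_on U (\<lambda>x. g' i x v)" for i v
    using g'U by (simp cong: continuous_on_cong)
  moreover have "continuous_on (- tsupp \<phi>) (\<lambda>x. g' i x v)" for i v
    by (rule continuous_on_eq[OF continuous_on_const[of _ 0]]) (simp add: g'_def)
  ultimately have "continuous_on (U \<union> - tsupp \<phi>) (\<lambda>x. g' i x v)" for i v
    by (intro continuous_on_open_Un U) auto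
  moreover have "U \<union> - tsupp \<phi> = UNIV" using U by auto
  ultimately have cont: "continuous_on UNIV (\<lambda>x. g' i x v)" for i v by simp
  have int: "integrable lborel (\<lambda>x. g' i x (axis i 1))" "(LINT x|lborel. g' i x (axis i 1)) = 0" for i
    using integral_derivative_compact_support[OF der cont test_functionD(2)[OF V(3)]] U phi0(2)
    by (auto simp: g_def tsupp_zero)
  have "indicator V x *\<^sub>R (w x * transposed c \<phi> x) = (\<Sum>i\<in>UNIV. g' i x (axis i 1))" for x
  proof (cases "x \<in> tsupp \<phi>")
    case True
    then have x: "x \<in> U" "x \<in> V" using U by auto
    have "(\<Sum>i\<in>UNIV. g' i x (axis i 1)) = \<phi> x * (\<Sum>i\<in>UNIV. c x $ i * w' x (axis i 1)) + w x * (\<Sum>i\<in>UNIV. D i x (axis i 1))"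
      by (simp add: g'U[OF x(1)] sum.distrib sum_distrib_left algebra_simps)
    then show ?thesis using Lw[OF x(1)] x by (simp add: transposed_def partial_deriv_def D_def)
  next
    case False
    then show ?thesis by (simp add: transposed_eq_0 g'_def)
  qed
  then have "(LINT x:V|lborel. w x * transposed c \<phi> x) = (LINT x|lborel. (\<Sum>i\<in>UNIV. g' i x (axis i 1)))"
    by (simp add: set_lebesgue_integral_def)
  also have "\<dots> = 0" using int by simp
  finally show ?thesis .
qed

text \<open>The error is at most \<open>\<delta>\<close> times the L^1 norm of the transposed test
  function. The approximant lives on the support only and may change with \<open>\<delta>\<close>,
  so locally uniform approximation by classical solutions is enough.\<close>

lemma weak_limit:
  assumes V: "open V" "smooth_on V c" "test_function V \<phi>" "continuous_on V g"
    and ap: "\<And>\<delta>. \<delta> > 0 \<Longrightarrow> \<exists>w. set_integrable lborel (tsupp \<phi>) (\<lambda>x. w x * transposed c \<phi> x) \<and>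
      (LINT x:tsupp \<phi>|lborel. w x * transposed c \<phi> x) = 0 \<and> (\<forall>x\<in>tsupp \<phi>. norm (g x - w x) \<le> \<delta>)"
  shows "(LINT x:V|lborel. g x * transposed c \<phi> x) = 0"
proof -
  let ?S = "tsupp \<phi>"
  define A where "A = (LINT x:?S|lborel. norm (transposed c \<phi> x))"
  have ti: "set_integrable lborel ?S (\<lambda>x. transposed c \<phi> x)"
    using integrand_props(3)[OF V(1-3), of "\<lambda>_. 1"] by simp
  have b: "norm (LINT x:?S|lborel. g x * transposed c \<phi> x) \<le> \<delta> * A" if d: "\<delta> > 0" for \<delta>
  proof -
    obtain w where w: "set_integrable lborel ?S (\<lambda>x. w x * transposed c \<phi> x)"
      "(LINT x:?S|lborel. w x * transposed c \<phi> x) = 0" "\<And>x. x \<in> ?S \<Longrightarrow> norm (g x - w x) \<le> \<delta>"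
      using ap[OF d] by blast
    have gi: "set_integrable lborel ?S (\<lambda>x. g x * transposed c \<phi> x)"
      by (rule integrand_props(3)[OF V])
    have "(LINT x:?S|lborel. g x * transposed c \<phi> x) =
        (LINT x:?S|lborel. g x * transposed c \<phi> x - w x * transposed c \<phi> x)"
      using set_integral_diff(2)[OF gi w(1)] w(2) by simp
    also have "norm \<dots> \<le> (LINT x:?S|lborel. norm (g x * transposed c \<phi> x - w x * transposed c \<phi> x))"
      by (rule set_integral_norm_bound) (rule set_integral_diff(1)[OF gi w(1)])
    also have "\<dots> \<le> (LINT x:?S|lborel. \<delta> * norm (transposed c \<phi> x))"
    proof (rule set_integral_mono)
      show "set_integrable lborel ?S (\<lambda>x. norm (g x * transposed c \<phi> x - w x * transposed c \<phi> x))"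
        by (rule set_integrable_norm) (rule set_integral_diff(1)[OF gi w(1)])
      show "set_integrable lborel ?S (\<lambda>x. \<delta> * norm (transposed c \<phi> x))"
        by (intro set_integrable_mult_right impI set_integrable_norm ti)
      show "norm (g x * transposed c \<phi> x - w x * transposed c \<phi> x) \<le> \<delta> * norm (transposed c \<phi> x)" if "x \<in> ?S" for x
        using mult_right_mono[OF w(3)[OF that], of "norm (transposed c \<phi> x)"]
        by (simp add: left_diff_distrib[symmetric] norm_mult)
    qed
    also have "\<dots> = \<delta> * A" by (simp add: A_def)
    finally show ?thesis .
  qed
  have "A \<ge> 0" unfolding A_def set_lebesgue_integral_def by (simp add: integral_nonneg_AE)
  then have "norm (LINT x:?S|lborel. g x * transposed c \<phi> x) \<le> e" if "e > 0" for e
  proof -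
    \<comment> \<open>The denominator is \<open>A + 1\<close> because \<open>A\<close> may be
      zero.\<close>
    have "norm (LINT x:?S|lborel. g x * transposed c \<phi> x) \<le> e / (A + 1) * A"
      using b[of "e / (A + 1)"] that \<open>A \<ge> 0\<close> by simp
    also have "\<dots> \<le> e" using that \<open>A \<ge> 0\<close> by (simp add: field_simps)
    finally show ?thesis .
  qed
  then have "norm (LINT x:?S|lborel. g x * transposed c \<phi> x) \<le> 0" by (rule field_le_epsilon[of _ 0, simplified])
  then show ?thesis using integrand_props(2)[OF V] by simp
qed

text \<open>A partition of unity built one ball at a time from a finite subcover of the support:
  \<open>\<phi>\<close> splits into a part supported in the full ball, where the local hypothesis
  applies, and a part supported off the half ball, which the remaining balls cover.\<close>

lemma weakly_annihilates_local:
  assumes V: "open V" "smooth_on V c" "continuous_on V g"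
    and loc: "\<And>a. a \<in> V \<Longrightarrow> \<exists>r>0. \<forall>\<phi>. test_function V \<phi> \<and> tsupp \<phi> \<subseteq> ball a r \<longrightarrow>
      (LINT x:V|lborel. g x * transposed c \<phi> x) = 0"
  shows "weakly_annihilates V c g"
proof -
  obtain r where r: "\<And>a. a \<in> V \<Longrightarrow> r a > 0" "\<And>a \<phi>. a \<in> V \<Longrightarrow> test_function V \<phi> \<Longrightarrow> tsupp \<phi> \<subseteq> ball a (r a) \<Longrightarrow>
      (LINT x:V|lborel. g x * transposed c \<phi> x) = 0"
    using loc by metis
  have fin: "(LINT x:V|lborel. g x * transposed c \<phi> x) = 0"
    if "finite A" "A \<subseteq> V" "test_function V \<phi>" "tsupp \<phi> \<subseteq> (\<Union>a\<in>A. ball a (r a / 2))" for A \<phi>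
    using that
  proof (induction A arbitrary: \<phi> rule: finite_induct)
    case empty
    then have "\<phi> = (\<lambda>x. 0)" using tsupp_zero[of _ \<phi>] by auto
    moreover have "transposed c (\<lambda>x. 0) x = 0" for x
      using transposed_eq_0[of x "\<lambda>x. 0" c] by (simp add: tsupp_def)
    ultimately show ?case by simp
  next
    case (insert a A)
    \<comment> \<open>The argument of \<open>cutoff\<close> is at most 0 within radius r/2 and at
      least 1 beyond 3r/4, where r is \<open>r a\<close>; the support thus stays strictly inside the
      ball of radius r.\<close>
    define \<theta> where "\<theta> x = complex_of_real (cutoff ((4 / (r a)\<^sup>2) * ((norm (x - a))\<^sup>2) - 1))" for x
    have sc: "smooth_on UNIV \<theta>" unfolding \<theta>_def
      by (intro smooth_on_of_real smooth_on_cutoff smooth_on_diff smooth_on_mult smooth_on_const smooth_on_dist_square) auto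
    have ra: "r a > 0" using r insert by auto
    have 1: "\<theta> x = 1" if "x \<in> ball a (r a / 2)" for x
    proof -
      have "(norm (x - a))\<^sup>2 \<le> (r a / 2)\<^sup>2"
        using that by (intro power_mono) (auto simp: dist_norm norm_minus_commute)
      then show ?thesis unfolding \<theta>_def using ra by (subst cutoff_eq_1) (auto simp: field_simps)
    qed
    have 0: "\<theta> x = 0" if "x \<notin> cball a (r a * 3 / 4)" for x
    proof -
      have "(norm (x - a))\<^sup>2 \<ge> (r a * 3 / 4)\<^sup>2"
        using that ra by (intro power_mono) (auto simp: dist_norm norm_minus_commute)
      then have "(norm (x - a))\<^sup>2 * 2 \<ge> (r a)\<^sup>2" using ra
        unfolding power2_eq_square by (simp add: field_simps) (use zero_le_square[of "r a"] in linarith)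
      then show ?thesis unfolding \<theta>_def using ra by (subst cutoff_eq_0) (auto simp: field_simps)
    qed
    let ?f1 = "\<lambda>x. \<theta> x * \<phi> x" and ?f2 = "\<lambda>x. (1 - \<theta> x) * \<phi> x"
    have s2: "smooth_on UNIV (\<lambda>x. 1 - \<theta> x)" by (intro smooth_on_diff smooth_on_const sc) auto
    have t: "test_function V ?f1" "test_function V ?f2"
      using test_function_times(1) insert.prems sc s2 by auto
    have "tsupp ?f1 \<subseteq> cball a (r a * 3 / 4)" by (rule tsupp_subset_closed) (use 0 in auto)
    also have "\<dots> \<subseteq> ball a (r a)" using ra by auto
    finally have I1: "(LINT x:V|lborel. g x * transposed c ?f1 x) = 0"
      using r(2) t(1) insert.prems by blast
    have "tsupp ?f2 \<subseteq> - ball a (r a / 2)" by (rule tsupp_subset_closed) (use 1 in auto)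
    moreover have "tsupp ?f2 \<subseteq> tsupp \<phi>" by (rule test_function_times(2)[OF insert.prems(2) s2])
    ultimately have "tsupp ?f2 \<subseteq> (\<Union>a\<in>A. ball a (r a / 2))" using insert.prems(3) by blast
    then have I2: "(LINT x:V|lborel. g x * transposed c ?f2 x) = 0"
      using insert.IH t(2) insert.prems by blast
    have "(LINT x:V|lborel. g x * transposed c \<phi> x) =
        (LINT x:V|lborel. g x * transposed c ?f1 x + g x * transposed c ?f2 x)"
    proof (rule set_lebesgue_integral_cong)
      show "\<forall>x. x \<in> V \<longrightarrow> g x * transposed c \<phi> x = g x * transposed c ?f1 x + g x * transposed c ?f2 x"
        using transposed_add[OF V(1,2) t] by (auto simp: algebra_simps)
    qed (use V in auto)
    also have "\<dots> = 0"
      using set_integral_add(2)[OF integrand_props(1)[OF V(1,2) t(1) V(3)] integrand_props(1)[OF V(1,2) t(2) V(3)]] I1 I2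
      by simp
    finally show ?case .
  qed
  show ?thesis unfolding weakly_annihilates_iff
  proof (intro allI impI)
    fix \<phi> assume \<phi>: "test_function V \<phi>"
    have "tsupp \<phi> \<subseteq> (\<Union>a\<in>tsupp \<phi>. ball a (r a / 2))"
      using r(1) test_functionD(3)[OF \<phi>] by fastforce
    then obtain A where "A \<subseteq> tsupp \<phi>" "finite A" "tsupp \<phi> \<subseteq> (\<Union>a\<in>A. ball a (r a / 2))"
      using compactE_image[OF test_functionD(2)[OF \<phi>], of "tsupp \<phi>" "\<lambda>a. ball a (r a / 2)"] by auto
    then show "(LINT x:V|lborel. g x * transposed c \<phi> x) = 0"
      using fin[OF _ _ \<phi>] test_functionD(3)[OF \<phi>] by blast
  qed
qed

subsection \<open>Locally uniform limits of holomorphic functions of two variables\<close>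

type_synonym C2 = "complex \<times> complex"

text \<open>The complex scalar action on C^2. Complex linearity of a real derivative is expressed as
  compatibility with \<open>csc \<i>\<close>.\<close>

definition csc :: "complex \<Rightarrow> C2 \<Rightarrow> C2" where
  "csc a v = (a * fst v, a * snd v)"

lemma csc_bounded_bilinear: "bounded_bilinear csc"
proof
  show "\<exists>K. \<forall>a b. norm (csc a b) \<le> norm a * norm b * K"
  proof (intro exI allI)
    fix a b
    have "norm (csc a b) = norm a * norm b"
      by (simp add: csc_def norm_prod_def norm_mult power_mult_distrib
          distrib_left[symmetric] real_sqrt_mult)
    then show "norm (csc a b) \<le> norm a * norm b * 1" by simp
  qed
qed (auto simp: csc_def algebra_simps)

interpretation csc: bounded_bilinear csc by (rule csc_bounded_bilinear)

lemmas continuous_on_csc [continuous_intros] = csc.continuous_on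

lemma norm_csc: "norm (csc a b) = norm a * norm b"
  by (simp add: csc_def norm_prod_def norm_mult power_mult_distrib
      distrib_left[symmetric] real_sqrt_mult)

lemma csc_1 [simp]: "csc 1 v = v"
  by (simp add: csc_def)

lemma csc_of_real: "csc (of_real r) v = r *\<^sub>R v"
  by (simp add: csc_def scaleR_conv_of_real prod_eq_iff)

text \<open>Classical holomorphy with continuous derivative. The derivative is a family of bounded
  real linear maps, continuous in operator norm, the form in which differentiation under an integral
  applies; compatibility with \<open>\<i>\<close> is the Cauchy-Riemann system.\<close>

definition C1hol :: "C2 set \<Rightarrow> (C2 \<Rightarrow> complex) \<Rightarrow> bool" where
  "C1hol U u \<longleftrightarrow> (\<exists>u'. continuous_on U u' \<and>
    (\<forall>z\<in>U. (u has_derivative blinfun_apply (u' z)) (at z) \<and>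
      (\<forall>v. blinfun_apply (u' z) (csc \<i> v) = \<i> * blinfun_apply (u' z) v)))"

text \<open>Holomorphy in the form that mollification delivers. By the theorem of Weierstrass it is
  ordinary holomorphy on open sets; the approximants themselves are needed again when the extension
  is shown to be CR.\<close>

definition hol2 :: "C2 set \<Rightarrow> (C2 \<Rightarrow> complex) \<Rightarrow> bool" where
  "hol2 W h \<longleftrightarrow> (\<forall>C \<delta>. compact C \<and> C \<subseteq> W \<and> \<delta> > 0 \<longrightarrow>
    (\<exists>U u. open U \<and> C \<subseteq> U \<and> C1hol U u \<and> (\<forall>z\<in>C. norm (h z - u z) \<le> \<delta>)))"

lemma hol2E:
  assumes "hol2 W h" "compact C" "C \<subseteq> W" "\<delta> > 0"
  obtains U u where "open U" "C \<subseteq> U" "C1hol U u" "\<And>z. z \<in> C \<Longrightarrow> norm (h z - u z) \<le> \<delta>"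
  using assms unfolding hol2_def by meson

lemma complex_linear_csc:
  assumes "linear l" "\<And>v. l (csc \<i> v) = \<i> * l v"
  shows "l (csc a v) = a * (l v :: complex)"
proof -
  have "csc a v = Re a *\<^sub>R v + Im a *\<^sub>R csc \<i> v"
    by (simp add: csc_def prod_eq_iff complex_eq_iff)
  then have "l (csc a v) = Re a *\<^sub>R l v + Im a *\<^sub>R (\<i> * l v)"
    by (simp only: linear_add[OF assms(1)] linear_scale[OF assms(1)] assms(2))
  then show ?thesis by (simp add: complex_eq_iff)
qed

lemma C1hol_continuous_on: "C1hol U u \<Longrightarrow> continuous_on U u"
  unfolding C1hol_def using has_derivative_continuous
  by (blast intro: continuous_at_imp_continuous_on)

lemma C1hol_line:
  assumes "C1hol U u"
  shows "(\<lambda>s. u (a + csc s b)) holomorphic_on {s. a + csc s b \<in> U}"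
proof -
  obtain u' where u: "\<And>z. z \<in> U \<Longrightarrow> (u has_derivative blinfun_apply (u' z)) (at z)"
    "\<And>z v. z \<in> U \<Longrightarrow> blinfun_apply (u' z) (csc \<i> v) = \<i> * blinfun_apply (u' z) v"
    using assms unfolding C1hol_def by blast
  have "((\<lambda>s. u (a + csc s b)) has_field_derivative blinfun_apply (u' (a + csc s b)) b) (at s)"
    if "a + csc s b \<in> U" for s
  proof -
    have 1: "((\<lambda>s. a + csc s b) has_derivative (\<lambda>s. csc s b)) (at s)"
      by (auto intro!: derivative_eq_intros bounded_linear_imp_has_derivative csc.bounded_linear_left)
    have "((\<lambda>s. u (a + csc s b)) has_derivative (\<lambda>t. blinfun_apply (u' (a + csc s b)) (csc t b))) (at s)"
      using has_derivative_compose[OF 1 u(1)[OF that]] .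
    moreover have "(\<lambda>t. blinfun_apply (u' (a + csc s b)) (csc t b)) = (*) (blinfun_apply (u' (a + csc s b)) b)"
      using complex_linear_csc[of "blinfun_apply (u' (a + csc s b))"] u(2)[OF that]
      by (auto simp: fun_eq_iff mult.commute blinfun.bounded_linear_right bounded_linear.linear)
    ultimately show ?thesis by (simp add: has_field_derivative_def)
  qed
  then show ?thesis
    by (intro holomorphic_onI) (auto simp: field_differentiable_def intro: has_field_derivative_at_within)
qed

lemma hol2_uniform_limit:
  assumes "hol2 W h" "compact C" "C \<subseteq> W"
  shows "\<exists>U u. (\<forall>n::nat. C \<subseteq> U n \<and> C1hol (U n) (u n)) \<and> uniform_limit C u h sequentially"
proof -
  have "\<exists>U u. open U \<and> C \<subseteq> U \<and> C1hol U u \<and> (\<forall>z\<in>C. norm (h z - u z) \<le> 1 / real (Suc n))" for n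
    using assms unfolding hol2_def by auto
  then obtain U u where U: "\<And>n. open (U n)" "\<And>n. C \<subseteq> U n" "\<And>n. C1hol (U n) (u n)"
    "\<And>n z. z \<in> C \<Longrightarrow> norm (h z - u n z) \<le> 1 / real (Suc n)" by metis
  have "uniform_limit C u h sequentially"
  proof (rule uniform_limitI)
    fix e :: real assume "e > 0"
    have "eventually (\<lambda>n. 1 / real (Suc n) < e) sequentially"
      using LIMSEQ_inverse_real_of_nat order_tendstoD(2)[OF _ \<open>e > 0\<close>] by (simp add: inverse_eq_divide)
    then show "\<forall>\<^sub>F n in sequentially. \<forall>x\<in>C. dist (u n x) (h x) < e"
    proof eventually_elim
      case (elim n)
      show ?case
      proof
        fix x assume "x \<in> C"
        from U(4)[OF this, of n] elim show "dist (u n x) (h x) < e"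
          by (simp add: dist_norm norm_minus_commute)
      qed
    qed
  qed
  with U(2,3) show ?thesis by (intro exI[of _ U] exI[of _ u]) simp
qed

lemma hol2_continuous_on:
  assumes "hol2 W h" "open W"
  shows "continuous_on W h"
proof -
  have "continuous (at z) h" if z: "z \<in> W" for z
  proof -
    obtain r where r: "r > 0" "cball z r \<subseteq> W" using assms(2) z unfolding open_contains_cball by blast
    obtain U u where "\<forall>n::nat. cball z r \<subseteq> U n \<and> C1hol (U n) (u n)"
      and lim: "uniform_limit (cball z r) u h sequentially"
      using hol2_uniform_limit[OF assms(1) compact_cball r(2)] by blast
    then have c: "continuous_on (cball z r) (u n)" for n
      using C1hol_continuous_on continuous_on_subset by blast
    have "continuous_on (cball z r) h"
      by (rule uniform_limit_theorem[OF _ lim]) (simp_all add: c)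
    then show ?thesis by (rule continuous_on_interior) (use r(1) in simp)
  qed
  then show ?thesis by (simp add: continuous_at_imp_continuous_on)
qed

text \<open>Along a complex line the approximants become holomorphic functions of one variable,
  converging uniformly on small discs.\<close>

lemma hol2_line:
  assumes h: "hol2 W h" "open W"
  shows "(\<lambda>s. h (a + csc s b)) holomorphic_on {s. a + csc s b \<in> W}"
proof -
  have op: "open {s. a + csc s b \<in> W}"
  proof -
    have "open ((\<lambda>s. a + csc s b) -` W)" by (rule open_vimage[OF h(2)]) (intro continuous_intros)
    then show ?thesis by (simp add: vimage_def)
  qed
  have *: "\<exists>r>0. (\<lambda>s. h (a + csc s b)) holomorphic_on ball s r" if s: "s \<in> {s. a + csc s b \<in> W}" for s
  proof -
    obtain r where r: "r > 0" "cball s r \<subseteq> {s. a + csc s b \<in> W}"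
      using op s unfolding open_contains_cball by blast
    let ?C = "(\<lambda>s. a + csc s b) ` cball s r"
    have C: "compact ?C" "?C \<subseteq> W"
      using r(2) by (auto intro!: compact_continuous_image continuous_intros)
    obtain U u where u: "\<forall>n::nat. ?C \<subseteq> U n \<and> C1hol (U n) (u n)"
      and lim: "uniform_limit ?C u h sequentially"
      using hol2_uniform_limit[OF h(1) C] by blast
    have hol: "(\<lambda>s. u n (a + csc s b)) holomorphic_on cball s r" for n
    proof (rule holomorphic_on_subset)
      show "(\<lambda>s. u n (a + csc s b)) holomorphic_on {s. a + csc s b \<in> U n}"
        by (rule C1hol_line) (use u in simp)
      show "cball s r \<subseteq> {s. a + csc s b \<in> U n}" using u[rule_format, of n] by blast
    qed
    have "uniform_limit (cball s r) (\<lambda>n s. u n (a + csc s b)) (\<lambda>s. h (a + csc s b)) sequentially"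
      by (rule uniform_limit_compose'[OF lim]) auto
    moreover have "\<forall>\<^sub>F n in sequentially. continuous_on (cball s r) (\<lambda>s. u n (a + csc s b)) \<and>
        (\<lambda>s. u n (a + csc s b)) holomorphic_on ball s r"
      using holomorphic_on_imp_continuous_on[OF hol] holomorphic_on_subset[OF hol ball_subset_cball] by simp
    ultimately have "(\<lambda>s. h (a + csc s b)) holomorphic_on ball s r"
      using holomorphic_uniform_limit[of s r "\<lambda>n s. u n (a + csc s b)" sequentially "\<lambda>s. h (a + csc s b)"]
      by simp
    then show ?thesis using r(1) by blast
  qed
  show ?thesis
  proof (rule holomorphic_onI)
    fix s assume "s \<in> {s. a + csc s b \<in> W}"
    from *[OF this] obtain r where "r > 0" "(\<lambda>s. h (a + csc s b)) holomorphic_on ball s r" by blast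
    then show "(\<lambda>s. h (a + csc s b)) field_differentiable at s within {s. a + csc s b \<in> W}"
      using field_differentiable_at_within[OF holomorphic_on_imp_differentiable_at[OF _ open_ball]] by simp
  qed
qed

text \<open>For holomorphic \<open>h\<close> this is the value at the centre when the closed disc
  lies in the domain; when only the circle does, it is the candidate for that value.\<close>

definition circle_mean :: "real \<Rightarrow> (C2 \<Rightarrow> complex) \<Rightarrow> C2 \<Rightarrow> C2 \<Rightarrow> complex" where
  "circle_mean \<tau> h v z =
    inverse (2*pi) *\<^sub>R integral (cbox 0 (2*pi)) (\<lambda>\<theta>. h (z + csc (of_real \<tau> * cis \<theta>) v))"

lemma continuous_on_circle_integrand:
  assumes "continuous_on W h" "\<And>\<theta>. z + csc (of_real \<tau> * cis \<theta>) v \<in> W"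
  shows "continuous_on A (\<lambda>\<theta>. h (z + csc (of_real \<tau> * cis \<theta>) v))"
  by (rule continuous_on_compose2[OF assms(1)]) (use assms(2) in \<open>auto intro!: continuous_intros\<close>)

lemma circle_integrable:
  assumes "continuous_on W (h :: C2 \<Rightarrow> 'b::banach)" "\<And>\<theta>. z + csc (of_real \<tau> * cis \<theta>) v \<in> W"
  shows "(\<lambda>\<theta>. h (z + csc (of_real \<tau> * cis \<theta>) v)) integrable_on cbox 0 (2*pi)"
  by (intro integrable_continuous continuous_on_circle_integrand[OF assms])

lemma circle_mean_norm_le:
  assumes "continuous_on W h" "\<And>\<theta>. z + csc (of_real \<tau> * cis \<theta>) v \<in> W"
    "\<And>\<theta>. norm (h (z + csc (of_real \<tau> * cis \<theta>) v)) \<le> B"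
  shows "norm (circle_mean \<tau> h v z) \<le> B"
proof -
  have "norm (integral (cbox 0 (2*pi)) (\<lambda>\<theta>. h (z + csc (of_real \<tau> * cis \<theta>) v))) \<le> integral (cbox 0 (2*pi)) (\<lambda>_. B)"
    by (rule integral_norm_bound_integral[OF circle_integrable[OF assms(1,2)]]) (use assms(3) in auto)
  then show ?thesis by (simp add: circle_mean_def field_simps)
qed

lemma circle_mean_diff:
  assumes "continuous_on W f" "continuous_on W g" "\<And>\<theta>. z + csc (of_real \<tau> * cis \<theta>) v \<in> W"
  shows "circle_mean \<tau> (\<lambda>z. f z - g z) v z = circle_mean \<tau> f v z - circle_mean \<tau> g v z"
proof -
  have "integral (cbox 0 (2*pi)) (\<lambda>\<theta>. f (z + csc (of_real \<tau> * cis \<theta>) v) - g (z + csc (of_real \<tau> * cis \<theta>) v))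
      = integral (cbox 0 (2*pi)) (\<lambda>\<theta>. f (z + csc (of_real \<tau> * cis \<theta>) v)) - integral (cbox 0 (2*pi)) (\<lambda>\<theta>. g (z + csc (of_real \<tau> * cis \<theta>) v))"
    by (rule integral_diff[OF circle_integrable[OF assms(1,3)] circle_integrable[OF assms(2,3)]])
  then show ?thesis by (simp add: circle_mean_def scaleR_diff_right)
qed

text \<open>Moving the centre translates the whole circle, so the derivative of the mean is the mean
  of the derivatives, and complex linearity survives averaging. Only the circles must lie in
  \<open>U\<close>, not the discs: this is how the extension gains points.\<close>

lemma C1hol_circle_mean:
  assumes u: "C1hol U u" and V: "open V" "\<And>z \<theta>. z \<in> V \<Longrightarrow> z + csc (of_real \<tau> * cis \<theta>) v \<in> U"
  shows "C1hol V (circle_mean \<tau> u v)"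
proof -
  obtain u' where u': "continuous_on U u'" "\<And>z. z \<in> U \<Longrightarrow> (u has_derivative blinfun_apply (u' z)) (at z)"
    "\<And>z v. z \<in> U \<Longrightarrow> blinfun_apply (u' z) (csc \<i> v) = \<i> * blinfun_apply (u' z) v"
    using u unfolding C1hol_def by blast
  define D where "D z \<theta> = u' (z + csc (of_real \<tau> * cis \<theta>) v)" for z \<theta>
  define M where "M z = inverse (2*pi) *\<^sub>R integral (cbox 0 (2*pi)) (D z)" for z
  have cD: "continuous_on (V \<times> cbox 0 (2*pi)) (\<lambda>(z, \<theta>). D z \<theta>)"
    unfolding D_def split_beta
    by (rule continuous_on_compose2[OF u'(1)]) (use V(2) in \<open>auto intro!: continuous_intros\<close>)
  have iD: "D z integrable_on cbox 0 (2*pi)" if "z \<in> V" for z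
    unfolding D_def by (intro integrable_continuous continuous_on_circle_integrand[OF u'(1)] V(2) that)
  have der: "(circle_mean \<tau> u v has_derivative blinfun_apply (M z)) (at z)" if z: "z \<in> V" for z
  proof -
    obtain r where r: "r > 0" "ball z r \<subseteq> V" using V(1) z unfolding open_contains_ball by blast
    have "((\<lambda>z. integral (cbox 0 (2*pi)) (\<lambda>\<theta>. u (z + csc (of_real \<tau> * cis \<theta>) v))) has_derivative
        integral (cbox 0 (2*pi)) (D z)) (at z within ball z r)"
    proof (rule leibniz_rule)
      show "((\<lambda>x. u (x + csc (of_real \<tau> * cis t) v)) has_derivative blinfun_apply (D x t)) (at x within ball z r)"
        if "x \<in> ball z r" for x t
      proof -
        have "x \<in> V" using that r by auto
        have 1: "((\<lambda>x. x + csc (of_real \<tau> * cis t) v) has_derivative (\<lambda>x. x)) (at x within ball z r)"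
          by (auto intro!: derivative_eq_intros)
        show ?thesis unfolding D_def
          by (rule has_derivative_compose[OF 1 u'(2)[OF V(2)[OF \<open>x \<in> V\<close>]]])
      qed
      show "(\<lambda>\<theta>. u (x + csc (of_real \<tau> * cis \<theta>) v)) integrable_on cbox 0 (2*pi)" if "x \<in> ball z r" for x
        by (rule circle_integrable[OF C1hol_continuous_on[OF u] V(2)]) (use that r in blast)
      show "continuous_on (ball z r \<times> cbox 0 (2*pi)) (\<lambda>(z, \<theta>). D z \<theta>)"
        by (rule continuous_on_subset[OF cD]) (use r in auto)
    qed (use r in auto)
    then have "((\<lambda>z. integral (cbox 0 (2*pi)) (\<lambda>\<theta>. u (z + csc (of_real \<tau> * cis \<theta>) v))) has_derivative
        integral (cbox 0 (2*pi)) (D z)) (at z)"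
      using r by (simp add: at_within_open[of z "ball z r"])
    then have "((\<lambda>z. inverse (2*pi) *\<^sub>R integral (cbox 0 (2*pi)) (\<lambda>\<theta>. u (z + csc (of_real \<tau> * cis \<theta>) v))) has_derivative
        (\<lambda>x. inverse (2*pi) *\<^sub>R blinfun_apply (integral (cbox 0 (2*pi)) (D z)) x)) (at z)"
      by (rule has_derivative_scaleR_right)
    then show ?thesis
      unfolding circle_mean_def M_def blinfun.scaleR_left .
  qed
  moreover have "blinfun_apply (M z) (csc \<i> w) = \<i> * blinfun_apply (M z) w" if "z \<in> V" for z w
  proof -
    have "integral (cbox 0 (2*pi)) (\<lambda>\<theta>. blinfun_apply (D z \<theta>) (csc \<i> w)) = integral (cbox 0 (2*pi)) (\<lambda>\<theta>. \<i> * blinfun_apply (D z \<theta>) w)"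
      by (rule integral_cong) (simp add: D_def u'(3)[OF V(2)[OF that]])
    then show ?thesis
      unfolding M_def blinfun.scaleR_left blinfun_apply_integral[OF iD[OF that]] by simp
  qed
  moreover have "continuous_on V M"
    unfolding M_def by (intro continuous_intros integral_continuous_on_param cD)
  ultimately show ?thesis unfolding C1hol_def by blast
qed

lemma hol2_circle_mean:
  assumes h: "hol2 W h" "open W" and U: "\<And>z \<theta>. z \<in> U \<Longrightarrow> z + csc (of_real \<tau> * cis \<theta>) v \<in> W"
  shows "hol2 U (circle_mean \<tau> h v)"
  unfolding hol2_def
proof (intro allI impI)
  fix C :: "C2 set" and \<delta> :: real assume C: "compact C \<and> C \<subseteq> U \<and> \<delta> > 0"
  \<comment> \<open>The compact set swept out by the circles over \<open>C\<close>; an approximant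
    of \<open>h\<close> on it becomes, after averaging, an approximant of the mean on
    \<open>C\<close>.\<close>
  define C' where "C' = (\<lambda>(z, \<theta>). z + csc (of_real \<tau> * cis \<theta>) v) ` (C \<times> {0..2*pi})"
  have C': "compact C'" unfolding C'_def split_beta
    using C by (intro compact_continuous_image compact_Times) (auto intro!: continuous_intros)
  have inC': "z + csc (of_real \<tau> * cis \<theta>) v \<in> C'" if "z \<in> C" for z \<theta>
  proof -
    obtain t where t: "t \<in> {0..2*pi}" "cis t = cis \<theta>"
    proof (cases "Arg (cis \<theta>) \<ge> 0")
      case True
      then show ?thesis using that[of "Arg (cis \<theta>)"] Arg_le_pi[of "cis \<theta>"] cis_Arg[of "cis \<theta>"] pi_gt_zero
        by (auto simp: sgn_eq)
    next
      case False
      then show ?thesis using that[of "Arg (cis \<theta>) + 2 * pi"] mpi_less_Arg[of "cis \<theta>"] cis_Arg[of "cis \<theta>"] pi_gt_zero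
        by (auto simp: sgn_eq cis_mult[symmetric])
    qed
    then show ?thesis unfolding C'_def using that by (auto intro!: image_eqI[of _ _ "(z, t)"])
  qed
  have "C' \<subseteq> W" unfolding C'_def using C U by auto
  then obtain U' u where u: "open U'" "C' \<subseteq> U'" "C1hol U' u" "\<And>z. z \<in> C' \<Longrightarrow> norm (h z - u z) \<le> \<delta>"
    using hol2E[OF h(1) C', of \<delta>] C by blast
  obtain e where e: "e > 0" "(\<Union>x\<in>C'. ball x e) \<subseteq> U'"
    using compact_subset_open_imp_ball_epsilon_subset[OF C' u(1,2)] by blast
  \<comment> \<open>Shifting a centre by less than \<open>e\<close> shifts every point of its circle
    by the same vector, which keeps the circle inside \<open>U'\<close>.\<close>
  define V where "V = (\<Union>x\<in>C. ball x e)"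
  have V: "z + csc (of_real \<tau> * cis \<theta>) v \<in> U'" if z: "z \<in> V" for z \<theta>
  proof -
    obtain x where x: "x \<in> C" "dist x z < e" using z by (auto simp: V_def)
    then have "z + csc (of_real \<tau> * cis \<theta>) v \<in> ball (x + csc (of_real \<tau> * cis \<theta>) v) e" by simp
    with e(2) inC'[OF x(1)] show ?thesis by blast
  qed
  have "open V" "C \<subseteq> V" using e(1) by (auto simp: V_def)
  moreover have "C1hol V (circle_mean \<tau> u v)" by (rule C1hol_circle_mean[OF u(3) \<open>open V\<close> V])
  moreover have "norm (circle_mean \<tau> h v z - circle_mean \<tau> u v z) \<le> \<delta>" if "z \<in> C" for z
  proof -
    have c: "continuous_on C' h" "continuous_on C' u"
      using continuous_on_subset[OF hol2_continuous_on[OF h] \<open>C' \<subseteq> W\<close>]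
        continuous_on_subset[OF C1hol_continuous_on[OF u(3)] u(2)] by auto
    have "norm (circle_mean \<tau> (\<lambda>z. h z - u z) v z) \<le> \<delta>"
      by (rule circle_mean_norm_le[of C']) (use inC'[OF that] u(4) in \<open>auto intro!: continuous_intros c\<close>)
    then show ?thesis using circle_mean_diff[OF c inC'[OF that]] by simp
  qed
  ultimately show "\<exists>U u. open U \<and> C \<subseteq> U \<and> C1hol U u \<and> (\<forall>z\<in>C. norm (circle_mean \<tau> h v z - u z) \<le> \<delta>)"
    by blast
qed

subsection \<open>Mollification\<close>

definition bump' :: "real \<Rightarrow> real" where "bump' t = flat (flat_pderiv 1) t"

lemma bump_has_derivative: "(bump has_real_derivative bump' t) (at t)"
  using flat_has_vector_derivative[of 1 t]
  by (simp add: bump_def[abs_def] bump'_def has_real_derivative_iff_has_vector_derivative)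

lemma bump'_eq_0: "t \<le> 0 \<Longrightarrow> bump' t = 0"
  by (simp add: bump'_def flat_def)

lemma bump_continuous: "continuous_on S bump" and bump'_continuous: "continuous_on S bump'"
proof -
  show "continuous_on S bump"
    by (intro continuous_at_imp_continuous_on ballI) (rule DERIV_isCont[OF bump_has_derivative])
  show "continuous_on S bump'"
    unfolding bump'_def[abs_def]
    by (intro continuous_at_imp_continuous_on ballI)
      (rule has_vector_derivative_continuous[OF flat_has_vector_derivative])
qed

text \<open>Measures the failure of complex linearity of the real inner product in \<open>v\<close>.
  The defect is a combination of the two components of \<open>w\<close>, which is why two weak
  equations suffice for the mollification.\<close>

lemma inner_csc_i:
  "complex_of_real (w \<bullet> csc \<i> v) =
    \<i> * of_real (w \<bullet> v) - \<i> * (fst w * cnj (fst v) + snd w * cnj (snd v))"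
  by (simp add: inner_prod_def csc_def inner_complex_def complex_eq_iff algebra_simps)

text \<open>The derivative in z falls on the kernel and produces \<open>bump'\<close> times the real
  inner product of y - z with the direction; its defect from complex linearity is a combination of
  the two integrals assumed to vanish. Up to sign these pair \<open>g\<close> with the conjugate
  derivatives of the kernel.\<close>

lemma C1hol_mollify:
  fixes g :: "C2 \<Rightarrow> complex"
  assumes g: "continuous_on UNIV g" and V: "open V"
    and weak: "\<And>z. z \<in> V \<Longrightarrow> integral (cbox a b) (\<lambda>y. bump' (r\<^sup>2 - (norm (y - z))\<^sup>2) *\<^sub>R g y * fst (y - z)) = 0"
      "\<And>z. z \<in> V \<Longrightarrow> integral (cbox a b) (\<lambda>y. bump' (r\<^sup>2 - (norm (y - z))\<^sup>2) *\<^sub>R g y * snd (y - z)) = 0"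
  shows "C1hol V (\<lambda>z. c *\<^sub>R integral (cbox a b) (\<lambda>y. bump (r\<^sup>2 - (norm (y - z))\<^sup>2) *\<^sub>R g y))"
proof -
  define D :: "C2 \<Rightarrow> C2 \<Rightarrow> C2 \<Rightarrow>\<^sub>L complex" where
    "D z y = (2 * bump' (r\<^sup>2 - (norm (y - z))\<^sup>2)) *\<^sub>R (blinfun_scaleR_left (g y) o\<^sub>L blinfun_inner_right (y - z))" for z y
  have Dv: "blinfun_apply (D z y) v = (2 * bump' (r\<^sup>2 - (norm (y - z))\<^sup>2) * ((y - z) \<bullet> v)) *\<^sub>R g y" for z y v
    by (simp add: D_def blinfun.scaleR_left)
  define M where "M z = c *\<^sub>R integral (cbox a b) (D z)" for z
  have gs: "continuous_on S (\<lambda>x. g (f x))" if "continuous_on S f" for S and f :: "'z::topological_space \<Rightarrow> C2"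
    by (rule continuous_on_compose2[OF g that]) auto
  have bs: "continuous_on S (\<lambda>x. bump' (f x))" "continuous_on S (\<lambda>x. bump (f x))"
    if "continuous_on S f" for S and f :: "'z::topological_space \<Rightarrow> real"
    by (rule continuous_on_compose2[OF bump'_continuous that subset_UNIV])
      (rule continuous_on_compose2[OF bump_continuous that subset_UNIV])
  have cD: "continuous_on S (\<lambda>(z, y). D z y)" for S
    unfolding D_def split_beta
    by (intro continuous_on_scaleR bounded_bilinear.continuous_on[OF bounded_bilinear_blinfun_compose]
        bounded_linear.continuous_on[OF bounded_linear_blinfun_scaleR_left]
        bounded_linear.continuous_on[OF bounded_linear_blinfun_inner_right] gs bs continuous_intros)
  have cDz: "continuous_on S (D z)" for S z
    by (rule continuous_on_compose2[OF cD[of UNIV], of S "\<lambda>y. (z, y)", simplified]) (auto intro!: continuous_intros)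
  have der: "((\<lambda>z. c *\<^sub>R integral (cbox a b) (\<lambda>y. bump (r\<^sup>2 - (norm (y - z))\<^sup>2) *\<^sub>R g y)) has_derivative
      blinfun_apply (M z)) (at z)" for z
  proof -
    have "((\<lambda>z. integral (cbox a b) (\<lambda>y. bump (r\<^sup>2 - (norm (y - z))\<^sup>2) *\<^sub>R g y)) has_derivative
        integral (cbox a b) (D z)) (at z within UNIV)"
    proof (rule leibniz_rule)
      show "((\<lambda>z. bump (r\<^sup>2 - (norm (y - z))\<^sup>2) *\<^sub>R g y) has_derivative blinfun_apply (D z y)) (at z within UNIV)" for z y
      proof -
        have 1: "((\<lambda>z. r\<^sup>2 - (norm (y - z))\<^sup>2) has_derivative (\<lambda>v. 2 * ((y - z) \<bullet> v))) (at z)"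
          unfolding power2_norm_eq_inner
          by (auto intro!: derivative_eq_intros simp: inner_commute algebra_simps)
        have "((\<lambda>z. bump (r\<^sup>2 - (norm (y - z))\<^sup>2)) has_derivative
            (\<lambda>v. 2 * ((y - z) \<bullet> v) * bump' (r\<^sup>2 - (norm (y - z))\<^sup>2))) (at z)"
          using has_derivative_compose[OF 1 bump_has_derivative[unfolded has_field_derivative_def]]
          by (simp add: mult.commute)
        then have "((\<lambda>z. bump (r\<^sup>2 - (norm (y - z))\<^sup>2) *\<^sub>R g y) has_derivative
            (\<lambda>v. (2 * ((y - z) \<bullet> v) * bump' (r\<^sup>2 - (norm (y - z))\<^sup>2)) *\<^sub>R g y)) (at z)"
          by (rule has_derivative_scaleR_left)
        moreover have "(\<lambda>v. (2 * ((y - z) \<bullet> v) * bump' (r\<^sup>2 - (norm (y - z))\<^sup>2)) *\<^sub>R g y) = blinfun_apply (D z y)"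
          by (auto simp: fun_eq_iff Dv mult_ac)
        ultimately show ?thesis by simp
      qed
      show "(\<lambda>y. bump (r\<^sup>2 - (norm (y - z))\<^sup>2) *\<^sub>R g y) integrable_on cbox a b" for z
        by (intro integrable_continuous continuous_on_scaleR gs bs continuous_intros)
      show "continuous_on (UNIV \<times> cbox a b) (\<lambda>(z, y). D z y)" by (rule cD)
    qed auto
    then show ?thesis unfolding M_def blinfun.scaleR_left by (rule has_derivative_scaleR_right)
  qed
  have cl: "blinfun_apply (M z) (csc \<i> v) = \<i> * blinfun_apply (M z) v" if z: "z \<in> V" for z v
  proof -
    have iD: "D z integrable_on cbox a b" by (rule integrable_continuous[OF cDz])
    let ?F1 = "\<lambda>y. bump' (r\<^sup>2 - (norm (y - z))\<^sup>2) *\<^sub>R g y * fst (y - z)"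
    let ?F2 = "\<lambda>y. bump' (r\<^sup>2 - (norm (y - z))\<^sup>2) *\<^sub>R g y * snd (y - z)"
    have i1: "?F1 integrable_on cbox a b" "?F2 integrable_on cbox a b"
      by (intro integrable_continuous continuous_on_mult continuous_on_scaleR gs bs continuous_intros)+
    have h1: "(?F1 has_integral 0) (cbox a b)" "(?F2 has_integral 0) (cbox a b)"
      using integrable_integral[OF i1(1)] integrable_integral[OF i1(2)] weak[OF z] by simp_all
    have h2: "((\<lambda>y. blinfun_apply (D z y) v) has_integral blinfun_apply (integral (cbox a b) (D z)) v) (cbox a b)"
      for v
      using has_integral_linear[OF integrable_integral[OF iD] blinfun.bounded_linear_left] by (simp add: o_def)
    have eq: "blinfun_apply (D z y) (csc \<i> v) = \<i> * blinfun_apply (D z y) v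
        - (2 * \<i> * cnj (fst v)) * ?F1 y - (2 * \<i> * cnj (snd v)) * ?F2 y" for y
      unfolding Dv scaleR_conv_of_real of_real_mult inner_csc_i by (simp add: algebra_simps)
    have "((\<lambda>y. blinfun_apply (D z y) (csc \<i> v)) has_integral
        \<i> * blinfun_apply (integral (cbox a b) (D z)) v - (2 * \<i> * cnj (fst v)) * 0 - (2 * \<i> * cnj (snd v)) * 0) (cbox a b)"
      unfolding eq by (intro has_integral_diff has_integral_mult_right h1 h2)
    from has_integral_unique[OF h2[of "csc \<i> v"] this] show ?thesis
      unfolding M_def blinfun.scaleR_left by simp
  qed
  have "continuous_on V M"
    unfolding M_def by (intro continuous_intros integral_continuous_on_param cD)
  then show ?thesis using der cl unfolding C1hol_def by blast
qed

text \<open>Weak Cauchy-Riemann equations tested against radial bumps are enough: mollifications are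
  \<open>C1hol\<close>, and uniform continuity on a compact neighbourhood makes them close to
  \<open>h\<close>.\<close>

lemma hol2_of_weak:
  fixes h :: "C2 \<Rightarrow> complex"
  assumes W: "open W" "continuous_on W h"
    and weak: "\<And>z r. r > 0 \<Longrightarrow> cball z r \<subseteq> W \<Longrightarrow>
        (LINT y:cball z r|lborel. bump' (r\<^sup>2 - (norm (y - z))\<^sup>2) *\<^sub>R h y * fst (y - z)) = 0"
      "\<And>z r. r > 0 \<Longrightarrow> cball z r \<subseteq> W \<Longrightarrow>
        (LINT y:cball z r|lborel. bump' (r\<^sup>2 - (norm (y - z))\<^sup>2) *\<^sub>R h y * snd (y - z)) = 0"
  shows "hol2 W h"
  unfolding hol2_def
proof (intro allI impI)
  fix C :: "C2 set" and \<delta> :: real assume C: "compact C \<and> C \<subseteq> W \<and> \<delta> > 0"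
  show "\<exists>U u. open U \<and> C \<subseteq> U \<and> C1hol U u \<and> (\<forall>z\<in>C. norm (h z - u z) \<le> \<delta>)"
  proof (cases "C = {}")
    case True
    then show ?thesis by (intro exI[of _ "{}"]) (auto simp: C1hol_def)
  next
    case False
    obtain e where e: "e > 0" "(\<Union>x\<in>C. ball x e) \<subseteq> W"
      using compact_subset_open_imp_ball_epsilon_subset[of C W] C W(1) by blast
    \<comment> \<open>Radius 2e/3: centres within e/3 of \<open>C\<close> and a kernel radius of at
      most e/3 keep the mollification inside \<open>C'\<close>.\<close>
    define C' where "C' = {y. infdist y C \<le> 2 * (e / 3)}"
    have C': "compact C'" unfolding C'_def using C e False by (intro compact_infdist_le) auto
    have C'W: "C' \<subseteq> W"
    proof
      fix y assume y: "y \<in> C'"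
      obtain x where "x \<in> C" "infdist y C = dist y x"
        using infdist_attains_inf[of C y] C False compact_imp_closed by blast
      with y e(1) have "y \<in> ball x e" by (simp add: C'_def dist_commute)
      with e(2) \<open>x \<in> C\<close> show "y \<in> W" by blast
    qed
    have "uniformly_continuous_on C' h"
      by (rule compact_uniformly_continuous[OF continuous_on_subset[OF W(2) C'W] C'])
    then obtain d where d: "d > 0" "\<And>x y. x \<in> C' \<Longrightarrow> y \<in> C' \<Longrightarrow> dist y x < d \<Longrightarrow> dist (h y) (h x) < \<delta>"
      using C unfolding uniformly_continuous_on_def by metis
    define r where "r = min (e / 3) (d / 2)"
    have r: "r > 0" "r \<le> e / 3" "r < d" using e d by (auto simp: r_def min_def)
    \<comment> \<open>A global continuous extension turns every mollification into an integral over
      one fixed box; off \<open>C'\<close> its values meet a vanishing kernel.\<close>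
    obtain g where g: "continuous_on UNIV g" "\<And>x. x \<in> C' \<Longrightarrow> g x = h x"
      using Tietze_unbounded[OF continuous_on_subset[OF W(2) C'W], of UNIV] compact_imp_closed[OF C'] by auto
    obtain a where a: "C' \<subseteq> cbox (-a) a"
      using bounded_subset_cbox_symmetric[OF compact_imp_bounded[OF C']] by blast
    define V where "V = (\<Union>x\<in>C. ball x (e / 3))"
    have V: "open V" "C \<subseteq> V" using e by (auto simp: V_def)
    have VC': "cball z r \<subseteq> C'" if z: "z \<in> V" for z
    proof
      fix y assume "y \<in> cball z r"
      moreover obtain x where x: "x \<in> C" "dist x z < e / 3" using z by (auto simp: V_def)
      ultimately have "dist y x \<le> 2 * (e / 3)"
        using dist_triangle[of y x z] r by (simp add: dist_commute)
      then show "y \<in> C'" unfolding C'_def using infdist_le[OF x(1), of y] by simp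
    qed
    define k where "k y = bump (r\<^sup>2 - (norm y)\<^sup>2)" for y :: C2
    have out: "r\<^sup>2 - (norm (y - z))\<^sup>2 \<le> 0" if "y \<notin> cball z r" for y z :: C2
      using that r(1) power_mono[of r "norm (y - z)" 2] by (simp add: dist_norm norm_minus_commute)
    have k0: "k (y - z) = 0" "bump' (r\<^sup>2 - (norm (y - z))\<^sup>2) = 0" if "y \<notin> cball z r" for y z
      using out[OF that] by (simp_all add: k_def bump_0 bump'_eq_0)
    have kc: "continuous_on S (\<lambda>y. k (y - z))" "continuous_on S (\<lambda>y. bump' (r\<^sup>2 - (norm (y - z))\<^sup>2))" for S z
      unfolding k_def
      by (rule continuous_on_compose2[OF bump_continuous _ subset_UNIV]
          continuous_on_compose2[OF bump'_continuous _ subset_UNIV], intro continuous_intros)+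
    define N where "N = (LINT y|lborel. k y)"
    have Nz: "integral (cbox (-a) a) (\<lambda>y. k (y - z)) = N" if z: "z \<in> V" for z
    proof -
      have "integral (cbox (-a) a) (\<lambda>y. k (y - z)) = (LINT y|lborel. k (y - z))"
        by (rule lborel_integral_eq_integral_cbox(1)[symmetric, OF kc(1)]) (use k0(1) VC'[OF z] a in blast)
      also have "\<dots> = (LINT y|distr lborel borel ((+) (- z)). k y)"
        using kc(1)[of UNIV 0] by (subst integral_distr) (auto intro!: borel_measurable_continuous_onI)
      finally show ?thesis by (simp add: lborel_distr_plus N_def)
    qed
    \<comment> \<open>The kernel is continuous, nonnegative and positive at its centre, so its
      integral cannot vanish.\<close>
    have N: "N > 0"
    proof -
      obtain z where z: "z \<in> C" using False by blast
      with V have zV: "z \<in> V" by blast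
      have i: "((\<lambda>y. k (y - z)) has_integral N) (cbox (-a) a)"
        using integrable_integral[OF integrable_continuous[OF kc(1)]] Nz[OF zV] by metis
      have "N \<ge> 0" by (rule has_integral_nonneg[OF i]) (simp add: k_def bump_nonneg)
      moreover have "N \<noteq> 0"
      proof
        assume "N = 0"
        have za: "ball z r \<subseteq> cbox (-a) a" using VC'[OF zV] a ball_subset_cball[of z r] by blast
        then have "ball z r \<subseteq> box (-a) a"
          using interior_maximal[OF za open_ball] by (simp add: interior_cbox)
        then have "box (-a) a \<noteq> {}" "z \<in> cbox (-a) a" using r(1) za by auto
        then have "k (z - z) = 0"
          using has_integral_0_cbox_imp_0[OF kc(1) _ i[unfolded \<open>N = 0\<close>], of z] by (simp add: k_def bump_nonneg)
        then show False using bump_pos[of "r\<^sup>2"] r(1) by (simp add: k_def)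
      qed
      ultimately show ?thesis by simp
    qed
    have w: "integral (cbox (-a) a) (\<lambda>y. bump' (r\<^sup>2 - (norm (y - z))\<^sup>2) *\<^sub>R g y * p (y - z)) = 0"
      if z: "z \<in> V" and p: "\<And>S. continuous_on S p"
        and wk: "(LINT y:cball z r|lborel. bump' (r\<^sup>2 - (norm (y - z))\<^sup>2) *\<^sub>R h y * p (y - z)) = 0"
      for z and p :: "C2 \<Rightarrow> complex"
    proof -
      let ?f = "\<lambda>y. bump' (r\<^sup>2 - (norm (y - z))\<^sup>2) *\<^sub>R g y * p (y - z)"
      have 1: "integral (cbox (-a) a) ?f = (LINT y|lborel. ?f y)"
      proof (rule lborel_integral_eq_integral_cbox(1)[symmetric])
        show "continuous_on UNIV ?f"
          by (intro continuous_on_mult continuous_on_scaleR kc g continuous_on_compose2[OF p[of UNIV]] continuous_intros subset_UNIV)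
        show "?f y = 0" if "y \<notin> cbox (-a) a" for y
        proof -
          have "y \<notin> cball z r" using VC'[OF z] a that by blast
          from k0(2)[OF this] show ?thesis by simp
        qed
      qed
      have eq: "?f = (\<lambda>y. indicator (cball z r) y *\<^sub>R (bump' (r\<^sup>2 - (norm (y - z))\<^sup>2) *\<^sub>R h y * p (y - z)))"
      proof
        fix y
        show "?f y = indicator (cball z r) y *\<^sub>R (bump' (r\<^sup>2 - (norm (y - z))\<^sup>2) *\<^sub>R h y * p (y - z))"
          using g(2)[of y] VC'[OF z] k0(2)[of y z] by (cases "y \<in> cball z r") auto
      qed
      show ?thesis unfolding 1 using wk unfolding set_lebesgue_integral_def eq .
    qed
    define u where "u z = inverse N *\<^sub>R integral (cbox (-a) a) (\<lambda>y. bump (r\<^sup>2 - (norm (y - z))\<^sup>2) *\<^sub>R g y)" for z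
    have VW: "cball z r \<subseteq> W" if "z \<in> V" for z using VC'[OF that] C'W by blast
    have "C1hol V u" unfolding u_def
    proof (rule C1hol_mollify[OF g(1) V(1)])
      fix z assume z: "z \<in> V"
      show "integral (cbox (-a) a) (\<lambda>y. bump' (r\<^sup>2 - (norm (y - z))\<^sup>2) *\<^sub>R g y * fst (y - z)) = 0"
        by (rule w[OF z _ weak(1)[OF r(1) VW[OF z]]]) (intro continuous_intros)
      show "integral (cbox (-a) a) (\<lambda>y. bump' (r\<^sup>2 - (norm (y - z))\<^sup>2) *\<^sub>R g y * snd (y - z)) = 0"
        by (rule w[OF z _ weak(2)[OF r(1) VW[OF z]]]) (intro continuous_intros)
    qed
    moreover have "norm (h z - u z) \<le> \<delta>" if z: "z \<in> C" for z
    proof -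
      have zV: "z \<in> V" using z V by blast
      have zC': "z \<in> C'" using VC'[OF zV] r(1) by auto
      have i1: "(\<lambda>y. k (y - z) *\<^sub>R g y) integrable_on cbox (-a) a"
        by (intro integrable_continuous continuous_on_scaleR kc continuous_on_subset[OF g(1)] subset_UNIV)
      have i2: "(\<lambda>y. k (y - z) *\<^sub>R h z) integrable_on cbox (-a) a"
        by (intro integrable_continuous continuous_on_scaleR kc continuous_on_const)
      have i3: "(\<lambda>y. k (y - z) * \<delta>) integrable_on cbox (-a) a"
        by (intro integrable_continuous continuous_on_mult kc continuous_on_const)
      have hz: "integral (cbox (-a) a) (\<lambda>y. k (y - z) *\<^sub>R h z) = N *\<^sub>R h z"
        using integral_linear[OF integrable_continuous[OF kc(1)] bounded_linear_scaleR_left[of "h z"], of "-a" a z] Nz[OF zV]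
        by (simp add: o_def)
      have "h z - u z = inverse N *\<^sub>R (N *\<^sub>R h z - integral (cbox (-a) a) (\<lambda>y. k (y - z) *\<^sub>R g y))"
        using N by (simp add: u_def k_def scaleR_diff_right)
      also have "N *\<^sub>R h z - integral (cbox (-a) a) (\<lambda>y. k (y - z) *\<^sub>R g y) =
          integral (cbox (-a) a) (\<lambda>y. k (y - z) *\<^sub>R h z - k (y - z) *\<^sub>R g y)"
        unfolding hz[symmetric] by (rule integral_diff[symmetric, OF i2 i1])
      finally have "norm (h z - u z) = inverse N * norm (integral (cbox (-a) a) (\<lambda>y. k (y - z) *\<^sub>R h z - k (y - z) *\<^sub>R g y))"
        using N by simp
      also have "\<dots> \<le> inverse N * integral (cbox (-a) a) (\<lambda>y. k (y - z) * \<delta>)"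
      proof (rule mult_left_mono[OF integral_norm_bound_integral[OF integrable_diff[OF i2 i1] i3]])
        fix y
        show "norm (k (y - z) *\<^sub>R h z - k (y - z) *\<^sub>R g y) \<le> k (y - z) * \<delta>"
        proof (cases "y \<in> cball z r")
          case True
          then have "y \<in> C'" "dist y z < d" using VC'[OF zV] r by (auto simp: dist_commute)
          then have "norm (h z - g y) \<le> \<delta>"
            using d(2)[OF zC', of y] g(2) by (simp add: dist_norm norm_minus_commute)
          then show ?thesis
            unfolding scaleR_diff_right[symmetric] norm_scaleR
            by (simp add: k_def bump_nonneg mult_left_mono)
        qed (use k0 in simp)
      qed (use N in simp)
      also have "integral (cbox (-a) a) (\<lambda>y. k (y - z) * \<delta>) = N * \<delta>" using Nz[OF zV] by simp
      finally show ?thesis using N by (simp add: mult.assoc[symmetric])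
    qed
    ultimately show ?thesis using V by blast
  qed
qed

subsection \<open>Circle-bundle charts of the quadric\<close>

lemma UNIV_5: "(UNIV :: 5 set) = {1, 2, 3, 4, 5}"
proof -
  have "x = 1 \<or> x = 2 \<or> x = 3 \<or> x = 4 \<or> x = 5" for x :: 5
  proof (induct x)
    case (of_int z)
    \<comment> \<open>In this index type \<open>5\<close> is the residue class of 0, so the
      representative 0 stands for the fifth index.\<close>
    then have "z = 0 \<or> z = 1 \<or> z = 2 \<or> z = 3 \<or> z = 4" by fastforce
    then show ?case by auto
  qed
  then show ?thesis by auto
qed

lemma sum_5: "sum f (UNIV :: 5 set) = f 1 + f 2 + f 3 + f 4 + f 5"
  unfolding UNIV_5 by (simp add: ac_simps)

section \<open>Lebesgue measure in the coordinates C^2 x R\<close>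

definition base :: "real^5 \<Rightarrow> C2" where
  "base x = (Complex (x$1) (x$2), Complex (x$3) (x$4))"

definition coords :: "real^5 \<Rightarrow> C2 \<times> real" where "coords x = (base x, x$5)"

definition coords_inv :: "C2 \<times> real \<Rightarrow> real^5" where
  "coords_inv p = (vec_lambda (\<lambda>i. if i = 1 then Re (fst (fst p)) else if i = 2 then Im (fst (fst p))
     else if i = 3 then Re (snd (fst p)) else if i = 4 then Im (snd (fst p)) else snd p))"

lemma all_5: "(\<forall>i::5. P i) \<longleftrightarrow> P 1 \<and> P 2 \<and> P 3 \<and> P 4 \<and> P 5"
  using UNIV_5 by (metis (no_types, opaque_lifting) UNIV_I empty_iff insert_iff)

lemma coords_inverse [simp]: "coords_inv (coords x) = x" "coords (coords_inv p) = p"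
  by (simp_all add: coords_def coords_inv_def base_def vec_eq_iff all_5 prod_eq_iff complex_eq_iff)

lemma bounded_linear_base: "bounded_linear base"
proof -
  have "linear base"
    by (rule linearI) (simp_all add: base_def complex_eq_iff prod_eq_iff)
  then show ?thesis by (rule linear_conv_bounded_linear[THEN iffD1])
qed

lemmas continuous_on_base [continuous_intros] = bounded_linear.continuous_on[OF bounded_linear_base]

lemma bounded_linear_coords: "bounded_linear coords"
  unfolding coords_def[abs_def]
  by (intro bounded_linear_Pair bounded_linear_base bounded_linear_vec_nth)

lemma continuous_coords_inv: "continuous_on S coords_inv"
  unfolding coords_inv_def
proof (rule continuous_on_vec_lambda)
  fix i :: 5
  show "continuous_on S (\<lambda>p. if i = 1 then Re (fst (fst p)) else if i = 2 then Im (fst (fst p))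
     else if i = 3 then Re (snd (fst p)) else if i = 4 then Im (snd (fst p)) else snd p)"
    by (cases "i = 1"; cases "i = 2"; cases "i = 3"; cases "i = 4"; auto intro!: continuous_intros)
qed

lemma base_axis:
  "base (axis 1 1) = (1, 0)" "base (axis 2 1) = (\<i>, 0)" "base (axis 3 1) = (0, 1)"
  "base (axis 4 1) = (0, \<i>)" "base (axis 5 1) = (0, 0)"
  by (simp_all add: base_def axis_def complex_eq_iff)

lemma C2R_inner:
  fixes p :: "C2 \<times> real"
  shows "p \<bullet> ((1,0),0) = Re (fst (fst p))" "p \<bullet> ((\<i>,0),0) = Im (fst (fst p))"
    "p \<bullet> ((0,1),0) = Re (snd (fst p))" "p \<bullet> ((0,\<i>),0) = Im (snd (fst p))" "p \<bullet> ((0,0),1) = snd p"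
  by (simp_all add: inner_prod_def inner_complex_def)

lemma C2R_Basis: "(Basis :: (C2 \<times> real) set) = {((1,0),0), ((\<i>,0),0), ((0,1),0), ((0,\<i>),0), ((0,0),1)}"
  by (auto simp: Basis_prod_def Basis_complex_def zero_prod_def)

text \<open>Boxes pull back to boxes with the same five side lengths, and values on boxes determine
  Lebesgue measure. The identification opens the way to Fubini in base point and angle.\<close>

lemma lborel_distr_coords: "distr lborel lborel coords = lborel"
proof (rule lborel_eqI[symmetric])
  have meas: "coords \<in> borel_measurable borel"
    by (intro borel_measurable_continuous_onI linear_continuous_on bounded_linear_coords)
  fix l u :: "C2 \<times> real"
  assume le: "\<And>b. b \<in> Basis \<Longrightarrow> l \<bullet> b \<le> u \<bullet> b"
  have vim: "coords -` box l u = box (coords_inv l) (coords_inv u)"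
    by (auto simp: mem_box_cart all_5 coords_inv_def mem_box C2R_Basis C2R_inner coords_def base_def)
  have le5: "coords_inv l \<bullet> b \<le> coords_inv u \<bullet> b" if b: "b \<in> Basis" for b
  proof -
    have "\<forall>i. coords_inv l $ i \<le> coords_inv u $ i"
      using le[of "((1,0),0)"] le[of "((\<i>,0),0)"] le[of "((0,1),0)"] le[of "((0,\<i>),0)"] le[of "((0,0),1)"]
      by (simp add: all_5 coords_inv_def C2R_Basis C2R_inner)
    moreover obtain i where "b = axis i 1" using b by (auto simp: Basis_vec_def)
    ultimately show ?thesis by (simp add: inner_axis)
  qed
  have "emeasure (distr lborel lborel coords) (box l u) = emeasure lborel (coords -` box l u)"
    using meas by (subst emeasure_distr) auto
  also have "\<dots> = (\<Prod>b\<in>Basis. (coords_inv u - coords_inv l) \<bullet> b)"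
    unfolding vim by (rule emeasure_lborel_box[OF le5])
  also have "(\<Prod>b\<in>Basis. (coords_inv u - coords_inv l) \<bullet> b) = (\<Prod>i\<in>UNIV. (coords_inv u - coords_inv l) $ i)"
    by (rule prod.reindex_bij_witness[of _ "\<lambda>i. axis i 1" "\<lambda>b. axis_index b"])
      (auto simp: Basis_vec_def inner_axis axis_index_axis)
  also have "\<dots> = (\<Prod>b\<in>Basis. (u - l) \<bullet> b)"
  proof -
    show ?thesis unfolding C2R_Basis UNIV_5
      by (simp add: coords_inv_def C2R_inner zero_prod_def complex_eq_iff mult_ac)
  qed
  finally show "emeasure (distr lborel lborel coords) (box l u) = ennreal (\<Prod>b\<in>Basis. (u - l) \<bullet> b)" .
qed auto

lemma lborel_integral_coords:
  fixes G :: "C2 \<times> real \<Rightarrow> complex"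
  assumes "continuous_on UNIV G"
  shows "(LINT x|lborel. G (coords x)) = (LINT p|lborel. G p)"
proof -
  have "(LINT p|distr lborel lborel coords. G p) = (LINT x|lborel. G (coords x))"
    by (rule integral_distr)
      (use assms in \<open>auto intro!: borel_measurable_continuous_onI linear_continuous_on bounded_linear_coords\<close>)
  then show ?thesis by (simp add: lborel_distr_coords)
qed

section \<open>The height function and the parametrised quadric\<close>

definition hsq :: "C2 \<Rightarrow> real" where "hsq z = (norm z)\<^sup>2 - 1"
text \<open>This is |z_3| on the quadric. The real \<open>sqrt\<close> is odd, so
  \<open>height\<close> is continuous on all of C^2, with negative values inside the unit ball;
  bounds on the norm appear where the sign matters.\<close>

definition height :: "C2 \<Rightarrow> real" where "height z = sqrt (hsq z)"

definition qpt :: "C2 \<Rightarrow> real \<Rightarrow> complex^3" where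
  "qpt z t = vector [fst z, snd z, of_real (height z) * cis t]"

definition proj2 :: "complex^3 \<Rightarrow> C2" where "proj2 p = (p $ 1, p $ 2)"

lemma qpt_nth [simp]: "qpt z t $ 1 = fst z" "qpt z t $ 2 = snd z" "qpt z t $ 3 = of_real (height z) * cis t"
  by (simp_all add: qpt_def)

lemma proj2_qpt [simp]: "proj2 (qpt z t) = z"
  by (simp add: proj2_def)

lemma norm_C2: "(norm (z::C2))\<^sup>2 = (cmod (fst z))\<^sup>2 + (cmod (snd z))\<^sup>2"
  by (simp add: norm_prod_def)

lemma hsq_pos: "norm z > 1 \<Longrightarrow> hsq z > 0" and hsq_nonneg: "norm z \<ge> 1 \<Longrightarrow> hsq z \<ge> 0"
  using power_strict_mono[of 1 "norm z" 2] power_mono[of 1 "norm z" 2] by (auto simp: hsq_def)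

lemma height_pos: "norm z > 1 \<Longrightarrow> height z > 0" and height_nonneg: "norm z \<ge> 1 \<Longrightarrow> height z \<ge> 0"
  using hsq_pos[of z] hsq_nonneg[of z] by (auto simp: height_def)

lemma height_sq: "norm z \<ge> 1 \<Longrightarrow> (height z)\<^sup>2 = hsq z"
  using hsq_nonneg[of z] by (simp add: height_def)

lemma quadric_iff: "p \<in> quadric \<longleftrightarrow> (norm (proj2 p))\<^sup>2 = 1 + (cmod (p $ 3))\<^sup>2"
  by (simp add: quadric_def proj2_def norm_C2)

lemma quadric_norm_ge: "p \<in> quadric \<Longrightarrow> norm (proj2 p) \<ge> 1"
  by (rule power2_le_imp_le) (auto simp: quadric_iff)

lemma quadric_cmod3: "p \<in> quadric \<Longrightarrow> cmod (p $ 3) = height (proj2 p)"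
  by (simp add: quadric_iff height_def hsq_def)

lemma qpt_in_quadric: "norm z \<ge> 1 \<Longrightarrow> qpt z t \<in> quadric"
  using height_sq[of z] by (simp add: quadric_iff norm_mult power_mult_distrib hsq_def)

lemma quadric_eq_qpt:
  assumes "p \<in> quadric"
  shows "qpt (proj2 p) (Arg (p $ 3)) = p"
proof -
  have "p $ 3 = of_real (cmod (p $ 3)) * cis (Arg (p $ 3))"
    using rcis_cmod_Arg[of "p $ 3"] by (simp add: rcis_def)
  then show ?thesis
    using quadric_cmod3[OF assms] by (simp add: vec_eq_iff forall_3 proj2_def)
qed

lemma smooth_on_base: "open S \<Longrightarrow> smooth_on S base"
  by (rule smooth_on_linear[OF _ bounded_linear_base])

lemma smooth_on_hsq: "open S \<Longrightarrow> smooth_on S (\<lambda>x. hsq (base x))"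
proof -
  assume "open S"
  then have "smooth_on S (\<lambda>x. base x \<bullet> base x)"
    using smooth_on_base[of S] unfolding smooth_on_def
    by (auto intro: Ck_on_bilinear[OF _ bounded_bilinear_inner])
  with \<open>open S\<close> show ?thesis
    unfolding hsq_def power2_norm_eq_inner by (intro smooth_on_diff smooth_on_const) auto
qed

lemma smooth_on_nth: "open S \<Longrightarrow> smooth_on S (\<lambda>x::real^5. x $ i)"
  by (rule smooth_on_linear[OF _ bounded_linear_vec_nth])

definition qchart :: "real^5 \<Rightarrow> complex^3" where "qchart x = qpt (base x) (x $ 5)"

text \<open>The angular window is open and of length 2 pi, so that \<open>qchart\<close> is
  injective on it; the angle \<open>a\<close> itself is missed, which later forces two
  windows.\<close>

definition qdom :: "C2 set \<Rightarrow> real \<Rightarrow> (real^5) set" where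
  "qdom W a = {x. base x \<in> W \<and> a < x $ 5 \<and> x $ 5 < a + 2 * pi}"

lemma open_qdom: "open W \<Longrightarrow> open (qdom W a)"
proof -
  assume "open W"
  then have "open (base -` W)" by (rule open_vimage) (simp add: linear_continuous_on bounded_linear_base)
  moreover have "open {x::real^5. a < x $ 5 \<and> x $ 5 < a + 2 * pi}"
    by (intro open_Collect_conj open_Collect_less continuous_intros)
  moreover have "qdom W a = base -` W \<inter> {x. a < x $ 5 \<and> x $ 5 < a + 2 * pi}"
    by (auto simp: qdom_def)
  ultimately show ?thesis by auto
qed

lemma height_base_has_derivative:
  assumes "norm (base x) > 1"
  shows "((\<lambda>x. height (base x)) has_derivative (\<lambda>v. (base x \<bullet> base v) / height (base x))) (at x)"
proof -
  have "((\<lambda>x. hsq (base x)) has_derivative (\<lambda>v. 2 * (base x \<bullet> base v))) (at x)"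
    unfolding hsq_def power2_norm_eq_inner
    by (auto intro!: derivative_eq_intros bounded_linear.has_derivative[OF bounded_linear_base] simp: inner_commute)
  moreover have "((\<lambda>y. sqrt y) has_derivative (*) (inverse (sqrt (hsq (base x))) / 2)) (at (hsq (base x)))"
    using DERIV_real_sqrt[OF hsq_pos[OF assms]] by (simp add: has_field_derivative_def)
  ultimately have "((\<lambda>x. sqrt (hsq (base x))) has_derivative
      (\<lambda>v. inverse (sqrt (hsq (base x))) / 2 * (2 * (base x \<bullet> base v)))) (at x)"
    by (rule has_derivative_compose)
  then show ?thesis by (simp add: height_def field_simps)
qed

definition third' :: "real^5 \<Rightarrow> real^5 \<Rightarrow> complex" where
  "third' x v = of_real ((base x \<bullet> base v) / height (base x)) * cis (x $ 5)
     + of_real (height (base x)) * (of_real (v $ 5) * (\<i> * cis (x $ 5)))"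

lemma cis_nth_has_derivative:
  "((\<lambda>x::real^5. cis (k * x $ 5)) has_derivative (\<lambda>v. of_real (k * v $ 5) * (\<i> * cis (k * x $ 5)))) (at x)"
proof -
  have 1: "((\<lambda>x::real^5. k * x $ 5) has_derivative (\<lambda>v. k * v $ 5)) (at x)"
    by (intro has_derivative_mult_right bounded_linear_imp_has_derivative bounded_linear_vec_nth)
  have "((\<lambda>t. exp (\<i> * of_real t)) has_vector_derivative \<i> * exp (\<i> * of_real t)) (at t)" for t
    by (rule has_vector_derivative_real_field) (auto intro!: derivative_eq_intros)
  then have 2: "(cis has_vector_derivative \<i> * cis t) (at t)" for t
    by (simp add: cis_conv_exp[abs_def])
  show ?thesis
    using has_derivative_compose[OF 1 2[unfolded has_vector_derivative_def]]
    by (simp add: scaleR_conv_of_real)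
qed

lemma qchart_nth_has_derivative:
  shows "((\<lambda>x. qchart x $ 1) has_derivative (\<lambda>v. fst (base v))) (at x)"
    "((\<lambda>x. qchart x $ 2) has_derivative (\<lambda>v. snd (base v))) (at x)"
    "norm (base x) > 1 \<Longrightarrow> ((\<lambda>x. qchart x $ 3) has_derivative third' x) (at x)"
proof -
  show "((\<lambda>x. qchart x $ 1) has_derivative (\<lambda>v. fst (base v))) (at x)"
    "((\<lambda>x. qchart x $ 2) has_derivative (\<lambda>v. snd (base v))) (at x)"
    unfolding qchart_def qpt_nth
    by (intro bounded_linear_imp_has_derivative bounded_linear_compose[OF bounded_linear_fst]
        bounded_linear_compose[OF bounded_linear_snd] bounded_linear_base)+
  assume "norm (base x) > 1"
  from has_derivative_mult[OF has_derivative_of_real[OF height_base_has_derivative[OF this]] cis_nth_has_derivative[of 1]]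
  show "((\<lambda>x. qchart x $ 3) has_derivative third' x) (at x)"
    unfolding qchart_def qpt_nth third'_def by (simp add: add.commute)
qed

lemma smooth_on_qchart:
  assumes "open S" "\<And>x. x \<in> S \<Longrightarrow> norm (base x) > 1"
  shows "smooth_on S qchart"
proof (rule smooth_on_vec[OF assms(1)])
  fix i :: 3
  have 1: "smooth_on S (\<lambda>x. fst (base x))" "smooth_on S (\<lambda>x. snd (base x))"
    using assms(1) smooth_on_base by (auto intro: smooth_on_bounded_linear_comp bounded_linear_fst bounded_linear_snd)
  have "smooth_on S (\<lambda>x. hsq (base x) powr (1/2))"
    by (intro smooth_on_powr smooth_on_hsq assms(1)) (use assms hsq_pos in auto)
  then have "smooth_on S (\<lambda>x. height (base x))"
    using smooth_on_cong[OF assms(1), of "\<lambda>x. hsq (base x) powr (1/2)" "\<lambda>x. height (base x)"] assms(2)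
    by (auto simp: height_def powr_half_sqrt hsq_nonneg less_imp_le)
  then have 3: "smooth_on S (\<lambda>x. complex_of_real (height (base x)) * cis (x $ 5))"
    by (intro smooth_on_mult smooth_on_of_real smooth_on_cis smooth_on_nth assms(1))
  show "smooth_on S (\<lambda>x. qchart x $ i)"
    using exhaust_3[of i] 1 3 by (auto simp: qchart_def)
qed

lemma vec_frechet_component:
  fixes X :: "real^5 \<Rightarrow> complex^3"
  assumes "(X has_derivative D) (at x)" "((\<lambda>x. X x $ j) has_derivative E) (at x)"
  shows "D v $ j = E v"
proof -
  have "((\<lambda>x. X x $ j) has_derivative (\<lambda>v. D v $ j)) (at x)"
    by (rule bounded_linear.has_derivative[OF bounded_linear_vec_nth assms(1)])
  from has_derivative_unique[OF this assms(2)] show ?thesis by (simp add: fun_eq_iff)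
qed

lemma local_param_qchart:
  assumes W: "open W" "W \<subseteq> {z. norm z > 1}"
  shows "local_param quadric (qdom W a) qchart"
proof -
  \<comment> \<open>The midpoint of the window. Rotating by -b moves the omitted angle to the
    negative real axis, the branch cut of \<open>Arg\<close>.\<close>
  define b where "b = a + pi"
  let ?V = "qdom W a" and ?c = "cis (- b)"
  have oV: "open ?V" by (rule open_qdom[OF W(1)])
  have nV: "norm (base x) > 1" if "x \<in> ?V" for x using that W by (auto simp: qdom_def)
  have sm: "smooth_on ?V qchart" by (rule smooth_on_qchart[OF oV nV])
  define Y where "Y p = coords_inv (proj2 p, Arg (p $ 3 * ?c) + b)" for p :: "complex^3"
  have mul: "qchart x $ 3 * ?c = rcis (height (base x)) (x $ 5 - b)" for x
    by (simp add: qchart_def rcis_def cis_mult mult.assoc)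
  have arg: "Arg (qchart x $ 3 * ?c) = x $ 5 - b" if "x \<in> ?V" for x
    unfolding mul using that height_pos[OF nV[OF that]]
    by (intro Arg_unique[where r="height (base x)"]) (auto simp: qdom_def rcis_def cis_conv_exp b_def)
  have YX: "Y (qchart x) = x" if "x \<in> ?V" for x
    using arg[OF that] coords_inverse(1)[of x] by (simp add: Y_def coords_def qchart_def)
  \<comment> \<open>An open set of C^3 that cuts the chart image out of the quadric; it gives both
    relative openness of the image and continuity of the inverse.\<close>
  define Q where "Q = {p. proj2 p \<in> W \<and> p $ 3 * ?c \<notin> \<real>\<^sub>\<le>\<^sub>0}"
  have pc: "continuous_on S proj2" for S
    unfolding proj2_def[abs_def] by (intro continuous_intros)
  have "open Q"
  proof -
    have "open (proj2 -` W)" by (rule open_vimage[OF W(1) pc])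
    moreover have "open ((\<lambda>p::complex^3. p $ 3 * ?c) -` (- \<real>\<^sub>\<le>\<^sub>0))"
      by (rule open_vimage) (auto intro!: continuous_intros simp: open_Compl)
    moreover have "Q = proj2 -` W \<inter> (\<lambda>p::complex^3. p $ 3 * ?c) -` (- \<real>\<^sub>\<le>\<^sub>0)" by (auto simp: Q_def)
    ultimately show ?thesis by auto
  qed
  have im: "qchart ` ?V = quadric \<inter> Q"
  proof
    show "qchart ` ?V \<subseteq> quadric \<inter> Q"
    proof
      fix p assume "p \<in> qchart ` ?V"
      then obtain x where x: "x \<in> ?V" "p = qchart x" by blast
      have "p $ 3 * ?c \<notin> \<real>\<^sub>\<le>\<^sub>0"
      proof
        assume n: "p $ 3 * ?c \<in> \<real>\<^sub>\<le>\<^sub>0"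
        have "p $ 3 * ?c \<noteq> 0" using height_pos[OF nV[OF x(1)]] x(2) by (simp add: qchart_def)
        with n have "Arg (p $ 3 * ?c) = pi"
          by (auto simp: Arg_eq_pi complex_nonpos_Reals_iff complex_eq_iff)
        with arg[OF x(1)] x show False by (auto simp: qdom_def b_def)
      qed
      then show "p \<in> quadric \<inter> Q"
        using x nV[OF x(1)] by (auto simp: Q_def qchart_def qdom_def intro!: qpt_in_quadric)
    qed
    show "quadric \<inter> Q \<subseteq> qchart ` ?V"
    proof
      fix p assume p: "p \<in> quadric \<inter> Q"
      define t where "t = Arg (p $ 3 * ?c) + b"
      have "Arg w < pi" if "w \<notin> \<real>\<^sub>\<le>\<^sub>0" for w
        using that Arg_eq_pi[of w] Arg_le_pi[of w] by (auto simp: complex_nonpos_Reals_iff)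
      with p have "Arg (p $ 3 * ?c) < pi" by (simp add: Q_def)
      then have t: "a < t" "t < a + 2 * pi" using mpi_less_Arg[of "p $ 3 * ?c"] by (auto simp: t_def b_def)
      have "p $ 3 * ?c = of_real (cmod (p $ 3)) * cis (Arg (p $ 3 * ?c))"
        using rcis_cmod_Arg[of "p $ 3 * ?c"] by (simp add: rcis_def norm_mult)
      then have "p $ 3 * ?c * cis b = of_real (cmod (p $ 3)) * (cis (Arg (p $ 3 * ?c)) * cis b)"
        by (simp add: mult.assoc)
      then have "p $ 3 = of_real (cmod (p $ 3)) * cis t"
        by (simp add: mult.assoc cis_mult t_def)
      then have "qpt (proj2 p) t = p"
        using quadric_cmod3[of p] p by (simp add: vec_eq_iff forall_3 proj2_def)
      moreover have "coords_inv (proj2 p, t) \<in> ?V"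
        using p t coords_inverse(2)[of "(proj2 p, t)"] unfolding coords_def by (auto simp: qdom_def Q_def)
      moreover have "qchart (coords_inv (proj2 p, t)) = qpt (proj2 p) t"
        using coords_inverse(2)[of "(proj2 p, t)"] unfolding coords_def by (simp add: qchart_def)
      ultimately show "p \<in> qchart ` ?V" by (metis image_eqI)
    qed
  qed
  have hom: "homeomorphism ?V (qchart ` ?V) qchart Y"
  proof (rule homeomorphismI)
    show "continuous_on ?V qchart" by (rule smooth_on_imp_continuous_on[OF sm])
    have "continuous_on Q (\<lambda>p. Arg (p $ 3 * ?c))"
    proof (rule continuous_on_compose2[of "- \<real>\<^sub>\<le>\<^sub>0" Arg])
      show "continuous_on (- \<real>\<^sub>\<le>\<^sub>0) Arg"
        by (intro continuous_at_imp_continuous_on ballI continuous_at_Arg) auto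
    qed (auto simp: Q_def intro!: continuous_intros)
    then have "continuous_on Q Y" unfolding Y_def
      by (intro continuous_on_compose2[OF continuous_coords_inv[of UNIV]] continuous_intros pc) (auto simp: Q_def)
    then show "continuous_on (qchart ` ?V) Y" using im by (auto intro: continuous_on_subset)
    show "Y ` qchart ` ?V \<subseteq> ?V" using YX by auto
  qed (use YX in auto)
  have "inj (frechet_derivative qchart (at x))" if x: "x \<in> ?V" for x
  proof -
    let ?D = "frechet_derivative qchart (at x)"
    have D: "(qchart has_derivative ?D) (at x)" by (rule smooth_on_has_derivative[OF sm x])
    have lin: "linear ?D" by (rule has_derivative_linear[OF D])
    have "v = 0" if v: "?D v = 0" for v
    proof -
      have 1: "fst (base v) = 0" "snd (base v) = 0"
        using vec_frechet_component[OF D qchart_nth_has_derivative(1), of v]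
          vec_frechet_component[OF D qchart_nth_has_derivative(2), of v] v by auto
      have "third' x v = 0"
        using vec_frechet_component[OF D qchart_nth_has_derivative(3)[OF nV[OF x]], of v] v by auto
      moreover have "base v = 0" using 1 by (simp add: prod_eq_iff)
      ultimately have "v $ 5 = 0"
        using height_pos[OF nV[OF x]] by (simp add: third'_def)
      with 1 show "v = 0" by (simp add: vec_eq_iff all_5 base_def complex_eq_iff)
    qed
    then show ?thesis using linear_injective_0[OF lin] by blast
  qed
  then show ?thesis unfolding local_param_def
    using oV sm hom im \<open>open Q\<close> by (auto simp: openin_open_Int)
qed

subsection \<open>Fourier coefficients of CR functions along the circles\<close>

definition lin :: "C2 \<Rightarrow> C2 \<Rightarrow> complex" where "lin l z = fst l * fst z + snd l * snd z"

text \<open>In the coordinates (z, t) this is l_1 d/dzbar_1 + l_2 d/dzbar_2 + (i/2) (l . z) / hsq(z)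
  d/dt, with l . z bilinear. The last coefficient is forced by the requirement that z_3 = height(z)
  e^(it) be annihilated.\<close>

definition cfield :: "C2 \<Rightarrow> real^5 \<Rightarrow> complex^5" where
  "cfield l x = vec_lambda (\<lambda>i. if i = 1 then fst l / 2 else if i = 2 then \<i> * fst l / 2
     else if i = 3 then snd l / 2 else if i = 4 then \<i> * snd l / 2
     else \<i> / 2 * lin l (base x) * of_real (hsq (base x) powr (-1)))"

lemma cfield_nth: "cfield l x $ 1 = fst l / 2" "cfield l x $ 2 = \<i> * fst l / 2"
  "cfield l x $ 3 = snd l / 2" "cfield l x $ 4 = \<i> * snd l / 2"
  "cfield l x $ 5 = \<i> / 2 * lin l (base x) * of_real (hsq (base x) powr (-1))"
  by (simp_all add: cfield_def)

lemma bounded_linear_lin: "bounded_linear (lin l)"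
  unfolding lin_def[abs_def]
  by (intro bounded_linear_add bounded_linear_const_mult bounded_linear_fst bounded_linear_snd)

definition apply_field :: "C2 \<Rightarrow> real^5 \<Rightarrow> (real^5 \<Rightarrow> complex) \<Rightarrow> complex" where
  "apply_field l x D = (\<Sum>i\<in>UNIV. cfield l x $ i * D (axis i 1))"

lemma apply_field_add: "apply_field l x (\<lambda>v. D v + E v) = apply_field l x D + apply_field l x E"
  by (simp add: apply_field_def sum.distrib algebra_simps)

lemma apply_field_mult: "apply_field l x (\<lambda>v. c * D v) = c * apply_field l x D"
  by (simp add: apply_field_def sum_distrib_left mult_ac)

text \<open>The (0,1) part of the real form given by the inner product with \<open>w\<close> is half
  the sum of w_j dzbar_j.\<close>

lemma apply_field_inner: "apply_field l x (\<lambda>v. of_real (w \<bullet> base v)) = lin l w / 2"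
proof -
  have "of_real (Re u) + \<i> * of_real (Im u) = u" for u by (simp add: complex_eq_iff)
  then have *: "fst w = of_real (Re (fst w)) + \<i> * of_real (Im (fst w))"
    "snd w = of_real (Re (snd w)) + \<i> * of_real (Im (snd w))" by simp_all
  show ?thesis unfolding lin_def
    by (subst *(1), subst *(2))
      (simp add: apply_field_def sum_5 cfield_nth base_axis inner_prod_def inner_complex_def field_simps)
qed

lemma axis_nth_5: "(axis 1 1 :: real^5) $ 5 = 0" "(axis 2 1 :: real^5) $ 5 = 0"
  "(axis 3 1 :: real^5) $ 5 = 0" "(axis 4 1 :: real^5) $ 5 = 0" "(axis 5 1 :: real^5) $ 5 = 1"
  by (simp_all add: axis_def)

lemma apply_field_nth5: "apply_field l x (\<lambda>v. of_real (v $ 5)) = cfield l x $ 5"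
  by (simp add: apply_field_def sum_5 axis_nth_5)

lemma hsq_powr_has_derivative:
  assumes "norm (base x) > 1"
  shows "((\<lambda>x. hsq (base x) powr p) has_derivative
    (\<lambda>v. p * hsq (base x) powr (p - 1) * 2 * (base x \<bullet> base v))) (at x)"
proof -
  have "((\<lambda>x. hsq (base x)) has_derivative (\<lambda>v. 2 * (base x \<bullet> base v))) (at x)"
    unfolding hsq_def power2_norm_eq_inner
    by (auto intro!: derivative_eq_intros bounded_linear.has_derivative[OF bounded_linear_base] simp: inner_commute)
  moreover have "((\<lambda>y. y powr p) has_derivative (*) (p * hsq (base x) powr (p - 1))) (at (hsq (base x)))"
    using has_real_derivative_powr[OF hsq_pos[OF assms]] by (simp add: has_field_derivative_def)
  ultimately have "((\<lambda>x. hsq (base x) powr p) has_derivative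
      (\<lambda>v. p * hsq (base x) powr (p - 1) * (2 * (base x \<bullet> base v)))) (at x)"
    by (rule has_derivative_compose)
  then show ?thesis by (simp add: mult.assoc)
qed

lemma smooth_on_if:
  "smooth_on S f \<Longrightarrow> smooth_on S g \<Longrightarrow> smooth_on S (\<lambda>x. if P then f x else g x)"
  by (cases P) simp_all

lemma smooth_on_cfield:
  assumes "open S" "\<And>x. x \<in> S \<Longrightarrow> norm (base x) > 1"
  shows "smooth_on S (cfield l)"
proof (rule smooth_on_vec[OF assms(1)])
  fix i :: 5
  have "smooth_on S (\<lambda>x. \<i> / 2 * lin l (base x) * of_real (hsq (base x) powr (-1)))"
    by (intro smooth_on_mult smooth_on_const smooth_on_of_real smooth_on_powr smooth_on_hsq assms(1)
        smooth_on_bounded_linear_comp[OF _ bounded_linear_lin smooth_on_base]) (use assms hsq_pos in auto)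
  then show "smooth_on S (\<lambda>x. cfield l x $ i)"
    unfolding cfield_def vec_lambda_beta by (intro smooth_on_if smooth_on_const assms(1))
qed

lemma CR_vector_field_cfield:
  assumes W: "open W" "W \<subseteq> {z. norm z > 1}"
  shows "CR_vector_field (qdom W a) qchart (cfield l)"
proof -
  let ?V = "qdom W a"
  have oV: "open ?V" by (rule open_qdom[OF W(1)])
  have nV: "norm (base x) > 1" if "x \<in> ?V" for x using that W by (auto simp: qdom_def)
  have "(\<Sum>i\<in>UNIV. cfield l x $ i * partial_deriv i qchart x $ j) = 0" if x: "x \<in> ?V" for x j
  proof -
    have D: "(qchart has_derivative frechet_derivative qchart (at x)) (at x)"
      by (rule smooth_on_has_derivative[OF smooth_on_qchart[OF oV nV] x])
    have eq: "(\<Sum>i\<in>UNIV. cfield l x $ i * partial_deriv i qchart x $ j) = apply_field l x E"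
      if "((\<lambda>x. qchart x $ j) has_derivative E) (at x)" for E
      using vec_frechet_component[OF D that] by (simp add: apply_field_def partial_deriv_def)
    have h: "height (base x) > 0" "hsq (base x) = (height (base x))\<^sup>2"
      using height_pos[OF nV[OF x]] height_sq[of "base x"] nV[OF x] by auto
    have "apply_field l x (third' x) =
      apply_field l x (\<lambda>v. (cis (x$5) / of_real (height (base x))) * of_real (base x \<bullet> base v)
        + (of_real (height (base x)) * (\<i> * cis (x$5))) * of_real (v$5))"
      by (rule arg_cong[where f="apply_field l x"]) (auto simp: third'_def fun_eq_iff)
    also have "\<dots> = 0"
      unfolding apply_field_add apply_field_mult apply_field_inner apply_field_nth5
      unfolding cfield_nth h(2) using h(1)
      by (simp add: powr_minus field_simps power2_eq_square)
    finally have 3: "apply_field l x (third' x) = 0" .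
    have "apply_field l x (\<lambda>v. fst (base v)) = 0" "apply_field l x (\<lambda>v. snd (base v)) = 0"
      by (simp_all add: apply_field_def sum_5 cfield_nth base_axis mult_ac)
    note 12 = this
    consider "j = 1" | "j = 2" | "j = 3" using exhaust_3[of j] by blast
    then show ?thesis
    proof cases
      case 1
      show ?thesis using eq[unfolded 1, OF qchart_nth_has_derivative(1)] 12(1) unfolding 1 by simp
    next
      case 2
      show ?thesis using eq[unfolded 2, OF qchart_nth_has_derivative(2)] 12(2) unfolding 2 by simp
    next
      case j: 3
      show ?thesis using eq[unfolded j, OF qchart_nth_has_derivative(3)[OF nV[OF x]]] 3 unfolding j by simp
    qed
  qed
  then show ?thesis
    unfolding CR_vector_field_def using smooth_on_cfield[OF oV nV] by blast
qed

text \<open>The field is divergence free: four coefficients are constant and the fifth does not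
  depend on the angle. Hence the transposed operator is the field itself.\<close>

lemma transposed_cfield:
  assumes "(\<phi> has_derivative D) (at x)" "norm (base x) > 1"
  shows "transposed (cfield l) \<phi> x = apply_field l x D"
proof -
  have c: "frechet_derivative (\<lambda>y. k * \<phi> y) (at x) v = k * D v" for k v
    using fun_cong[OF frechet_derivative_at[OF has_derivative_mult_right[OF assms(1)], symmetric]] .
  let ?E = "\<lambda>v. \<i> / 2 * lin l (base x) * of_real (-1 * hsq (base x) powr (-1 - 1) * 2 * (base x \<bullet> base v))
      + \<i> / 2 * lin l (base v) * of_real (hsq (base x) powr (-1))"
  have "((\<lambda>y. \<i> / 2 * lin l (base y) * of_real (hsq (base y) powr (-1))) has_derivative ?E) (at x)"
    by (intro has_derivative_mult has_derivative_of_real hsq_powr_has_derivative[OF assms(2)]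
        has_derivative_mult_right bounded_linear_imp_has_derivative
        bounded_linear_compose[OF bounded_linear_lin bounded_linear_base])
  from frechet_derivative_at[OF has_derivative_mult[OF this assms(1)], symmetric]
  have 5: "frechet_derivative (\<lambda>y. \<i> / 2 * lin l (base y) * of_real (hsq (base y) powr (-1)) * \<phi> y) (at x) (axis 5 1)
      = \<i> / 2 * lin l (base x) * of_real (hsq (base x) powr (-1)) * D (axis 5 1)"
    by (simp add: base_axis lin_def inner_prod_def)
  show ?thesis
    unfolding transposed_def apply_field_def sum_5 partial_deriv_def cfield_nth c 5 ..
qed

text \<open>The function z_3^(-m) in chart coordinates, annihilated by every
  \<open>cfield l\<close>.\<close>

definition efac :: "real \<Rightarrow> C2 \<Rightarrow> real \<Rightarrow> complex" where
  "efac m z t = of_real (hsq z powr (- m / 2)) * cis (- m * t)"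

definition bp :: "real \<Rightarrow> C2 \<Rightarrow> C2 \<Rightarrow> real" where "bp r z0 y = bump (r\<^sup>2 - (norm (y - z0))\<^sup>2)"
definition bp' :: "real \<Rightarrow> C2 \<Rightarrow> C2 \<Rightarrow> real" where "bp' r z0 y = bump' (r\<^sup>2 - (norm (y - z0))\<^sup>2)"

text \<open>A radial bump in the base, an angular cutoff \<open>b\<close> that copes with the missed
  angle, and z_3^(-m), so that pairing with a function extracts its coefficient of z_3^m.\<close>

definition tfun :: "real \<Rightarrow> real \<Rightarrow> C2 \<Rightarrow> (real \<Rightarrow> real) \<Rightarrow> real^5 \<Rightarrow> complex" where
  "tfun m r z0 b x = of_real (bp r z0 (base x) * b (x $ 5)) * efac m (base x) (x $ 5)"

text \<open>Only the bump and the cutoff get differentiated, the factor z_3^(-m) being annihilated.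
  The term with \<open>b'\<close> is an artefact of the window and disappears when two complementary
  cutoffs are added.\<close>

lemma transposed_tfun:
  assumes "norm (base x) > 1" "(b has_real_derivative b') (at (x $ 5))"
  shows "transposed (cfield l) (tfun m r z0 b) x = efac m (base x) (x $ 5) *
    (- of_real (bp' r z0 (base x)) * lin l (base x - z0) * of_real (b (x $ 5))
     + of_real (bp r z0 (base x)) * (\<i> / 2 * lin l (base x) * of_real (hsq (base x) powr (-1))) * of_real b')"
proof -
  let ?z = "base x"
  let ?p = "- m / 2"
  have 1: "((\<lambda>x. r\<^sup>2 - (norm (base x - z0))\<^sup>2) has_derivative (\<lambda>v. - 2 * ((?z - z0) \<bullet> base v))) (at x)"
    unfolding power2_norm_eq_inner
    by (auto intro!: derivative_eq_intros bounded_linear.has_derivative[OF bounded_linear_base]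
        simp: inner_commute algebra_simps)
  have a: "((\<lambda>x. bp r z0 (base x)) has_derivative (\<lambda>v. bp' r z0 ?z * (- 2 * ((?z - z0) \<bullet> base v)))) (at x)"
    unfolding bp_def bp'_def
    using has_derivative_compose[OF 1 bump_has_derivative[unfolded has_field_derivative_def]] .
  have b: "((\<lambda>x. b (x $ 5)) has_derivative (\<lambda>v. b' * (v $ 5))) (at x)"
    using has_derivative_compose[OF bounded_linear_imp_has_derivative[OF bounded_linear_vec_nth]
        assms(2)[unfolded has_field_derivative_def]] .
  note e = has_derivative_mult[OF has_derivative_of_real[OF hsq_powr_has_derivative[OF assms(1), of ?p]]
      cis_nth_has_derivative[of "-m"]]
  define E' where "E' v = complex_of_real (hsq ?z powr ?p) * (of_real (- m * v $ 5) * (\<i> * cis (- m * x $ 5)))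
      + of_real (?p * hsq ?z powr (?p - 1) * 2 * (?z \<bullet> base v)) * cis (- m * x $ 5)" for v
  have e: "((\<lambda>x. efac m (base x) (x $ 5)) has_derivative E') (at x)"
    unfolding efac_def E'_def by (rule e)
  note d = has_derivative_mult[OF has_derivative_of_real[OF has_derivative_mult[OF a b]] e]
  have hp: "hsq ?z > 0" by (rule hsq_pos[OF assms(1)])
  have "apply_field l x E' = apply_field l x (\<lambda>v. (of_real (hsq ?z powr ?p * (-m)) * \<i> * cis (- m * x $ 5)) * of_real (v $ 5)
     + (of_real (?p * hsq ?z powr (?p - 1) * 2) * cis (- m * x $ 5)) * of_real (?z \<bullet> base v))"
    by (rule arg_cong[where f="apply_field l x"]) (auto simp: E'_def fun_eq_iff mult_ac)
  also have "\<dots> = 0"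
  proof -
    have "hsq ?z powr (?p - 1) = hsq ?z powr ?p * hsq ?z powr (-1)"
      unfolding powr_add[symmetric] by simp
    then show ?thesis
      unfolding apply_field_add apply_field_mult apply_field_inner apply_field_nth5 cfield_nth
      by (simp add: mult_ac)
  qed
  finally have E0: "apply_field l x E' = 0" .
  have "transposed (cfield l) (tfun m r z0 b) x = apply_field l x (\<lambda>v.
      of_real (bp r z0 ?z * b (x $ 5)) * E' v +
      of_real (bp r z0 ?z * (b' * (v $ 5)) + bp' r z0 ?z * (- 2 * ((?z - z0) \<bullet> base v)) * b (x $ 5)) * efac m ?z (x $ 5))"
    by (rule transposed_cfield[OF _ assms(1)]) (use d in \<open>simp add: tfun_def[abs_def]\<close>)
  also have "\<dots> = apply_field l x (\<lambda>v.
      of_real (bp r z0 ?z * b (x $ 5)) * E' v +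
      ((of_real (bp r z0 ?z * b') * efac m ?z (x $ 5)) * of_real (v $ 5) +
       (of_real (- 2 * bp' r z0 ?z * b (x $ 5)) * efac m ?z (x $ 5)) * of_real ((?z - z0) \<bullet> base v)))"
    by (rule arg_cong[where f="apply_field l x"]) (auto simp: fun_eq_iff algebra_simps)
  also have "\<dots> = efac m (base x) (x $ 5) *
    (- of_real (bp' r z0 (base x)) * lin l (base x - z0) * of_real (b (x $ 5))
     + of_real (bp r z0 (base x)) * (\<i> / 2 * lin l (base x) * of_real (hsq (base x) powr (-1))) * of_real b')"
    unfolding apply_field_add apply_field_mult apply_field_inner apply_field_nth5 cfield_nth E0
    by (simp add: algebra_simps)
  finally show ?thesis .
qed

lemma bp_0: "y \<notin> cball z0 r \<Longrightarrow> r > 0 \<Longrightarrow> bp r z0 y = 0" "y \<notin> cball z0 r \<Longrightarrow> r > 0 \<Longrightarrow> bp' r z0 y = 0"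
  using power_mono[of r "norm (y - z0)" 2]
  by (auto simp: bp_def bp'_def dist_norm norm_minus_commute intro!: bump_0 bump'_eq_0)

lemma bp_continuous: "continuous_on S f \<Longrightarrow> continuous_on S (\<lambda>x. bp r z0 (f x))"
    "continuous_on S f \<Longrightarrow> continuous_on S (\<lambda>x. bp' r z0 (f x))"
  unfolding bp_def bp'_def
  by (rule continuous_on_compose2[OF bump_continuous _ subset_UNIV]
      continuous_on_compose2[OF bump'_continuous _ subset_UNIV], intro continuous_intros, assumption)+

lemma smooth_on_tfun:
  assumes "open S" "\<And>x. x \<in> S \<Longrightarrow> norm (base x) > 1" "smooth_on S (\<lambda>x::real^5. b (x $ 5))"
  shows "smooth_on S (tfun m r z0 b)"
proof -
  have 1: "smooth_on S (\<lambda>x. (norm (base x - z0))\<^sup>2)"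
  proof -
    have "smooth_on S (\<lambda>x. base x - z0)" by (intro smooth_on_diff smooth_on_base smooth_on_const assms)
    then show ?thesis unfolding smooth_on_def power2_norm_eq_inner
      by (auto intro: Ck_on_bilinear[OF assms(1) bounded_bilinear_inner])
  qed
  have "smooth_on S (\<lambda>x. (- m) * x $ 5)" by (intro smooth_on_mult smooth_on_const smooth_on_nth assms)
  then show ?thesis
    unfolding tfun_def bp_def efac_def
    by (intro smooth_on_mult smooth_on_of_real smooth_on_bump smooth_on_diff smooth_on_const 1 assms
        smooth_on_powr smooth_on_hsq smooth_on_cis smooth_on_nth) (use assms hsq_pos in auto)
qed

lemma continuous_on_qpt [continuous_intros]:
  assumes "continuous_on S f" "continuous_on S g"
  shows "continuous_on S (\<lambda>x. qpt (f x) (g x))"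
proof -
  have "continuous_on S (\<lambda>x. vec_lambda (\<lambda>i. qpt (f x) (g x) $ i))"
  proof (rule continuous_on_vec_lambda)
    fix i :: 3
    have "continuous_on S (\<lambda>x. qpt (f x) (g x) $ 3)"
      unfolding qpt_nth height_def hsq_def by (intro continuous_intros assms)
    then show "continuous_on S (\<lambda>x. qpt (f x) (g x) $ i)"
      using exhaust_3[of i] continuous_on_fst[OF assms(1)] continuous_on_snd[OF assms(1)]
      by (elim disjE) simp_all
  qed
  then show ?thesis by simp
qed

lemma continuous_on_efac:
  assumes "continuous_on S f" "continuous_on S g" "\<And>x. x \<in> S \<Longrightarrow> norm (f x) > 1"
  shows "continuous_on S (\<lambda>x. efac m (f x) (g x))"
proof -
  have "(norm (f x))\<^sup>2 - 1 \<noteq> 0" if "x \<in> S" for x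
    using hsq_pos[OF assms(3)[OF that]] by (simp add: hsq_def)
  then show ?thesis
    unfolding efac_def hsq_def by (intro continuous_intros assms) blast
qed

subsection \<open>The weak equation for Fourier coefficients\<close>

text \<open>The product of \<open>f\<close> with the transposed test function, as a function of base
  point and angle.\<close>

definition chart_int :: "(complex^3 \<Rightarrow> complex) \<Rightarrow> real \<Rightarrow> real \<Rightarrow> C2 \<Rightarrow> C2 \<Rightarrow> (real \<Rightarrow> real) \<Rightarrow> (real \<Rightarrow> real) \<Rightarrow> C2 \<Rightarrow> real \<Rightarrow> complex" where
  "chart_int f m r z0 l b b' y t = f (qpt y t) * (efac m y t *
    (- of_real (bp' r z0 y) * lin l (y - z0) * of_real (b t)
     + of_real (bp r z0 y) * (\<i> / 2 * lin l y * of_real (hsq y powr (-1))) * of_real (b' t)))"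

lemma chart_int_continuous:
  assumes "continuous_on D f" "W \<subseteq> {z. norm z > 1}" "\<And>z t. z \<in> W \<Longrightarrow> qpt z t \<in> D"
    "\<And>S. continuous_on S b" "\<And>S. continuous_on S b'"
    "continuous_on S p" "continuous_on S q" "p ` S \<subseteq> W"
  shows "continuous_on S (\<lambda>x. chart_int f m r z0 l b b' (p x) (q x))"
proof -
  have 1: "continuous_on S (\<lambda>x. f (qpt (p x) (q x)))"
  proof (rule continuous_on_compose2[OF assms(1) continuous_on_qpt[OF assms(6,7)]])
    show "(\<lambda>x. qpt (p x) (q x)) ` S \<subseteq> D" using assms(8) by (auto intro!: assms(3))
  qed
  have n: "norm (p x) > 1" if "x \<in> S" for x using that assms(2,8) by blast
  have hn: "(norm (p x))\<^sup>2 - 1 \<noteq> 0" if "x \<in> S" for x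
    using hsq_pos[OF n[OF that]] by (simp add: hsq_def)
  have 2: "continuous_on S (\<lambda>x. hsq (p x) powr (-1))"
    unfolding hsq_def by (intro continuous_intros assms) (use hn in blast)
  have 3: "continuous_on S (\<lambda>x. lin l (p x - c))" for c
    by (intro bounded_linear.continuous_on[OF bounded_linear_lin] continuous_intros assms)
  have 4: "continuous_on S (\<lambda>x. b (q x))" "continuous_on S (\<lambda>x. b' (q x))"
    by (rule continuous_on_compose2[OF assms(4)[of UNIV] assms(7) subset_UNIV]
        continuous_on_compose2[OF assms(5)[of UNIV] assms(7) subset_UNIV])+
  show ?thesis unfolding chart_int_def
    by (intro continuous_on_mult continuous_on_add continuous_on_minus continuous_on_of_real continuous_on_const
        1 2 3 3[of 0, simplified] 4 continuous_on_efac bp_continuous assms n)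
qed

text \<open>The CR condition in one angular window, tested with \<open>tfun\<close> and turned into
  an iterated integral by Fubini. Because \<open>b\<close> vanishes near both ends of the window,
  the test function has compact support in the chart.\<close>

lemma weak_chart:
  assumes f: "f \<in> CR quadric D" and W: "open W" "W \<subseteq> {z. norm z > 1}" "\<And>z t. z \<in> W \<Longrightarrow> qpt z t \<in> D"
    and r: "r > 0" "cball z0 r \<subseteq> W"
    and b: "smooth_on UNIV (\<lambda>x::real^5. b (x $ 5))" "\<And>t. (b has_real_derivative b' t) (at t)"
      "\<And>S. continuous_on S b'"
    and \<delta>: "\<delta> > 0" "\<And>t. a \<le> t \<Longrightarrow> t \<le> a + 2 * pi \<Longrightarrow> t < a + \<delta> \<or> a + 2 * pi - \<delta> < t \<Longrightarrow> b t = 0 \<and> b' t = 0"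
    and A: "cball z0 r \<subseteq> cbox (-A) A"
  shows "integral (cbox (-A) A) (\<lambda>y. if y \<in> W then integral {a..a+2*pi} (chart_int f m r z0 l b b' y) else 0) = 0"
    "(\<lambda>y. if y \<in> W then integral {a..a+2*pi} (chart_int f m r z0 l b b' y) else 0) integrable_on cbox (-A) A"
proof -
  let ?V = "qdom W a"
  have oV: "open ?V" by (rule open_qdom[OF W(1)])
  have nV: "norm (base x) > 1" if "x \<in> ?V" for x using that W by (auto simp: qdom_def)
  have fc: "continuous_on D f" using f by (simp add: CR_def)
  have bc: "continuous_on S b" for S
    by (intro continuous_at_imp_continuous_on ballI DERIV_isCont[OF b(2)])
  define Q where "Q = W \<times> {a<..<a+2*pi}"
  define C where "C = cball z0 r \<times> {a+\<delta>..a+2*pi-\<delta>}"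
  \<comment> \<open>Extension by zero to the whole product space, continuous because the integrand
    vanishes on \<open>Q\<close> off the closed set \<open>C\<close>.\<close>
  define G where "G p = (if p \<in> Q then chart_int f m r z0 l b b' (fst p) (snd p) else 0)" for p
  have C: "closed C" "C \<subseteq> Q" unfolding C_def Q_def using r(2) \<delta>(1) by (auto intro!: closed_Times)
  have z: "chart_int f m r z0 l b b' (fst p) (snd p) = 0" if "p \<in> W \<times> {a..a+2*pi} - C" for p
  proof (cases "fst p \<in> cball z0 r")
    case True
    with that have "b (snd p) = 0 \<and> b' (snd p) = 0"
      using \<delta>(2)[of "snd p"] by (cases p) (auto simp: C_def)
    then show ?thesis by (simp add: chart_int_def)
  next
    case False
    then show ?thesis using bp_0[OF False r(1)] by (simp add: chart_int_def)
  qed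
  have Gc: "continuous_on UNIV G"
  proof -
    have oQ: "open Q" unfolding Q_def using W(1) by (intro open_Times) auto
    have "continuous_on Q (\<lambda>p. chart_int f m r z0 l b b' (fst p) (snd p))"
      by (rule chart_int_continuous[OF fc W(2,3) bc b(3)]) (auto intro!: continuous_intros simp: Q_def)
    then have "continuous_on Q G"
      by (rule continuous_on_eq) (simp add: G_def)
    moreover have "continuous_on (- C) G"
      by (rule continuous_on_eq[OF continuous_on_const[of _ 0]]) (use z in \<open>auto simp: G_def Q_def\<close>)
    ultimately have "continuous_on (Q \<union> - C) G"
      using oQ C(1) by (intro continuous_on_open_Un) auto
    moreover have "Q \<union> - C = UNIV" using C(2) by auto
    ultimately show ?thesis by simp
  qed
  have G0: "G p = 0" if "p \<notin> cbox (-A, a) (A, a + 2 * pi)" for p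
  proof (rule ccontr)
    assume "G p \<noteq> 0"
    then have Q: "p \<in> Q" and n: "chart_int f m r z0 l b b' (fst p) (snd p) \<noteq> 0"
      by (auto simp: G_def split: if_splits)
    from Q have "p \<in> W \<times> {a..a+2*pi}" by (auto simp: Q_def)
    with z[of p] n have "p \<in> C" by blast
    with A \<delta>(1) that show False by (cases p) (auto simp: C_def cbox_Pair_eq)
  qed
  define \<phi> where "\<phi> x = (if x \<in> ?V then tfun m r z0 b x else 0)" for x
  define Cx where "Cx = coords -` C"
  have Cx: "compact Cx"
  proof -
    have "Cx = coords_inv ` C" unfolding Cx_def by (auto intro!: image_eqI[where x="coords _"])
    moreover have "compact C" unfolding C_def by (intro compact_Times) auto
    ultimately show ?thesis using compact_continuous_image[OF continuous_coords_inv] by simp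
  qed
  have CxV: "Cx \<subseteq> ?V" using C(2) by (auto simp: Cx_def Q_def qdom_def coords_def)
  have tz: "tfun m r z0 b x = 0" if "x \<in> ?V - Cx" for x
  proof (cases "base x \<in> cball z0 r")
    case True
    with that have "b (x $ 5) = 0"
      using \<delta>(2)[of "x $ 5"] by (auto simp: C_def Cx_def coords_def qdom_def)
    then show ?thesis by (simp add: tfun_def)
  next
    case False
    then show ?thesis using bp_0[OF False r(1)] by (simp add: tfun_def)
  qed
  have "smooth_on UNIV \<phi>" unfolding \<phi>_def
    by (rule smooth_on_extend_zero[OF oV compact_imp_closed[OF Cx] CxV smooth_on_tfun[OF oV nV smooth_on_subset[OF b(1)]] tz]) auto
  then have t: "test_function ?V \<phi>"
    by (rule test_functionI[OF _ Cx CxV]) (use tz in \<open>auto simp: \<phi>_def\<close>)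
  have "qchart ` ?V \<subseteq> D"
  proof
    fix p assume "p \<in> qchart ` ?V"
    then obtain x where "x \<in> ?V" "p = qchart x" by blast
    then show "p \<in> D" using W(3)[of "base x" "x $ 5"] by (simp add: qdom_def qchart_def)
  qed
  then have "weakly_annihilates ?V (cfield l) (f \<circ> qchart)"
    using f local_param_qchart[OF W(1,2), of a] CR_vector_field_cfield[OF W(1,2), of a l]
    unfolding CR_def by blast
  then have "(LINT x:?V|lborel. (f \<circ> qchart) x * transposed (cfield l) \<phi> x) = 0"
    using t by (simp add: weakly_annihilates_iff)
  moreover have "indicator ?V x *\<^sub>R ((f \<circ> qchart) x * transposed (cfield l) \<phi> x) = G (coords x)" for x
  proof (cases "x \<in> ?V")
    case True
    have "frechet_derivative (\<lambda>y. cfield l y $ i * \<phi> y) (at x) = frechet_derivative (\<lambda>y. cfield l y $ i * tfun m r z0 b y) (at x)" for i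
      by (rule frechet_derivative_cong_open[OF oV True]) (simp add: \<phi>_def)
    then have "transposed (cfield l) \<phi> x = transposed (cfield l) (tfun m r z0 b) x"
      by (simp add: transposed_def partial_deriv_def)
    also note transposed_tfun[OF nV[OF True] b(2)]
    finally show ?thesis using True
      by (simp add: G_def chart_int_def Q_def qdom_def coords_def qchart_def)
  next
    case False
    then show ?thesis by (auto simp: G_def Q_def qdom_def coords_def)
  qed
  ultimately have "(LINT x|lborel. G (coords x)) = 0" by (simp add: set_lebesgue_integral_def)
  then have "(LINT p|lborel. G p) = 0" using lborel_integral_coords[OF Gc] by simp
  then have I: "integral (cbox (-A) A) (\<lambda>y. integral (cbox a (a+2*pi)) (\<lambda>t. G (y, t))) = 0"
    using lborel_integral_eq_integral_cbox(1)[OF Gc G0]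
      integral_prod_continuous[OF continuous_on_subset[OF Gc subset_UNIV], of "-A" a A "a+2*pi"] by simp
  have eq: "integral (cbox a (a+2*pi)) (\<lambda>t. G (y, t)) =
      (if y \<in> W then integral {a..a+2*pi} (chart_int f m r z0 l b b' y) else 0)" for y
  proof (cases "y \<in> W")
    case True
    have "G (y, t) = chart_int f m r z0 l b b' y t" if "t \<in> {a..a+2*pi}" for t
    proof (cases "(y, t) \<in> Q")
      case False
      then have "(y, t) \<notin> C" using C(2) by blast
      then show ?thesis using z[of "(y, t)"] True that False by (simp add: G_def)
    qed (simp add: G_def)
    then have "integral {a..a+2*pi} (\<lambda>t. G (y, t)) = integral {a..a+2*pi} (chart_int f m r z0 l b b' y)"
      by (rule integral_cong)
    then show ?thesis using True by simp
  qed (simp add: G_def Q_def)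
  show "integral (cbox (-A) A) (\<lambda>y. if y \<in> W then integral {a..a+2*pi} (chart_int f m r z0 l b b' y) else 0) = 0"
    using I unfolding eq .
  have "continuous_on (cbox (-A) A) (\<lambda>y. integral (cbox a (a+2*pi)) (\<lambda>t. G (y, t)))"
    by (rule integral_continuous_on_param) (simp add: split_beta continuous_on_subset[OF Gc])
  then show "(\<lambda>y. if y \<in> W then integral {a..a+2*pi} (chart_int f m r z0 l b b' y) else 0) integrable_on cbox (-A) A"
    unfolding eq by (rule integrable_continuous)
qed

lemma continuous_on_extend_zero:
  assumes "open V" "closed C" "C \<subseteq> V" "continuous_on V f" "\<And>x. x \<in> V - C \<Longrightarrow> f x = 0"
  shows "continuous_on UNIV (\<lambda>x. if x \<in> V then f x else 0)" (is "continuous_on _ ?g")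
proof -
  have "continuous_on V ?g" by (rule continuous_on_eq[OF assms(4)]) simp
  moreover have "continuous_on (- C) ?g"
    by (rule continuous_on_eq[OF continuous_on_const[of _ 0]]) (use assms(5) in auto)
  ultimately have "continuous_on (V \<union> - C) ?g"
    using assms(1,2) by (intro continuous_on_open_Un) auto
  moreover have "V \<union> - C = UNIV" using assms(3) by auto
  ultimately show ?thesis by simp
qed

text \<open>A 2 pi-periodic function that is 0 near the angle 0 and 1 near the angle pi:
  \<open>cut\<close> fits the window starting at 0, and \<open>1 - cut\<close> the window starting
  at -pi.\<close>

definition cut :: "real \<Rightarrow> real" where "cut t = cutoff (cos t + 1/2)"
definition cut' :: "real \<Rightarrow> real" where
  "cut' t = - bump' (bump 1 - bump (cos t + 1/2)) * bump' (cos t + 1/2) * - sin t / bump (bump 1)"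

lemma cut_has_derivative: "(cut has_real_derivative cut' t) (at t)"
proof -
  have 1: "((\<lambda>t. cos t + 1/2) has_real_derivative - sin t) (at t)"
    by (auto intro!: derivative_eq_intros)
  have 2: "((\<lambda>t. bump 1 - bump (cos t + 1/2)) has_real_derivative - (bump' (cos t + 1/2) * - sin t)) (at t)"
    using DERIV_diff[OF DERIV_const DERIV_chain2[OF bump_has_derivative 1], of "bump 1"] by simp
  have "((\<lambda>t. bump (bump 1 - bump (cos t + 1/2)) / bump (bump 1)) has_real_derivative
      bump' (bump 1 - bump (cos t + 1/2)) * - (bump' (cos t + 1/2) * - sin t) / bump (bump 1)) (at t)"
    by (rule DERIV_cdivide[OF DERIV_chain2[OF bump_has_derivative 2]])
  then show ?thesis unfolding cut_def[abs_def] cutoff_def cut'_def by (simp add: mult.assoc)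
qed

lemma cut'_continuous: "continuous_on S cut'"
  unfolding cut'_def divide_inverse
  by (intro continuous_intros continuous_on_compose2[OF bump'_continuous[of UNIV]]
      continuous_on_compose2[OF bump_continuous[of UNIV]] subset_UNIV)

lemma bump_mono1: "t \<ge> 1 \<Longrightarrow> bump t \<ge> bump 1"
  by (auto simp: bump_def flat_def field_simps)

lemma cut_near_0: "cos t \<ge> 1/2 \<Longrightarrow> cut t = 0 \<and> cut' t = 0"
  using bump_mono1[of "cos t + 1/2"] by (auto simp: cut_def cut'_def cutoff_eq_0 bump'_eq_0)

lemma cut_near_pi: "cos t \<le> -1/2 \<Longrightarrow> cut t = 1 \<and> cut' t = 0"
  by (auto simp: cut_def cut'_def cutoff_eq_1 bump'_eq_0)

lemma cos_ge_half: "0 \<le> t \<Longrightarrow> t \<le> 2 * pi \<Longrightarrow> t < pi / 3 \<or> 2 * pi - pi / 3 < t \<Longrightarrow> cos t \<ge> 1/2"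
proof -
  assume t: "0 \<le> t" "t \<le> 2 * pi" "t < pi / 3 \<or> 2 * pi - pi / 3 < t"
  have *: "cos s \<ge> 1/2" if "0 \<le> s" "s \<le> pi / 3" for s
    using cos_monotone_0_pi_le[of s "pi/3"] that by (simp add: cos_60)
  show ?thesis
  proof (cases "t < pi / 3")
    case True
    then show ?thesis using *[of t] t by simp
  next
    case False
    then have "cos (2 * pi - t) \<ge> 1/2" using *[of "2 * pi - t"] t by simp
    then show ?thesis by (simp add: cos_diff)
  qed
qed

lemma integral_periodic:
  fixes G :: "real \<Rightarrow> complex"
  assumes "\<And>S. continuous_on S G" "\<And>t. G (t + 2 * pi) = G t"
  shows "integral {-pi..pi} G = integral {0..2*pi} G"
proof -
  have i: "G integrable_on {a..b}" for a b by (rule integrable_continuous_interval[OF assms(1)])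
  have "integral {-pi..0} G = integral {pi..2*pi} G"
    using integral_shift_real_ivl[of "pi" "2*pi" "2*pi" G] assms(2) by simp
  moreover have "integral {-pi..0} G + integral {0..pi} G = integral {-pi..pi} G"
    by (rule Henstock_Kurzweil_Integration.integral_combine) (use i in auto)
  moreover have "integral {0..pi} G + integral {pi..2*pi} G = integral {0..2*pi} G"
    by (rule Henstock_Kurzweil_Integration.integral_combine) (use i in auto)
  ultimately show ?thesis by (metis add.commute)
qed

text \<open>The coefficient of z_3^k as the circle mean of f z_3^(-k). The power of the height
  contained in \<open>efac\<close> is what makes it holomorphic in z, unlike the plain Fourier
  coefficient in t.\<close>

definition fcoef :: "(complex^3 \<Rightarrow> complex) \<Rightarrow> int \<Rightarrow> C2 \<Rightarrow> complex" where
  "fcoef f k z = inverse (2*pi) *\<^sub>R integral (cbox 0 (2*pi)) (\<lambda>t. f (qpt z t) * efac (of_int k) z t)"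

lemma continuous_on_circle_fun:
  assumes "continuous_on D f" "W \<subseteq> {z. norm z > 1}" "\<And>z t. z \<in> W \<Longrightarrow> qpt z t \<in> D"
    "continuous_on S p" "continuous_on S q" "p ` S \<subseteq> W"
  shows "continuous_on S (\<lambda>x. f (qpt (p x) (q x)) * efac m (p x) (q x))"
proof (rule continuous_on_mult)
  show "continuous_on S (\<lambda>x. f (qpt (p x) (q x)))"
    by (rule continuous_on_compose2[OF assms(1) continuous_on_qpt[OF assms(4,5)]])
      (use assms(6) in \<open>auto intro!: assms(3)\<close>)
  show "continuous_on S (\<lambda>x. efac m (p x) (q x))"
    by (rule continuous_on_efac) (use assms in auto)
qed

lemma fcoef_continuous:
  assumes "continuous_on D f" "W \<subseteq> {z. norm z > 1}" "\<And>z t. z \<in> W \<Longrightarrow> qpt z t \<in> D"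
  shows "continuous_on W (fcoef f k)"
proof -
  have "continuous_on (W \<times> cbox 0 (2*pi)) (\<lambda>x. f (qpt (fst x) (snd x)) * efac (of_int k) (fst x) (snd x))"
    by (rule continuous_on_circle_fun[OF assms]) (auto intro!: continuous_intros)
  then have "continuous_on (W \<times> cbox 0 (2*pi)) (\<lambda>(z, t). f (qpt z t) * efac (of_int k) z t)"
    by (simp add: split_beta)
  then show ?thesis
    unfolding fcoef_def[abs_def] by (intro continuous_intros integral_continuous_on_param)
qed

lemma cis_add_2pi: "cis (t + 2 * pi) = cis t"
  by (simp add: cis_mult[symmetric])

lemma cis_int_2pi: "cis (of_int k * (2 * pi)) = 1"
  using cis_multiple_2pi[of "of_int k"] by (simp add: mult_ac)

lemma efac_periodic: "efac (of_int k) z (t + 2 * pi) = efac (of_int k) z t"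
proof -
  have "cis (- real_of_int k * (t + 2 * pi)) = cis (- real_of_int k * t) * cis (of_int (-k) * (2 * pi))"
    by (simp add: cis_mult algebra_simps)
  then show ?thesis unfolding efac_def cis_int_2pi by simp
qed

text \<open>The equations of the windows starting at 0 and at -pi are added with the cutoffs
  \<open>cut\<close> and \<open>1 - cut\<close>. Periodicity moves both integrals to one interval,
  the cutoffs sum to 1 and their derivatives cancel; -2 pi times the weak equation remains.\<close>

lemma fcoef_weak:
  assumes f: "f \<in> CR quadric D" and W: "open W" "W \<subseteq> {z. norm z > 1}" "\<And>z t. z \<in> W \<Longrightarrow> qpt z t \<in> D"
    and r: "r > 0" "cball z0 r \<subseteq> W"
  shows "(LINT y:cball z0 r|lborel. bp' r z0 y *\<^sub>R fcoef f k y * lin l (y - z0)) = 0"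
proof -
  have fc: "continuous_on D f" using f by (simp add: CR_def)
  obtain A where A: "cball z0 r \<subseteq> cbox (-A) A"
    using bounded_subset_cbox_symmetric[OF bounded_cball] by blast
  let ?m = "real_of_int k"
  let ?c1 = "\<lambda>y. chart_int f ?m r z0 l cut cut' y"
  let ?c2 = "\<lambda>y. chart_int f ?m r z0 l (\<lambda>t. 1 - cut t) (\<lambda>t. - cut' t) y"
  let ?J1 = "\<lambda>y. if y \<in> W then integral {0..0+2*pi} (?c1 y) else 0"
  let ?J2 = "\<lambda>y. if y \<in> W then integral {-pi..-pi+2*pi} (?c2 y) else 0"
  have sm: "smooth_on UNIV (\<lambda>x::real^5. cut (x $ 5))"
    unfolding cut_def by (intro smooth_on_cutoff smooth_on_add smooth_on_cos smooth_on_nth smooth_on_const) auto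
  have sm2: "smooth_on UNIV (\<lambda>x::real^5. 1 - cut (x $ 5))"
    by (intro smooth_on_diff smooth_on_const sm) auto
  have pos: "pi / 3 > 0" by simp
  have J1: "integral (cbox (-A) A) ?J1 = 0" "?J1 integrable_on cbox (-A) A"
    by (rule weak_chart[OF f W r sm cut_has_derivative cut'_continuous pos _ A];
        use cos_ge_half cut_near_0 in simp)+
  have e2: "1 - cut t = 0 \<and> - cut' t = 0"
    if "- pi \<le> t" "t \<le> - pi + 2 * pi" "t < - pi + pi / 3 \<or> - pi + 2 * pi - pi / 3 < t" for t
  proof -
    have "cos (t + pi) \<ge> 1/2" by (rule cos_ge_half) (use that in auto)
    then show ?thesis using cut_near_pi[of t] by simp
  qed
  have d2: "((\<lambda>t. 1 - cut t) has_real_derivative - cut' t) (at t)" for t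
    using DERIV_diff[OF DERIV_const cut_has_derivative, of 1] by simp
  have J2: "integral (cbox (-A) A) ?J2 = 0" "?J2 integrable_on cbox (-A) A"
    by (rule weak_chart[OF f W r sm2 d2 continuous_on_minus[OF cut'_continuous] pos e2 A]; assumption)+
  let ?F = "\<lambda>y. if y \<in> W then bp' r z0 y *\<^sub>R fcoef f k y * lin l (y - z0) else 0"
  have sum: "?J1 y + ?J2 y = (- (2 * pi)) *\<^sub>R ?F y" for y
  proof (cases "y \<in> W")
    case True
    have cut_c: "continuous_on S cut" for S
      by (intro continuous_at_imp_continuous_on ballI DERIV_isCont[OF cut_has_derivative])
    define g where "g t = f (qpt y t) * efac ?m y t" for t
    have gc: "continuous_on S g" for S
      unfolding g_def by (rule continuous_on_circle_fun[OF fc W(2,3)]) (use True in \<open>auto intro!: continuous_intros\<close>)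
    have gp: "g (t + 2 * pi) = g t" for t
      unfolding g_def efac_periodic by (simp add: qpt_def cis_add_2pi)
    have cp: "cut (t + 2 * pi) = cut t" "cut' (t + 2 * pi) = cut' t" for t
      by (simp_all add: cut_def cut'_def)
    define P where "P = - of_real (bp' r z0 y) * lin l (y - z0)"
    define Q where "Q = of_real (bp r z0 y) * (\<i> / 2 * lin l y * of_real (hsq y powr (-1)))"
    have c1: "?c1 y t = g t * (P * of_real (cut t) + Q * of_real (cut' t))" for t
      by (simp add: chart_int_def g_def P_def Q_def)
    have c2: "?c2 y t = g t * (P * of_real (1 - cut t) + Q * of_real (- cut' t))" for t
      unfolding chart_int_def g_def P_def Q_def by (simp add: mult_ac)
    have cc: "continuous_on S (?c1 y)" "continuous_on S (?c2 y)" for S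
      unfolding c1 c2 by (intro continuous_intros gc cut_c cut'_continuous)+
    have "integral {-pi..-pi+2*pi} (?c2 y) = integral {0..2*pi} (?c2 y)"
      using integral_periodic[of "?c2 y", OF cc(2)] unfolding c2 gp cp by simp
    then have "integral {0..0+2*pi} (?c1 y) + integral {-pi..-pi+2*pi} (?c2 y) =
        integral {0..2*pi} (\<lambda>t. ?c1 y t + ?c2 y t)"
      using integral_add[OF integrable_continuous_interval[OF cc(1)] integrable_continuous_interval[OF cc(2)], of 0 "2*pi"]
      by simp
    also have "(\<lambda>t. ?c1 y t + ?c2 y t) = (\<lambda>t. P * g t)"
      unfolding c1 c2 by (simp add: fun_eq_iff algebra_simps)
    also have "integral {0..2*pi} (\<lambda>t. P * g t) = P * integral {0..2*pi} g" by simp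
    also have "integral {0..2*pi} g = (2 * pi) *\<^sub>R fcoef f k y"
      by (simp add: fcoef_def g_def[abs_def])
    finally show ?thesis using True by (simp add: P_def scaleR_conv_of_real)
  qed simp
  have "integral (cbox (-A) A) (\<lambda>y. (- (2 * pi)) *\<^sub>R ?F y) = 0"
    unfolding sum[symmetric] using integral_add[OF J1(2) J2(2)] J1(1) J2(1) by simp
  then have I: "integral (cbox (-A) A) ?F = 0" by (simp del: if_split)
  have z: "bp' r z0 y *\<^sub>R fcoef f k y * lin l (y - z0) = 0" if "y \<notin> cball z0 r" for y
    using bp_0(2)[OF that r(1)] by simp
  have "continuous_on UNIV ?F"
    by (rule continuous_on_extend_zero[OF W(1) closed_cball r(2)])
      (use z in \<open>auto intro!: continuous_intros bp_continuous fcoef_continuous[OF fc W(2,3)]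
        bounded_linear.continuous_on[OF bounded_linear_lin]\<close>)
  then have "(LINT y|lborel. ?F y) = integral (cbox (-A) A) ?F"
  proof (rule lborel_integral_eq_integral_cbox(1))
    fix y assume "y \<notin> cbox (-A) A"
    then have "y \<notin> cball z0 r" using A by blast
    from z[OF this] show "?F y = 0" by simp
  qed
  then have "(LINT y|lborel. ?F y) = 0" unfolding I .
  moreover have "?F y = indicator (cball z0 r) y *\<^sub>R (bp' r z0 y *\<^sub>R fcoef f k y * lin l (y - z0))" for y
    using z[of y] r(2) by (cases "y \<in> cball z0 r") auto
  ultimately show ?thesis unfolding set_lebesgue_integral_def by simp
qed

lemma hol2_fcoef:
  assumes f: "f \<in> CR quadric D" and W: "open W" "W \<subseteq> {z. norm z > 1}" "\<And>z t. z \<in> W \<Longrightarrow> qpt z t \<in> D"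
  shows "hol2 W (fcoef f k)"
proof (rule hol2_of_weak[OF W(1)])
  show "continuous_on W (fcoef f k)" using f by (intro fcoef_continuous[OF _ W(2,3)]) (auto simp: CR_def)
  show "(LINT y:cball z r|lborel. bump' (r\<^sup>2 - (norm (y - z))\<^sup>2) *\<^sub>R fcoef f k y * fst (y - z)) = 0"
    "(LINT y:cball z r|lborel. bump' (r\<^sup>2 - (norm (y - z))\<^sup>2) *\<^sub>R fcoef f k y * snd (y - z)) = 0"
    if "r > 0" "cball z r \<subseteq> W" for z r
    using fcoef_weak[OF f W that, of k "(1,0)"] fcoef_weak[OF f W that, of k "(0,1)"]
    by (simp_all add: lin_def bp'_def)
qed

subsection \<open>Uniqueness of Fourier coefficients\<close>

text \<open>Continuous functions orthogonal to all characters. The class is stable under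
  multiplication by characters, hence by trigonometric polynomials.\<close>

definition fnull :: "(real \<Rightarrow> complex) \<Rightarrow> bool" where
  "fnull h \<longleftrightarrow> continuous_on {0..2*pi} h \<and> (\<forall>k::int. integral {0..2*pi} (\<lambda>t. h t * cis (of_int k * t)) = 0)"

lemma fnull_integrable: "fnull h \<Longrightarrow> (\<lambda>t. h t * cis (k * t)) integrable_on {0..2*pi}"
  unfolding fnull_def by (intro integrable_continuous_interval continuous_intros) auto

lemma fnull_add: "fnull h \<Longrightarrow> fnull g \<Longrightarrow> fnull (\<lambda>t. h t + g t)"
  using integral_add[OF fnull_integrable fnull_integrable, of h g]
  unfolding fnull_def by (auto simp: distrib_right intro!: continuous_intros)

lemma fnull_mult: "fnull h \<Longrightarrow> fnull (\<lambda>t. c * h t)"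
  unfolding fnull_def by (auto simp: mult.assoc intro!: continuous_intros)

lemma fnull_cis: assumes "fnull h" shows "fnull (\<lambda>t. h t * cis (of_int j * t))"
proof -
  have "integral {0..2*pi} (\<lambda>t. h t * cis (of_int j * t) * cis (of_int k * t)) = 0" for k
  proof -
    have "(\<lambda>t. h t * cis (of_int j * t) * cis (of_int k * t)) = (\<lambda>t. h t * cis (of_int (j + k) * t))"
      by (auto simp: mult.assoc cis_mult algebra_simps)
    then show ?thesis using assms unfolding fnull_def by presburger
  qed
  then show ?thesis using assms unfolding fnull_def by (auto intro!: continuous_intros)
qed

lemma fnull_real_polynomial:
  assumes "real_polynomial_function q"
  shows "fnull h \<Longrightarrow> fnull (\<lambda>t. h t * of_real (q (cis t)))"
  using assms
proof (induction q arbitrary: h rule: real_polynomial_function.induct)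
  case (linear q)
  have "q (cis t) = cos t * q 1 + sin t * q \<i>" for t
  proof -
    have "cis t = cos t *\<^sub>R 1 + sin t *\<^sub>R \<i>" by (simp add: complex_eq_iff)
    then show ?thesis
      using linear(1) by (simp add: bounded_linear.linear linear_add linear_scale)
  qed
  moreover have "cis (of_int 1 * t) = of_real (cos t) + \<i> * of_real (sin t)"
    "cis (of_int (-1) * t) = of_real (cos t) - \<i> * of_real (sin t)" for t
    by (simp_all add: complex_eq_iff)
  ultimately have "h t * of_real (q (cis t)) =
      ((of_real (q 1) - \<i> * of_real (q \<i>)) / 2) * (h t * cis (of_int 1 * t)) +
      ((of_real (q 1) + \<i> * of_real (q \<i>)) / 2) * (h t * cis (of_int (-1) * t))" for t
    by (simp only: of_real_add of_real_mult) (simp add: field_simps)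
  then show ?case
    using fnull_add[OF fnull_mult[OF fnull_cis[OF linear(2)]] fnull_mult[OF fnull_cis[OF linear(2)]]] by presburger
next
  case (const c)
  then show ?case using fnull_mult[of h "of_real c"] by (simp add: mult.commute)
next
  case (add f g)
  from fnull_add[OF add.IH(1)[OF add.prems] add.IH(2)[OF add.prems]]
  show ?case by (simp add: algebra_simps)
next
  case (mult f g)
  from mult.IH(2)[OF mult.IH(1)[OF mult.prems]] show ?case by (simp add: mult_ac)
qed

text \<open>Polynomials in the real coordinates restrict to trigonometric polynomials on the circle,
  and \<open>G\<close> is orthogonal to those. Approximating the conjugate of \<open>G\<close> by
  them shows that the integral of |G|^2 is zero.\<close>

lemma fourier_unique:
  assumes G: "continuous_on (sphere 0 1) G"
    and co: "\<And>k::int. integral {0..2*pi} (\<lambda>t. G (cis t) * cis (of_int k * t)) = 0"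
  shows "G (cis s) = 0"
proof -
  let ?I = "{0..2*pi}"
  have c: "continuous_on S (\<lambda>t. G (cis t))" for S
    by (rule continuous_on_compose2[OF G]) (auto intro!: continuous_intros)
  have fn: "fnull (\<lambda>t. G (cis t))" using c co by (simp add: fnull_def)
  define B where "B = integral ?I (\<lambda>t. norm (G (cis t)))"
  have nB: "B \<ge> 0" unfolding B_def by (rule integral_nonneg[OF integrable_continuous_interval]) (auto intro!: continuous_intros c)
  have est: "norm (integral ?I (\<lambda>t. G (cis t) * cnj (G (cis t)))) \<le> e * B" if e: "e > 0" for e
  proof -
    obtain p where p: "polynomial_function p" "\<And>x. x \<in> sphere 0 1 \<Longrightarrow> norm (cnj (G x) - p x) < e"
      using Stone_Weierstrass_polynomial_function[OF compact_sphere continuous_on_cnj[OF G] e] by blast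
    have pc: "continuous_on S (\<lambda>t. p (cis t))" for S
      by (rule continuous_on_compose2[OF continuous_on_polymonial_function[OF p(1), of UNIV]]) (auto intro!: continuous_intros)
    have "real_polynomial_function (\<lambda>x. Re (p x))" "real_polynomial_function (\<lambda>x. Im (p x))"
      using p(1) unfolding polynomial_function_def by (auto dest: spec[of _ Re] spec[of _ Im] intro: bounded_linear_Re bounded_linear_Im simp: o_def)
    then have "fnull (\<lambda>t. G (cis t) * of_real (Re (p (cis t))) + \<i> * (G (cis t) * of_real (Im (p (cis t)))))"
      using fnull_real_polynomial[OF _ fn] by (intro fnull_add fnull_mult) auto
    moreover have "G (cis t) * of_real (Re (p (cis t))) + \<i> * (G (cis t) * of_real (Im (p (cis t)))) = G (cis t) * p (cis t)" for t
      by (simp add: complex_eq_iff algebra_simps)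
    ultimately have "fnull (\<lambda>t. G (cis t) * p (cis t))" by simp
    then have 0: "integral ?I (\<lambda>t. G (cis t) * p (cis t)) = 0"
      unfolding fnull_def by (auto dest: spec[of _ 0])
    have "integral ?I (\<lambda>t. G (cis t) * cnj (G (cis t))) = integral ?I (\<lambda>t. G (cis t) * cnj (G (cis t)) - G (cis t) * p (cis t))"
      using integral_diff[of "\<lambda>t. G (cis t) * cnj (G (cis t))" ?I "\<lambda>t. G (cis t) * p (cis t)"] 0
      by (simp add: integrable_continuous_interval continuous_on_mult continuous_on_cnj c pc)
    also have "norm \<dots> \<le> integral ?I (\<lambda>t. e * norm (G (cis t)))"
    proof (rule integral_norm_bound_integral)
      show "(\<lambda>t. G (cis t) * cnj (G (cis t)) - G (cis t) * p (cis t)) integrable_on ?I"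
        by (intro integrable_continuous_interval continuous_intros c pc)
      show "(\<lambda>t. e * norm (G (cis t))) integrable_on ?I"
        by (intro integrable_continuous_interval continuous_intros c)
      show "norm (G (cis t) * cnj (G (cis t)) - G (cis t) * p (cis t)) \<le> e * norm (G (cis t))" for t
        using mult_left_mono[OF less_imp_le[OF p(2)[of "cis t"]], of "norm (G (cis t))"]
        by (simp add: norm_mult[symmetric] right_diff_distrib mult.commute)
    qed
    finally show ?thesis by (simp add: B_def)
  qed
  have sq: "integral ?I (\<lambda>t. G (cis t) * cnj (G (cis t))) = of_real (integral ?I (\<lambda>t. (norm (G (cis t)))\<^sup>2))"
    unfolding complex_norm_square[symmetric]
    using integral_linear[OF integrable_continuous_interval bounded_linear_of_real, of 0 "2*pi" "\<lambda>t. (norm (G (cis t)))\<^sup>2"]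
    by (simp add: o_def continuous_on_norm continuous_on_power c)
  have "norm (integral ?I (\<lambda>t. G (cis t) * cnj (G (cis t)))) \<le> 0"
  proof (rule field_le_epsilon)
    fix e :: real assume "e > 0"
    have "e / (B + 1) * B \<le> e" using \<open>e > 0\<close> nB by (simp add: field_simps)
    then show "norm (integral ?I (\<lambda>t. G (cis t) * cnj (G (cis t)))) \<le> 0 + e"
      using est[of "e / (B + 1)"] \<open>e > 0\<close> nB by auto
  qed
  then have "integral (cbox 0 (2*pi)) (\<lambda>t. (norm (G (cis t)))\<^sup>2) = 0" using sq by simp
  moreover have cc: "continuous_on (cbox 0 (2*pi)) (\<lambda>t. (norm (G (cis t)))\<^sup>2)" by (intro continuous_intros c)
  ultimately have h0: "((\<lambda>t. (norm (G (cis t)))\<^sup>2) has_integral 0) (cbox 0 (2*pi))"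
    using integrable_integral[OF integrable_continuous[OF cc]] by simp
  have z: "G (cis t) = 0" if "t \<in> {0..2*pi}" for t
    using has_integral_0_cbox_imp_0[OF cc _ h0, of t] that pi_gt_zero by (auto simp: box_real)
  show ?thesis
  proof (cases "Arg (cis s) \<ge> 0")
    case True
    then show ?thesis using z[of "Arg (cis s)"] Arg_le_pi[of "cis s"] cis_Arg[of "cis s"]
      by (simp add: sgn_eq)
  next
    case False
    then show ?thesis using z[of "Arg (cis s) + 2 * pi"] mpi_less_Arg[of "cis s"] cis_Arg[of "cis s"]
      by (simp add: sgn_eq cis_add_2pi)
  qed
qed

subsection \<open>Identity theorems along lines\<close>

text \<open>The connected real set lies in a single component of \<open>T\<close>, where analytic
  continuation in one variable applies.\<close>

lemma real_identity:
  fixes F :: "complex \<Rightarrow> complex"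
  assumes F: "F holomorphic_on T" "open T" and J: "connected J" "of_real ` J \<subseteq> T"
    and U: "U \<subseteq> J" "\<xi> \<in> J" "\<xi> islimpt U" "\<And>s. s \<in> U \<Longrightarrow> F (of_real s) = 0"
    and s: "s \<in> J"
  shows "F (of_real s) = 0"
proof -
  let ?S = "connected_component_set T (of_real \<xi>)"
  have cJ: "connected (of_real ` J :: complex set)"
    by (intro connected_continuous_image J continuous_intros)
  have JS: "of_real ` J \<subseteq> ?S"
    by (rule connected_component_maximal[OF _ cJ J(2)]) (use U in auto)
  have lim: "complex_of_real \<xi> islimpt (of_real ` U)"
    unfolding islimpt_approachable
  proof (intro allI impI)
    fix e :: real assume "e > 0"
    then obtain x where "x \<in> U" "x \<noteq> \<xi>" "dist x \<xi> < e"
      using U(3) unfolding islimpt_approachable by blast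
    then show "\<exists>x'\<in>of_real ` U. x' \<noteq> complex_of_real \<xi> \<and> dist x' (complex_of_real \<xi>) < e"
      by (intro bexI[of _ "of_real x"]) (auto simp: dist_of_real)
  qed
  show ?thesis
  proof (rule analytic_continuation[of F ?S "of_real ` U" "of_real \<xi>"])
    show "F holomorphic_on ?S"
      by (rule holomorphic_on_subset[OF F(1) connected_component_subset])
    show "open ?S" by (rule open_connected_component[OF F(2)])
    show "of_real ` U \<subseteq> ?S" using JS U(1) by blast
    show "complex_of_real \<xi> \<in> ?S" "of_real s \<in> ?S" using JS U(2) s by blast+
  qed (use U(4) lim in auto)
qed

lemma line_identity:
  fixes a b :: C2
  assumes h: "hol2 W h" "open W" and J: "connected J" "\<And>s. s \<in> J \<Longrightarrow> a + s *\<^sub>R b \<in> W"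
    and U: "U \<subseteq> J" "\<xi> \<in> J" "\<xi> islimpt U" "\<And>s. s \<in> U \<Longrightarrow> h (a + s *\<^sub>R b) = 0"
    and s: "s \<in> J"
  shows "h (a + s *\<^sub>R b) = 0"
proof -
  have op: "open {s. a + csc s b \<in> W}"
  proof -
    have "open ((\<lambda>s. a + csc s b) -` W)" by (rule open_vimage[OF h(2)]) (intro continuous_intros)
    then show ?thesis by (simp add: vimage_def)
  qed
  have "(\<lambda>s. h (a + csc s b)) (of_real s) = 0"
    by (rule real_identity[OF hol2_line[OF h] op J(1) _ U(1-3) _ s])
      (use J(2) U(4) in \<open>auto simp: csc_of_real\<close>)
  then show ?thesis by (simp add: csc_of_real)
qed

lemma islimpt_Ioo_left: "(a::real) < b \<Longrightarrow> a islimpt {a<..<b}"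
  by (simp add: islimpt_greaterThanLessThan1)

text \<open>An identity theorem without power series: inside a ball, every segment that leaves a
  point \<open>y\<close> of the open zero set begins with zeros and so consists of zeros.\<close>

lemma hol2_zero_set_clopen:
  assumes h: "hol2 W h" "open W"
  shows "W \<inter> closure (interior {z\<in>W. h z = 0}) \<subseteq> interior {z\<in>W. h z = 0}"
proof
  let ?Z = "interior {z\<in>W. h z = 0}"
  fix z assume z: "z \<in> W \<inter> closure ?Z"
  then obtain r where r: "r > 0" "ball z r \<subseteq> W" using h(2) open_contains_ball by blast
  then obtain y where y: "y \<in> ?Z" "y \<in> ball z r"
    using z closure_approachable[of z ?Z] by (auto simp: dist_commute)
  obtain e where e: "e > 0" "ball y e \<subseteq> ?Z" using y(1) open_interior open_contains_ball by blast
  have "h w = 0" if w: "w \<in> ball z r" for w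
  proof (cases "w = y")
    case True
    then show ?thesis using y(1) interior_subset by blast
  next
    case False
    define d where "d = min 1 (e / norm (w - y))"
    have d: "d > 0" "d \<le> 1" using e(1) False by (auto simp: d_def)
    have "h (y + 1 *\<^sub>R (w - y)) = 0"
    proof (rule line_identity[OF h, of "{0..1}" y "w - y" "{0<..<d}" 0])
      show "y + s *\<^sub>R (w - y) \<in> W" if "s \<in> {0..1}" for s
      proof -
        have "(1 - s) *\<^sub>R y + s *\<^sub>R w \<in> ball z r"
          by (rule convexD[OF convex_ball y(2) w]) (use that in auto)
        moreover have "(1 - s) *\<^sub>R y + s *\<^sub>R w = y + s *\<^sub>R (w - y)" by (simp add: algebra_simps)
        ultimately show ?thesis using r(2) by auto
      qed
      show "h (y + s *\<^sub>R (w - y)) = 0" if "s \<in> {0<..<d}" for s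
      proof -
        have "s * norm (w - y) < e" using that False by (simp add: d_def field_simps)
        then have "y + s *\<^sub>R (w - y) \<in> ball y e" using that by (simp add: dist_norm)
        then show ?thesis using e(2) interior_subset by blast
      qed
      show "0 islimpt {0<..<d}" by (rule islimpt_Ioo_left[OF d(1)])
    qed (use d in auto)
    then show ?thesis by simp
  qed
  then have "ball z r \<subseteq> {z\<in>W. h z = 0}" using r(2) by blast
  then show "z \<in> ?Z" using interior_maximal[OF _ open_ball] r(1) by (meson centre_in_ball subsetD)
qed

subsection \<open>Geometry of the neighbourhoods of \<open>K\<close>\<close>

lemma norm_vec3: "(norm (u :: complex^3))\<^sup>2 = (norm (proj2 u))\<^sup>2 + (cmod (u $ 3))\<^sup>2"
  by (simp add: norm_vec_def L2_set_def sum_3 proj2_def norm_C2 sum_nonneg)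

lemma S3_iff: "k \<in> S3 \<longleftrightarrow> k $ 3 = 0 \<and> norm (proj2 k) = 1"
proof -
  have "(norm (proj2 k))\<^sup>2 = 1 \<longleftrightarrow> norm (proj2 k) = 1"
    using norm_ge_zero[of "proj2 k"] by (metis abs_of_nonneg power2_eq_1_iff abs_square_eq_1)
  then show ?thesis by (auto simp: S3_def quadric_iff)
qed

text \<open>The third coordinate contributes |z|^2 - 1, whatever the angle, and the constants cancel
  because \<open>proj2 k\<close> has norm 1. Neighbourhoods of subsets of the sphere are therefore
  invariant under rotation of z_3.\<close>

lemma dist_qpt_S3:
  assumes "norm z \<ge> 1" "k \<in> S3"
  shows "(dist (qpt z t) k)\<^sup>2 = 2 * (norm z)\<^sup>2 - 2 * (z \<bullet> proj2 k)"
proof -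
  have p: "proj2 (qpt z t - k) = z - proj2 k" by (simp add: proj2_def prod_eq_iff)
  have "(dist (qpt z t) k)\<^sup>2 = (norm (z - proj2 k))\<^sup>2 + (height z)\<^sup>2"
    using assms(2) height_nonneg[OF assms(1)]
    by (simp add: dist_norm norm_vec3 p S3_iff norm_mult)
  also have "(norm (z - proj2 k))\<^sup>2 = (norm z)\<^sup>2 - 2 * (z \<bullet> proj2 k) + 1"
    using assms(2) by (simp add: power2_norm_eq_inner inner_diff_left inner_diff_right inner_commute S3_iff)
      (simp add: power2_norm_eq_inner[symmetric])
  finally show ?thesis using height_sq[OF assms(1)] by (simp add: hsq_def)
qed

lemma infdist_mono_dist:
  fixes K :: "'a::heine_borel set"
  assumes "K \<noteq> {}" "compact K" "\<And>k. k \<in> K \<Longrightarrow> dist x k \<le> dist y k"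
  shows "infdist x K \<le> infdist y K"
proof -
  obtain k where "k \<in> K" "infdist y K = dist y k"
    using infdist_attains_inf[OF compact_imp_closed[OF assms(2)] assms(1)] by blast
  then show ?thesis using infdist_le[of k K x] assms(3)[of k] by simp
qed

text \<open>\<open>\<kappa>\<close> is the width of a neighbourhood of \<open>K\<close> inside
  \<open>\<Omega>\<close>. The factor 10 leaves room for circles reaching to distance 9
  \<open>\<epsilon>\<close>, the bound 1/2 controls higher powers of \<open>\<epsilon>\<close>, and
  the point of \<open>S3\<close> away from \<open>K\<close> is where the vanishing of negative
  coefficients starts.\<close>

locale hartogs =
  fixes K \<Omega> :: "(complex^3) set" and \<epsilon> \<kappa> :: real and f :: "complex^3 \<Rightarrow> complex"
  assumes K: "compact K" "K \<noteq> {}" "K \<subseteq> S3"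
    and \<kappa>: "10 * \<epsilon> \<le> \<kappa>" "\<And>p. p \<in> quadric \<Longrightarrow> infdist p K < \<kappa> \<Longrightarrow> p \<in> \<Omega>"
    and \<epsilon>: "\<epsilon> > 0" "\<epsilon> \<le> 1/2" "\<exists>q\<in>S3. infdist q K > \<epsilon>"
    and f: "f \<in> CR quadric (\<Omega> - closed_nhd quadric K \<epsilon>)"
begin

definition rad :: "C2 \<Rightarrow> real" where "rad z = infdist (qpt z 0) K"

lemma infdist_qpt: assumes "norm z \<ge> 1" shows "infdist (qpt z t) K = rad z"
proof -
  have "dist (qpt z t) k = dist (qpt z 0) k" if "k \<in> K" for k
    using dist_qpt_S3[OF assms, of k t] dist_qpt_S3[OF assms, of k 0] that K(3)
    by (metis power2_eq_imp_eq subsetD zero_le_dist)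
  then show ?thesis
    unfolding rad_def by (intro order_antisym infdist_mono_dist K) auto
qed

lemma rad_continuous: "continuous_on S rad"
  unfolding rad_def[abs_def] by (intro continuous_on_infdist continuous_intros)

text \<open>\<open>K\<close> lies in z_3 = 0, so the third coordinate alone accounts for the
  distance \<open>height z\<close>.\<close>

lemma rad_ge_height: assumes "norm z \<ge> 1" shows "height z \<le> rad z"
proof -
  obtain k where k: "k \<in> K" "rad z = dist (qpt z 0) k"
    unfolding rad_def using infdist_attains_inf[OF compact_imp_closed[OF K(1)] K(2)] by blast
  have "(height z)\<^sup>2 \<le> (dist (qpt z 0) k)\<^sup>2"
    using k K(3) by (auto simp: dist_norm norm_vec3 S3_iff)
  then show ?thesis unfolding k(2) by (rule power2_le_imp_le) simp
qed

lemma rad_le: "rad y \<le> rad z + norm (y - z) + \<bar>height y - height z\<bar>"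
proof -
  have p: "proj2 (qpt y 0 - qpt z 0) = y - z" by (simp add: proj2_def prod_eq_iff)
  have "(dist (qpt y 0) (qpt z 0))\<^sup>2 = (norm (y - z))\<^sup>2 + \<bar>height y - height z\<bar>\<^sup>2"
    by (simp add: dist_norm norm_vec3 p flip: of_real_diff)
  also have "\<dots> \<le> (norm (y - z) + \<bar>height y - height z\<bar>)\<^sup>2"
    by (simp add: power2_sum)
  finally have "dist (qpt y 0) (qpt z 0) \<le> norm (y - z) + \<bar>height y - height z\<bar>"
    by (rule power2_le_imp_le) simp
  then show ?thesis unfolding rad_def using infdist_triangle[of "qpt y 0" K "qpt z 0"] by simp
qed

lemma norm_scale_ge1: "norm (z::C2) \<ge> 1 \<Longrightarrow> s \<ge> 1 \<Longrightarrow> norm (s *\<^sub>R z) \<ge> 1"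
  using mult_mono[of 1 s 1 "norm z"] by simp

text \<open>The squared distance 2|z|^2 - 2 z . k grows with the radial factor, because z . k is at
  most |z|^2 when |k| = 1 and |z| is at least 1.\<close>

lemma rad_mono: assumes "norm z \<ge> 1" "s \<ge> 1" shows "rad z \<le> rad (s *\<^sub>R z)"
  unfolding rad_def
proof (rule infdist_mono_dist[OF K(2,1)])
  fix k assume "k \<in> K"
  then have k: "k \<in> S3" using K(3) by blast
  have "z \<bullet> proj2 k \<le> norm z * norm (proj2 k)" by (rule norm_cauchy_schwarz)
  also have "\<dots> \<le> norm z * norm z" using k assms(1) by (intro mult_left_mono) (auto simp: S3_iff)
  finally have i: "z \<bullet> proj2 k \<le> (norm z)\<^sup>2" by (simp add: power2_eq_square)
  have "(dist (qpt (s *\<^sub>R z) 0) k)\<^sup>2 - (dist (qpt z 0) k)\<^sup>2 = 2 * (s - 1) * ((s + 1) * (norm z)\<^sup>2 - z \<bullet> proj2 k)"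
    unfolding dist_qpt_S3[OF assms(1) k] dist_qpt_S3[OF norm_scale_ge1[OF assms] k]
    by (simp add: power_mult_distrib algebra_simps power2_eq_square)
  also have "\<dots> \<ge> 0"
  proof -
    have "(norm z)\<^sup>2 \<le> (s + 1) * (norm z)\<^sup>2" using assms(2) mult_right_mono[of 1 "s + 1" "(norm z)\<^sup>2"] by simp
    then show ?thesis using i assms(2) by (intro mult_nonneg_nonneg) auto
  qed
  finally have "(dist (qpt z 0) k)\<^sup>2 \<le> (dist (qpt (s *\<^sub>R z) 0) k)\<^sup>2" by linarith
  then show "dist (qpt z 0) k \<le> dist (qpt (s *\<^sub>R z) 0) k"
    by (rule power2_le_imp_le) simp
qed

text \<open>The base of the circle bundle over the shell around \<open>K\<close>. The unit sphere is
  left out, since the circles collapse to points there.\<close>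

definition W :: "C2 set" where "W = {z. norm z > 1 \<and> \<epsilon> < rad z \<and> rad z < \<kappa>}"

abbreviation "D \<equiv> \<Omega> - closed_nhd quadric K \<epsilon>"

lemma open_W: "open W"
  unfolding W_def by (intro open_Collect_conj open_Collect_less continuous_intros rad_continuous)

lemma W_norm: "W \<subseteq> {z. norm z > 1}" by (auto simp: W_def)

lemma qpt_in_D: "norm z \<ge> 1 \<Longrightarrow> \<epsilon> < rad z \<Longrightarrow> rad z < \<kappa> \<Longrightarrow> qpt z t \<in> D"
  using \<kappa>(2)[OF qpt_in_quadric[of z t]] infdist_qpt[of z t] by (auto simp: closed_nhd_def)

lemma qpt_W: "z \<in> W \<Longrightarrow> qpt z t \<in> D" by (rule qpt_in_D) (auto simp: W_def)

lemma f_cont: "continuous_on D f" using f by (simp add: CR_def)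

abbreviation "h \<equiv> fcoef f"

lemma h_hol2: "hol2 W (h k)" by (rule hol2_fcoef[OF f open_W W_norm qpt_W])

section \<open>Vanishing of the coefficients of negative index\<close>

lemma norm_fcoef_le:
  assumes "z \<in> W" "\<And>t. norm (f (qpt z t)) \<le> B"
  shows "norm (h k z) \<le> B * hsq z powr (- of_int k / 2)"
proof -
  have "norm (integral (cbox 0 (2*pi)) (\<lambda>t. f (qpt z t) * efac (of_int k) z t))
      \<le> integral (cbox 0 (2*pi)) (\<lambda>t. B * hsq z powr (- of_int k / 2))"
  proof (rule integral_norm_bound_integral)
    show "(\<lambda>t. f (qpt z t) * efac (of_int k) z t) integrable_on cbox 0 (2*pi)"
      by (intro integrable_continuous continuous_on_circle_fun[OF f_cont W_norm qpt_W])
        (use assms(1) in \<open>auto intro!: continuous_intros\<close>)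
    show "norm (f (qpt z t) * efac (of_int k) z t) \<le> B * hsq z powr (- of_int k / 2)" for t
      unfolding efac_def by (simp add: norm_mult assms(2) mult_right_mono)
  qed (rule integrable_const)
  then show ?thesis by (simp add: fcoef_def field_simps)
qed

text \<open>On the complex line through \<open>q\<close> the map w -> e^w q turns the outside of the
  ball into the half plane Re w > 0. There the coefficient is bounded by a positive power of
  \<open>hsq\<close>, so its continuation by 0 is continuous across the imaginary axis, hence
  holomorphic, hence zero.\<close>

lemma boundary_vanishing:
  assumes q: "norm q = 1" "\<epsilon> < rad q" "rad q < \<kappa>" and k: "k < 0"
  obtains \<delta> where "\<delta> > 1" "\<And>s. 1 < s \<Longrightarrow> s < \<delta> \<Longrightarrow> s *\<^sub>R q \<in> W \<and> h k (s *\<^sub>R q) = 0"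
proof -
  have h0: "height q = 0" using q(1) by (simp add: height_def hsq_def)
  have qq: "qpt q 0 \<in> D" by (rule qpt_in_D) (use q in auto)
  obtain \<rho> where \<rho>: "\<rho> > 0" "\<And>p. p \<in> D \<Longrightarrow> dist p (qpt q 0) < \<rho> \<Longrightarrow> dist (f p) (f (qpt q 0)) < 1"
    using f_cont qq unfolding continuous_on_iff by (metis zero_less_one)
  define B where "B = norm (f (qpt q 0)) + 1"
  define e where "e w = csc (exp w) q" for w
  have ec: "continuous_on S e" for S
    unfolding e_def[abs_def] by (intro continuous_intros)
  have e0: "e 0 = q" by (simp add: e_def)
  \<comment> \<open>The sum of \<open>norm (z - q)\<close> and \<open>height z\<close> dominates the
    distance of every \<open>qpt z t\<close> from \<open>qpt q 0\<close>, which bounds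
    \<open>f\<close> by \<open>B\<close> uniformly in the angle.\<close>
  define N where "N = {z. \<epsilon> < rad z \<and> rad z < \<kappa> \<and> norm (z - q) + height z < \<rho>}"
  have "open N"
    unfolding N_def height_def hsq_def by (intro open_Collect_conj open_Collect_less continuous_intros rad_continuous)
  then have "open (e -` N)" by (rule open_vimage[OF _ ec])
  moreover have "0 \<in> e -` N" using q \<rho>(1) h0 by (simp add: N_def e0)
  ultimately obtain r where r: "r > 0" "ball 0 r \<subseteq> e -` N" using open_contains_ball by blast
  have ne: "norm (e w) = exp (Re w)" for w by (simp add: e_def norm_csc q(1))
  have eW: "e w \<in> W" if "w \<in> ball 0 r" "Re w > 0" for w
    using that r(2) ne[of w] by (auto simp: N_def W_def subset_iff)
  define g where "g w = (if Re w > 0 then h k (e w) else 0)" for w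
  \<comment> \<open>With \<open>max 0\<close> the bound is continuous on the whole plane and
    vanishes for Re w at most 0; the exponent is positive because \<open>k < 0\<close>.\<close>
  define M where "M w = B * (max 0 (exp (2 * Re w) - 1)) powr (- of_int k / 2)" for w :: complex
  have gM: "norm (g w) \<le> M w" if w: "w \<in> ball 0 r" for w
  proof (cases "Re w > 0")
    case True
    have z: "e w \<in> W" by (rule eW[OF w True])
    have n1: "norm (e w) \<ge> 1" using z W_norm by auto
    have "norm (f (qpt (e w) t)) \<le> B" for t
    proof -
      have p: "proj2 (qpt (e w) t - qpt q 0) = e w - q" by (simp add: proj2_def prod_eq_iff)
      have "(dist (qpt (e w) t) (qpt q 0))\<^sup>2 = (norm (e w - q))\<^sup>2 + (height (e w))\<^sup>2"
        by (simp add: dist_norm norm_vec3 p h0 norm_mult)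
      also have "\<dots> \<le> (norm (e w - q) + height (e w))\<^sup>2"
        using height_nonneg[OF n1] by (simp add: power2_sum)
      finally have "dist (qpt (e w) t) (qpt q 0) \<le> norm (e w - q) + height (e w)"
        by (rule power2_le_imp_le) (use height_nonneg[OF n1] in simp)
      also have "\<dots> < \<rho>" using w r(2) by (auto simp: N_def subset_iff)
      finally have "dist (f (qpt (e w) t)) (f (qpt q 0)) < 1" using \<rho>(2)[OF qpt_W[OF z]] by blast
      then show ?thesis
        using norm_triangle_sub[of "f (qpt (e w) t)" "f (qpt q 0)"] by (simp add: B_def dist_norm)
    qed
    from norm_fcoef_le[OF z this] have "norm (h k (e w)) \<le> B * hsq (e w) powr (- of_int k / 2)" .
    moreover have "hsq (e w) = max 0 (exp (2 * Re w) - 1)"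
      using True by (simp add: hsq_def ne exp_double)
    ultimately show ?thesis using True by (simp add: g_def M_def)
  next
    case False
    then show ?thesis by (simp add: g_def M_def B_def)
  qed
  have Mc: "continuous_on UNIV M"
    unfolding M_def[abs_def]
    by (intro continuous_on_mult continuous_on_const continuous_on_powr' continuous_intros) (use k in auto)
  have hol: "(\<lambda>w. h k (e w)) holomorphic_on (ball 0 r \<inter> {w. 0 < Re w})"
  proof -
    have 1: "(\<lambda>s. h k (0 + csc s q)) holomorphic_on {s. 0 + csc s q \<in> W}" by (rule hol2_line[OF h_hol2 open_W])
    have "((\<lambda>s. h k (0 + csc s q)) \<circ> exp) holomorphic_on (ball 0 r \<inter> {w. 0 < Re w})"
      by (rule holomorphic_on_compose_gen[OF holomorphic_on_exp 1]) (use eW in \<open>auto simp: e_def\<close>)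
    then show ?thesis by (simp add: o_def e_def)
  qed
  have o: "open (ball (0::complex) r \<inter> {w. 0 < Re w})"
    by (intro open_Int open_ball open_Collect_less continuous_intros)
  have "g holomorphic_on ball 0 r"
  proof (rule holomorphic_on_paste_across_line[of _ 1 _ 0])
    show "g holomorphic_on ball 0 r \<inter> {z. 1 \<bullet> z < 0}"
      by (rule holomorphic_transform[of "\<lambda>_. 0"]) (auto simp: g_def inner_complex_def)
    show "g holomorphic_on ball 0 r \<inter> {z. 0 < 1 \<bullet> z}"
    proof -
      have "g holomorphic_on ball 0 r \<inter> {w. 0 < Re w}"
        by (rule holomorphic_transform[OF hol]) (auto simp: g_def)
      then show ?thesis by (simp add: inner_complex_def)
    qed
    show "continuous_on (ball 0 r) g"
    proof (rule continuous_at_imp_continuous_on, rule ballI)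
      fix w assume w: "w \<in> ball (0::complex) r"
      show "isCont g w"
      proof (cases "Re w > 0")
        case True
        have "continuous_on (ball 0 r \<inter> {w. 0 < Re w}) g"
          by (rule continuous_on_eq[OF holomorphic_on_imp_continuous_on[OF hol]]) (auto simp: g_def)
        then have "\<forall>x\<in>ball 0 r \<inter> {w. 0 < Re w}. isCont g x"
          using continuous_on_eq_continuous_at[OF o, of g] by blast
        then show ?thesis using w True by simp
      next
        case False
        have "isCont M w" using Mc by (simp add: continuous_on_eq_continuous_at)
        moreover have "M w = 0" using False k by (simp add: M_def)
        ultimately have "(M \<longlongrightarrow> 0) (at w)" by (simp add: isCont_def)
        moreover have "\<forall>\<^sub>F x in at w. norm (g x) \<le> M x"
          unfolding eventually_at_topological using gM w by (intro exI[of _ "ball 0 r"]) auto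
        ultimately have "(g \<longlongrightarrow> 0) (at w)" by (rule Lim_null_comparison[rotated])
        then show ?thesis using False by (simp add: isCont_def g_def)
      qed
    qed
  qed auto
  then have g0: "g w = 0" if "w \<in> ball 0 r" for w
  \<comment> \<open>The left half disc consists of zeros, and its interior point -r/2 is the
    required point of accumulation.\<close>
  proof (rule analytic_continuation[of g "ball 0 r" "ball 0 r \<inter> {w. Re w < 0}" "- of_real (r/2)"])
    show "- complex_of_real (r/2) islimpt ball 0 r \<inter> {w. Re w < 0}"
      by (rule interior_limit_point, rule interiorI[of "ball 0 r \<inter> {w. Re w < 0}"])
        (use r(1) in \<open>auto intro!: open_Int open_Collect_less continuous_intros\<close>)
  qed (use that r(1) in \<open>auto simp: g_def\<close>)
  show thesis
  proof (rule that[of "exp r"])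
    show "exp r > 1" using r(1) by simp
    fix s :: real assume s: "1 < s" "s < exp r"
    then have l: "0 < ln s" "ln s < r" using ln_less_cancel_iff[of s "exp r"] by (simp_all add: ln_gt_zero)
    have es: "e (of_real (ln s)) = s *\<^sub>R q"
    proof -
      have "exp (complex_of_real (ln s)) = of_real s" unfolding exp_of_real using s by simp
      then show ?thesis by (simp add: e_def csc_of_real)
    qed
    have b: "complex_of_real (ln s) \<in> ball 0 r" using l by simp
    show "s *\<^sub>R q \<in> W \<and> h k (s *\<^sub>R q) = 0"
      using eW[OF b] g0[OF b] l es by (simp add: g_def)
  qed
qed

text \<open>Since \<open>rad\<close> is monotone along rays, the bounds defining \<open>W\<close>
  cut out an interval.\<close>

lemma ray_connected:
  assumes "norm q = 1"
  shows "connected {s. 1 < s \<and> s *\<^sub>R q \<in> W}"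
proof -
  have "is_interval {s. 1 < s \<and> s *\<^sub>R q \<in> W}"
    unfolding is_interval_1
  proof (intro ballI allI impI)
    fix a b x assume a: "a \<in> {s. 1 < s \<and> s *\<^sub>R q \<in> W}" and b: "b \<in> {s. 1 < s \<and> s *\<^sub>R q \<in> W}"
      and x: "a \<le> x \<and> x \<le> b"
    have 1: "rad (a *\<^sub>R q) \<le> rad (x *\<^sub>R q)"
      using rad_mono[of "a *\<^sub>R q" "x / a"] a x assms by (simp add: field_simps)
    have 2: "rad (x *\<^sub>R q) \<le> rad (b *\<^sub>R q)"
      using rad_mono[of "x *\<^sub>R q" "b / x"] a x assms by (simp add: field_simps)
    show "x \<in> {s. 1 < s \<and> s *\<^sub>R q \<in> W}"
      using a b x 1 2 assms by (simp add: W_def)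
  qed
  then show ?thesis by (simp add: is_interval_connected_1)
qed

text \<open>The factor is the one that gives height 2 \<open>\<epsilon>\<close>. Height alone forces
  distance at least 2 \<open>\<epsilon>\<close>, while displacement and height together allow at
  most 5 \<open>\<epsilon>\<close>, below \<open>\<kappa>\<close>.\<close>

lemma ray_enters_W:
  assumes "norm q = 1" "rad q \<le> \<epsilon>"
  shows "sqrt (1 + 4 * \<epsilon>\<^sup>2) > 1" "sqrt (1 + 4 * \<epsilon>\<^sup>2) *\<^sub>R q \<in> W"
proof -
  let ?s = "sqrt (1 + 4 * \<epsilon>\<^sup>2)"
  show s: "?s > 1" using \<epsilon>(1) by simp
  have s2: "?s \<le> 1 + 2 * \<epsilon>"
    by (rule real_le_lsqrt) (use \<epsilon>(1) in \<open>auto simp: power2_sum\<close>)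
  have h: "height (?s *\<^sub>R q) = 2 * \<epsilon>"
    using s assms(1) \<epsilon>(1) by (simp add: height_def hsq_def power_mult_distrib real_sqrt_mult)
  have "norm (?s *\<^sub>R q - q) = ?s - 1"
  proof -
    have "?s *\<^sub>R q - q = (?s - 1) *\<^sub>R q" by (simp add: algebra_simps)
    then show ?thesis using s assms(1) by simp
  qed
  moreover have "height q = 0" using assms(1) by (simp add: height_def hsq_def)
  ultimately have "rad (?s *\<^sub>R q) \<le> \<epsilon> + 2 * \<epsilon> + 2 * \<epsilon>"
    using rad_le[of "?s *\<^sub>R q" q] h s2 assms(2) \<epsilon>(1) by simp
  moreover have "2 * \<epsilon> \<le> rad (?s *\<^sub>R q)"
    using rad_ge_height[of "?s *\<^sub>R q"] h s assms(1) by simp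
  ultimately show "?s *\<^sub>R q \<in> W" using \<kappa>(1) \<epsilon>(1) s assms(1) by (simp add: W_def)
qed

text \<open>A ray meets \<open>W\<close> in an interval, on which the interior of the zero set is
  relatively open and closed; so a whole ray lies inside it or outside it. Both alternatives are
  open in the direction of the ray, and the sphere of directions is connected.\<close>

lemma negative_coefficients_vanish:
  assumes k: "k < 0" and z: "z \<in> W"
  shows "h k z = 0"
proof -
  let ?Z = "interior {z\<in>W. h k z = 0}"
  have clo: "W \<inter> closure ?Z \<subseteq> ?Z" by (rule hol2_zero_set_clopen[OF h_hol2 open_W])
  have ZW: "?Z \<subseteq> W" using interior_subset by blast
  have ray0: "h k (s *\<^sub>R q) = 0"
    if q: "norm q = 1" "\<epsilon> < rad q" "rad q < \<kappa>" and s: "1 < s" "s *\<^sub>R q \<in> W" for q s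
  proof -
    obtain d where d: "d > 1" "\<And>s. 1 < s \<Longrightarrow> s < d \<Longrightarrow> s *\<^sub>R q \<in> W \<and> h k (s *\<^sub>R q) = 0"
      using boundary_vanishing[OF q k] by blast
    define x where "x = (1 + d) / 2"
    have x: "1 < x" "x < d" using d(1) by (auto simp: x_def field_simps)
    have "h k (0 + s *\<^sub>R q) = 0"
      by (rule line_identity[OF h_hol2 open_W ray_connected[OF q(1)], of 0 q "{x<..<d}" x])
        (use d(2) x s islimpt_Ioo_left[OF x(2)] in auto)
    then show ?thesis by simp
  qed
  have rayZ: "s *\<^sub>R q \<in> ?Z"
    if q: "norm q = 1" "\<epsilon> < rad q" "rad q < \<kappa>" and s: "1 < s" "s *\<^sub>R q \<in> W" for q s
  proof -
    \<comment> \<open>Radial projection. The vanishing rays in all directions near \<open>q\<close>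
      fill an open set, so their points lie in the interior of the zero set.\<close>
    define u where "u z = inverse (norm z) *\<^sub>R z" for z :: C2
    define N where "N = W \<inter> {z. \<epsilon> < rad (u z) \<and> rad (u z) < \<kappa>}"
    have uc: "continuous_on W u"
      unfolding u_def by (intro continuous_intros) (use W_norm in force)
    have ruc: "continuous_on W (\<lambda>z. rad (u z))"
      by (rule continuous_on_compose2[OF rad_continuous uc subset_UNIV])
    have "open (W \<inter> (\<lambda>z. rad (u z)) -` {\<epsilon><..<\<kappa>})"
      by (rule continuous_open_preimage[OF ruc open_W]) simp
    moreover have "N = W \<inter> (\<lambda>z. rad (u z)) -` {\<epsilon><..<\<kappa>}" by (auto simp: N_def)
    ultimately have "open N" by simp
    moreover have "N \<subseteq> {z\<in>W. h k z = 0}"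
    proof
      fix y assume y: "y \<in> N"
      then have n: "norm y > 1" using W_norm by (auto simp: N_def)
      have yu: "norm y *\<^sub>R u y = y" "norm (u y) = 1"
      proof -
        have "norm y \<noteq> 0" using n by linarith
        then show "norm y *\<^sub>R u y = y" "norm (u y) = 1" by (simp_all add: u_def del: norm_eq_zero)
      qed
      have "h k (norm y *\<^sub>R u y) = 0"
        by (rule ray0) (use y n yu in \<open>auto simp: N_def\<close>)
      then show "y \<in> {z\<in>W. h k z = 0}" using y yu by (simp add: N_def)
    qed
    moreover have "s *\<^sub>R q \<in> N" using s q by (simp add: N_def u_def)
    ultimately show ?thesis using interior_maximal by blast
  qed
  have raysep: False if q: "norm q = 1" and s: "1 < s" "s *\<^sub>R q \<in> ?Z" and t: "1 < t" "t *\<^sub>R q \<in> W - ?Z" for q s t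
  proof -
    let ?R = "(\<lambda>s. s *\<^sub>R q) ` {s. 1 < s \<and> s *\<^sub>R q \<in> W}"
    have "connected ?R" by (intro connected_continuous_image ray_connected q continuous_intros)
    moreover have "?R \<subseteq> ?Z \<union> - closure ?Z" using clo by auto
    moreover have "?Z \<inter> ?R \<noteq> {}" "- closure ?Z \<inter> ?R \<noteq> {}" using s t ZW clo by blast+
    moreover have "?Z \<inter> - closure ?Z \<inter> ?R = {}" using closure_subset[of ?Z] by blast
    ultimately show False using connectedD[of ?R ?Z "- closure ?Z"] by auto
  qed
  let ?S = "sphere (0::C2) 1"
  \<comment> \<open>\<open>A\<close> collects the directions off the neighbourhood of
    \<open>K\<close> and those whose ray meets the open zero set, \<open>B\<close> the directions
    whose ray meets \<open>W\<close> outside it.\<close>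
  define A where "A = {q. \<epsilon> < rad q} \<union> (\<Union>s\<in>{1<..}. (\<lambda>q. s *\<^sub>R q) -` ?Z)"
  define B where "B = (\<Union>s\<in>{1<..}. (\<lambda>q. s *\<^sub>R q) -` (W \<inter> - closure ?Z))"
  have oA: "open A" unfolding A_def
    by (intro open_Un open_UN ballI open_vimage open_interior open_Collect_less continuous_intros rad_continuous)
  have oB: "open B" unfolding B_def
    by (intro open_UN ballI open_vimage open_Int open_W continuous_intros) auto
  have cov: "?S \<subseteq> A \<union> B"
  proof
    fix q assume "q \<in> ?S"
    then have q: "norm q = 1" by simp
    show "q \<in> A \<union> B"
    proof (cases "rad q \<le> \<epsilon>")
      case True
      from ray_enters_W[OF q True] clo show ?thesis by (force simp: A_def B_def)
    qed (simp add: A_def)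
  qed
  have disj: "A \<inter> B \<inter> ?S = {}"
  proof (rule ccontr)
    assume "A \<inter> B \<inter> ?S \<noteq> {}"
    then obtain q where q: "q \<in> A" "q \<in> B" "norm q = 1" by auto
    then obtain t where t: "1 < t" "t *\<^sub>R q \<in> W - ?Z" using closure_subset[of ?Z] by (auto simp: B_def)
    show False
    proof (cases "\<epsilon> < rad q")
      case True
      \<comment> \<open>\<open>rad\<close> only grows outward, so a ray that meets \<open>W\<close>
        starts below \<open>\<kappa>\<close>, where the vanishing at the boundary applies.\<close>
      have "rad q < \<kappa>" using rad_mono[of q t] t q(3) by (auto simp: W_def)
      then show False using rayZ[OF q(3) True _ t(1)] t(2) by blast
    next
      case False
      then obtain s where "1 < s" "s *\<^sub>R q \<in> ?Z" using q(1) by (auto simp: A_def)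
      then show False using raysep[OF q(3)] t by blast
    qed
  qed
  obtain p where p: "p \<in> S3" "infdist p K > \<epsilon>" using \<epsilon>(3) by blast
  have "qpt (proj2 p) 0 = p"
    using p(1) by (simp add: vec_eq_iff forall_3 proj2_def S3_iff height_def hsq_def)
  \<comment> \<open>The point of the sphere far from \<open>K\<close> makes \<open>A\<close> meet
    the sphere, so connectedness leaves no room for \<open>B\<close>.\<close>
  with p have "proj2 p \<in> A \<inter> ?S" by (simp add: A_def rad_def S3_iff)
  moreover have "connected ?S" by (rule connected_sphere) simp
  ultimately have BS: "B \<inter> ?S = {}" using connectedD[OF _ oA oB disj cov] by blast
  have n: "norm z > 1" using z W_norm by auto
  then have nz: "norm z \<noteq> 0" by linarith
  have 1: "inverse (norm z) *\<^sub>R z \<in> ?S" using nz by (simp del: norm_eq_zero)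
  have 2: "norm z *\<^sub>R (inverse (norm z) *\<^sub>R z) = z" using nz by (simp del: norm_eq_zero)
  have "z \<in> closure ?Z"
  proof (rule ccontr)
    assume "z \<notin> closure ?Z"
    then have "inverse (norm z) *\<^sub>R z \<in> (\<lambda>q. norm z *\<^sub>R q) -` (W \<inter> - closure ?Z)"
      using z 2 by simp
    then have "inverse (norm z) *\<^sub>R z \<in> B" unfolding B_def using n by blast
    with 1 BS show False by blast
  qed
  with clo z have "z \<in> ?Z" by blast
  then show ?thesis using interior_subset by blast
qed

end

subsection \<open>Circle means\<close>

text \<open>Cauchy's formula at the centre, with the circle parametrised by its angle so as to match
  \<open>circle_mean\<close>.\<close>

lemma mean_value_circle:
  assumes F: "F holomorphic_on cball 0 \<tau>" and \<tau>: "\<tau> > 0"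
  shows "inverse (2*pi) *\<^sub>R integral (cbox 0 (2*pi)) (\<lambda>\<theta>. F (of_real \<tau> * cis \<theta>)) = F 0"
proof -
  have "((\<lambda>u. F u / (u - 0)) has_contour_integral (2 * of_real pi * \<i> * F 0)) (circlepath 0 \<tau>)"
    by (rule Cauchy_integral_circlepath_simple[OF F]) (use \<tau> in simp)
  then have "((\<lambda>t. F (0 + of_real \<tau> * cis t) / (0 + of_real \<tau> * cis t - 0) * of_real \<tau> * \<i> * cis t) has_integral (2 * of_real pi * \<i> * F 0)) {0..2*pi}"
    unfolding circlepath_def by (subst (asm) has_contour_integral_part_circlepath_iff) simp_all
  moreover have "(\<lambda>t. F (0 + of_real \<tau> * cis t) / (0 + of_real \<tau> * cis t - 0) * of_real \<tau> * \<i> * cis t) =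
      (\<lambda>t. \<i> * F (of_real \<tau> * cis t))"
    using \<tau> by (simp add: fun_eq_iff)
  ultimately have "((\<lambda>t. \<i> * F (of_real \<tau> * cis t)) has_integral (2 * of_real pi * \<i> * F 0)) {0..2*pi}"
    by (simp only:)
  note * = this
  have "((\<lambda>t. F (of_real \<tau> * cis t)) has_integral (2 * of_real pi * F 0)) {0..2*pi}"
  proof -
    have "- \<i> * (2 * of_real pi * \<i> * F 0) = 2 * of_real pi * F 0" by (simp add: complex_eq_iff)
    moreover have "(\<lambda>t. - \<i> * (\<i> * F (of_real \<tau> * cis t))) = (\<lambda>t. F (of_real \<tau> * cis t))"
      by (simp add: mult.assoc[symmetric])
    ultimately show ?thesis
      using has_integral_mult_right[OF *, of "-\<i>"] by (simp only:)
  qed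
  from integral_unique[OF this] show ?thesis by (simp add: scaleR_conv_of_real)
qed

text \<open>The complement is the set of differences of a closed set and a compact circle, hence
  closed.\<close>

lemma open_circle_in:
  assumes "open W"
  shows "open {z. \<forall>\<theta>. z + csc (of_real \<tau> * cis \<theta>) v \<in> W}"
proof -
  let ?C = "(\<lambda>w. csc (of_real \<tau> * w) v) ` sphere 0 1"
  have C: "compact ?C" by (intro compact_continuous_image compact_sphere continuous_intros)
  have sph: "sphere 0 1 = range cis"
  proof
    show "sphere 0 1 \<subseteq> range cis"
    proof
      fix w :: complex assume "w \<in> sphere 0 1"
      then have "cis (Arg w) = w" using rcis_cmod_Arg[of w] by (simp add: rcis_def)
      then show "w \<in> range cis" by (metis rangeI)
    qed
  qed auto
  have "- {z. \<forall>\<theta>. z + csc (of_real \<tau> * cis \<theta>) v \<in> W} = (\<Union>x\<in>-W. \<Union>y\<in>?C. {x - y})"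
  proof (rule set_eqI)
    fix z
    have "z \<in> - {z. \<forall>\<theta>. z + csc (of_real \<tau> * cis \<theta>) v \<in> W} \<longleftrightarrow> (\<exists>\<theta>. z + csc (of_real \<tau> * cis \<theta>) v \<in> -W)" by blast
    also have "\<dots> \<longleftrightarrow> (\<exists>y\<in>?C. z + y \<in> -W)" unfolding sph by blast
    also have "\<dots> \<longleftrightarrow> z \<in> (\<Union>x\<in>-W. \<Union>y\<in>?C. {x - y})"
    proof
      assume "\<exists>y\<in>?C. z + y \<in> -W"
      then obtain y where y: "y \<in> ?C" "z + y \<in> -W" by blast
      have "z \<in> {(z + y) - y}" by simp
      with y show "z \<in> (\<Union>x\<in>-W. \<Union>y\<in>?C. {x - y})" by blast
    next
      assume "z \<in> (\<Union>x\<in>-W. \<Union>y\<in>?C. {x - y})"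
      then obtain x y where "x \<in> -W" "y \<in> ?C" "z = x - y" by blast
      then show "\<exists>y\<in>?C. z + y \<in> -W" by (intro bexI[of _ y]) auto
    qed
    finally show "z \<in> - {z. \<forall>\<theta>. z + csc (of_real \<tau> * cis \<theta>) v \<in> W} \<longleftrightarrow> z \<in> (\<Union>x\<in>-W. \<Union>y\<in>?C. {x - y})" .
  qed
  moreover have "closed (\<Union>x\<in>-W. \<Union>y\<in>?C. {x - y})"
    by (rule closed_compact_differences[OF closed_Compl[OF assms] C])
  ultimately have "closed (- {z. \<forall>\<theta>. z + csc (of_real \<tau> * cis \<theta>) v \<in> W})" by (simp only:)
  then show ?thesis by (simp only: closed_def double_complement)
qed

lemma C1hol_subset: "C1hol U u \<Longrightarrow> V \<subseteq> U \<Longrightarrow> C1hol V u"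
  unfolding C1hol_def by (meson continuous_on_subset subsetD)

lemma C1hol_diff:
  assumes "C1hol U u" "C1hol U w"
  shows "C1hol U (\<lambda>z. u z - w z)"
proof -
  obtain u' where u: "continuous_on U u'" "\<And>z. z \<in> U \<Longrightarrow> (u has_derivative blinfun_apply (u' z)) (at z)"
    "\<And>z v. z \<in> U \<Longrightarrow> blinfun_apply (u' z) (csc \<i> v) = \<i> * blinfun_apply (u' z) v"
    using assms(1) unfolding C1hol_def by blast
  obtain w' where w: "continuous_on U w'" "\<And>z. z \<in> U \<Longrightarrow> (w has_derivative blinfun_apply (w' z)) (at z)"
    "\<And>z v. z \<in> U \<Longrightarrow> blinfun_apply (w' z) (csc \<i> v) = \<i> * blinfun_apply (w' z) v"
    using assms(2) unfolding C1hol_def by blast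
  have "continuous_on U (\<lambda>z. u' z - w' z)" by (intro continuous_intros u w)
  moreover have "((\<lambda>z. u z - w z) has_derivative blinfun_apply (u' z - w' z)) (at z)" if "z \<in> U" for z
    using has_derivative_diff[OF u(2)[OF that] w(2)[OF that]] by (simp add: blinfun.diff_left[abs_def])
  moreover have "blinfun_apply (u' z - w' z) (csc \<i> v) = \<i> * blinfun_apply (u' z - w' z) v" if "z \<in> U" for z v
    by (simp add: blinfun.diff_left u(3)[OF that] w(3)[OF that] right_diff_distrib)
  ultimately show ?thesis unfolding C1hol_def by blast
qed

lemma hol2_subset: "hol2 W h \<Longrightarrow> V \<subseteq> W \<Longrightarrow> hol2 V h"
  unfolding hol2_def by (meson order_trans)

lemma hol2_diff:
  assumes "hol2 W h" "hol2 W g"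
  shows "hol2 W (\<lambda>z. h z - g z)"
  unfolding hol2_def
proof (intro allI impI)
  fix C :: "C2 set" and \<delta> :: real assume C: "compact C \<and> C \<subseteq> W \<and> \<delta> > 0"
  obtain U u where u: "open U" "C \<subseteq> U" "C1hol U u" "\<And>z. z \<in> C \<Longrightarrow> norm (h z - u z) \<le> \<delta> / 2"
    using hol2E[OF assms(1), of C "\<delta> / 2"] C by auto
  obtain V w where w: "open V" "C \<subseteq> V" "C1hol V w" "\<And>z. z \<in> C \<Longrightarrow> norm (g z - w z) \<le> \<delta> / 2"
    using hol2E[OF assms(2), of C "\<delta> / 2"] C by auto
  have "C1hol (U \<inter> V) (\<lambda>z. u z - w z)"
    by (intro C1hol_diff C1hol_subset[OF u(3)] C1hol_subset[OF w(3)]) auto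
  moreover have "norm ((h z - g z) - (u z - w z)) \<le> \<delta>" if "z \<in> C" for z
    using norm_triangle_ineq4[of "h z - u z" "g z - w z"] u(4)[OF that] w(4)[OF that]
    by (simp add: algebra_simps)
  ultimately show "\<exists>U u. open U \<and> C \<subseteq> U \<and> C1hol U u \<and> (\<forall>z\<in>C. norm ((h z - g z) - u z) \<le> \<delta>)"
    using u w by (intro exI[of _ "U \<inter> V"] exI[of _ "\<lambda>z. u z - w z"]) auto
qed

section \<open>Hermitian estimates for complex tangent discs\<close>

definition herm :: "C2 \<Rightarrow> C2 \<Rightarrow> complex" where
  "herm z v = fst z * cnj (fst v) + snd z * cnj (snd v)"

lemma inner_csc: "z \<bullet> csc \<eta> v = Re (cnj \<eta> * herm z v)"
  by (simp add: herm_def csc_def inner_prod_def inner_complex_def algebra_simps)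

lemma cmod_herm_le: "cmod (herm a b) \<le> norm a * norm b"
proof -
  have "cmod (herm a b) \<le> cmod (fst a) * cmod (fst b) + cmod (snd a) * cmod (snd b)"
    unfolding herm_def by (rule order_trans[OF norm_triangle_ineq]) (simp add: norm_mult)
  also have "\<dots> = (cmod (fst a), cmod (snd a)) \<bullet> (cmod (fst b), cmod (snd b))"
    by (simp add: inner_prod_def)
  also have "\<dots> \<le> norm (cmod (fst a), cmod (snd a)) * norm (cmod (fst b), cmod (snd b))"
    by (rule norm_cauchy_schwarz)
  also have "\<dots> = norm a * norm b" by (simp add: norm_prod_def)
  finally show ?thesis .
qed

lemma norm_add_csc:
  assumes "norm v = 1" "cmod (herm z v) \<le> c"
  shows "(norm z)\<^sup>2 + (cmod \<eta>)\<^sup>2 - 2 * cmod \<eta> * c \<le> (norm (z + csc \<eta> v))\<^sup>2"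
    "(norm (z + csc \<eta> v))\<^sup>2 \<le> (norm z)\<^sup>2 + (cmod \<eta>)\<^sup>2 + 2 * cmod \<eta> * c"
proof -
  have "(norm (z + csc \<eta> v))\<^sup>2 = (norm z)\<^sup>2 + 2 * (z \<bullet> csc \<eta> v) + (norm (csc \<eta> v))\<^sup>2"
    by (simp add: power2_norm_eq_inner inner_add_left inner_add_right inner_commute)
  then have e: "(norm (z + csc \<eta> v))\<^sup>2 = (norm z)\<^sup>2 + (cmod \<eta>)\<^sup>2 + 2 * Re (cnj \<eta> * herm z v)"
    using assms(1) by (simp add: inner_csc norm_csc)
  have "\<bar>Re (cnj \<eta> * herm z v)\<bar> \<le> cmod (cnj \<eta> * herm z v)" by (rule abs_Re_le_cmod)
  also have "\<dots> \<le> cmod \<eta> * c" using assms(2) by (simp add: norm_mult mult_left_mono)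
  finally show "(norm z)\<^sup>2 + (cmod \<eta>)\<^sup>2 - 2 * cmod \<eta> * c \<le> (norm (z + csc \<eta> v))\<^sup>2"
    "(norm (z + csc \<eta> v))\<^sup>2 \<le> (norm z)\<^sup>2 + (cmod \<eta>)\<^sup>2 + 2 * cmod \<eta> * c"
    unfolding e by linarith+
qed

text \<open>For z not 0, a unit vector spanning the complex tangent line at z of the sphere through
  z. It involves conjugates of z, so a frozen direction is needed whenever holomorphy in z
  matters.\<close>

definition perp :: "C2 \<Rightarrow> C2" where
  "perp z = inverse (norm z) *\<^sub>R (- cnj (snd z), cnj (fst z))"

lemma norm_perp: "z \<noteq> 0 \<Longrightarrow> norm (perp z) = 1"
proof -
  assume "z \<noteq> 0"
  moreover have "norm (- cnj (snd z), cnj (fst z)) = norm z" by (simp add: norm_prod_def add.commute)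
  ultimately show ?thesis unfolding perp_def norm_scaleR by simp
qed

lemma herm_perp: "herm z (perp z) = 0"
  by (simp add: herm_def perp_def scaleR_conv_of_real)

context hartogs
begin

text \<open>Orthogonality is relaxed to \<open>\<epsilon> / 8\<close> so that one direction
  \<open>v\<close> serves all centres near a given point, and the mean becomes holomorphic in the
  centre.\<close>

definition adm :: "C2 \<Rightarrow> C2 \<Rightarrow> bool" where
  "adm z v \<longleftrightarrow> norm z \<ge> 1 \<and> rad z < 2 * \<epsilon> \<and> norm v = 1 \<and> cmod (herm z v) \<le> \<epsilon> / 8"

section \<open>Size estimates for the tangent discs\<close>

lemma eps_sq: "\<epsilon>\<^sup>2 > 0" "\<epsilon>\<^sup>2 \<le> 1/4" "\<epsilon>\<^sup>2 \<le> \<epsilon> / 2" "\<epsilon>\<^sup>2 * \<epsilon>\<^sup>2 \<le> \<epsilon>\<^sup>2 / 4"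
proof -
  show 1: "\<epsilon>\<^sup>2 > 0" using \<epsilon> by simp
  show 2: "\<epsilon>\<^sup>2 \<le> 1/4" using power_mono[of \<epsilon> "1/2" 2] \<epsilon> by (simp add: power2_eq_square)
  show "\<epsilon>\<^sup>2 \<le> \<epsilon> / 2" using mult_left_mono[of \<epsilon> "1/2" \<epsilon>] \<epsilon> by (simp add: power2_eq_square)
  show "\<epsilon>\<^sup>2 * \<epsilon>\<^sup>2 \<le> \<epsilon>\<^sup>2 / 4" using mult_left_mono[OF 2, of "\<epsilon>\<^sup>2"] 1 by simp
qed

lemma le_of_sq_le: assumes "s\<^sup>2 \<le> 1 + 2 * \<epsilon>\<^sup>2" shows "s \<le> 1 + \<epsilon>\<^sup>2"
proof (rule power2_le_imp_le)
  have "(1 + \<epsilon>\<^sup>2)\<^sup>2 = 1 + 2 * \<epsilon>\<^sup>2 + \<epsilon>\<^sup>2 * \<epsilon>\<^sup>2" by (simp add: power2_eq_square algebra_simps)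
  moreover have "0 \<le> \<epsilon>\<^sup>2 * \<epsilon>\<^sup>2" by simp
  ultimately show "s\<^sup>2 \<le> (1 + \<epsilon>\<^sup>2)\<^sup>2" using assms by linarith
qed (use eps_sq in simp)

lemma hsq_le_of_rad: assumes "norm z \<ge> 1" "rad z < 2 * \<epsilon>" shows "hsq z \<le> 4 * \<epsilon>\<^sup>2" "height z < 2 * \<epsilon>"
proof -
  show h: "height z < 2 * \<epsilon>" using rad_ge_height[OF assms(1)] assms(2) by simp
  have "(height z)\<^sup>2 \<le> (2 * \<epsilon>)\<^sup>2" using h height_nonneg[OF assms(1)] by (intro power_mono) auto
  then show "hsq z \<le> 4 * \<epsilon>\<^sup>2" using height_sq[OF assms(1)] by (simp add: power_mult_distrib)
qed

text \<open>The push \<open>s\<close> is below 2, so the Hermitian product is at most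
  \<open>\<epsilon> / 4\<close>. On the circle the gain of 4 eps^2 loses at most eps^2, which leaves
  3 eps^2; inside the disc the loss is at most eps^2/16, outweighed by a push of 3/2 eps^2.
  Distances add up as 2 + 3 + 4, in units of eps.\<close>

lemma adm_disc:
  assumes a: "adm z v" and s: "1 \<le> s" "s\<^sup>2 \<le> 1 + 2 * \<epsilon>\<^sup>2" and \<eta>: "cmod \<eta> \<le> 2 * \<epsilon>"
    and c: "cmod \<eta> = 2 * \<epsilon> \<or> 1 + 3/2 * \<epsilon>\<^sup>2 \<le> s\<^sup>2"
  shows "s *\<^sub>R z + csc \<eta> v \<in> W" "rad (s *\<^sub>R z + csc \<eta> v) \<le> 9 * \<epsilon>"
    "cmod \<eta> = 2 * \<epsilon> \<Longrightarrow> hsq z + 3 * \<epsilon>\<^sup>2 \<le> hsq (s *\<^sub>R z + csc \<eta> v)"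
proof -
  let ?y = "s *\<^sub>R z + csc \<eta> v"
  have z: "norm z \<ge> 1" "rad z < 2 * \<epsilon>" "norm v = 1" "cmod (herm z v) \<le> \<epsilon> / 8"
    using a by (auto simp: adm_def)
  note e = eps_sq
  have s2: "s \<le> 1 + \<epsilon>\<^sup>2" by (rule le_of_sq_le[OF s(2)])
  have hs: "herm (s *\<^sub>R z) v = of_real s * herm z v"
    by (simp add: herm_def scaleR_conv_of_real algebra_simps)
  have "cmod (herm (s *\<^sub>R z) v) = s * cmod (herm z v)" using s(1) unfolding hs by (simp add: norm_mult)
  also have "\<dots> \<le> 2 * (\<epsilon> / 8)" using z(4) s(1) s2 e(2) by (intro mult_mono) auto
  finally have hb: "cmod (herm (s *\<^sub>R z) v) \<le> \<epsilon> / 4" by simp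
  note N = norm_add_csc[OF z(3) hb, of \<eta>]
  have nz: "(norm z)\<^sup>2 = 1 + hsq z" by (simp add: hsq_def)
  have hz: "0 \<le> hsq z" "hsq z \<le> 4 * \<epsilon>\<^sup>2"
    using hsq_nonneg[OF z(1)] hsq_le_of_rad(1)[OF z(1,2)] by auto
  have sz: "(norm (s *\<^sub>R z))\<^sup>2 = s\<^sup>2 * (1 + hsq z)" by (simp add: power_mult_distrib nz)
  have s1: "1 \<le> s\<^sup>2" using s(1) by simp
  have szl: "s\<^sup>2 + hsq z \<le> s\<^sup>2 * (1 + hsq z)"
    using mult_right_mono[OF s1 hz(1)] by (simp add: algebra_simps)
  have "s\<^sup>2 * (1 + hsq z) \<le> (1 + 2 * \<epsilon>\<^sup>2) * (1 + 4 * \<epsilon>\<^sup>2)"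
    using s(2) hz e by (intro mult_mono) auto
  also have "\<dots> = 1 + 6 * \<epsilon>\<^sup>2 + 8 * (\<epsilon>\<^sup>2 * \<epsilon>\<^sup>2)" by (simp add: algebra_simps)
  also have "\<dots> \<le> 1 + 8 * \<epsilon>\<^sup>2" using e(4) by simp
  finally have szu: "s\<^sup>2 * (1 + hsq z) \<le> 1 + 8 * \<epsilon>\<^sup>2" .
  have hy: "hsq ?y = (norm ?y)\<^sup>2 - 1" by (simp add: hsq_def)
  have cir: "hsq z + 3 * \<epsilon>\<^sup>2 \<le> hsq ?y" if "cmod \<eta> = 2 * \<epsilon>"
    using N(1) szl s1 unfolding sz hy that by (simp add: power2_eq_square)
  then show "cmod \<eta> = 2 * \<epsilon> \<Longrightarrow> hsq z + 3 * \<epsilon>\<^sup>2 \<le> hsq ?y" .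
  have low: "\<epsilon>\<^sup>2 < hsq ?y"
  proof (cases "cmod \<eta> = 2 * \<epsilon>")
    case True
    from cir[OF True] hz(1) e(1) show ?thesis by linarith
  next
    case False
    \<comment> \<open>Completing the square bounds the loss for all points of the disc at
      once.\<close>
    have "0 \<le> (cmod \<eta> - \<epsilon> / 4)\<^sup>2" by simp
    then have "- (\<epsilon>\<^sup>2) / 16 \<le> (cmod \<eta>)\<^sup>2 - 2 * cmod \<eta> * (\<epsilon> / 4)"
      by (simp add: power2_diff power_divide)
    moreover have "1 + 3/2 * \<epsilon>\<^sup>2 \<le> s\<^sup>2" using c False by simp
    ultimately show ?thesis using N(1) szl hz(1) e(1) unfolding sz hy by linarith
  qed
  have "(cmod \<eta>)\<^sup>2 \<le> 4 * \<epsilon>\<^sup>2"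
    using mult_mono[OF \<eta> \<eta>] \<epsilon>(1) by (simp add: power2_eq_square)
  moreover have "2 * cmod \<eta> * (\<epsilon> / 4) \<le> \<epsilon>\<^sup>2"
    using mult_right_mono[OF \<eta>, of \<epsilon>] \<epsilon>(1) by (simp add: power2_eq_square)
  ultimately have up: "hsq ?y \<le> 16 * \<epsilon>\<^sup>2"
    using N(2) szu e(1) unfolding sz hy by linarith
  have ny: "norm ?y > 1"
  proof (rule power2_less_imp_less[of 1])
    have "1 < (norm ?y)\<^sup>2" using low e(1) unfolding hy by linarith
    then show "1\<^sup>2 < (norm ?y)\<^sup>2" by simp
  qed simp
  have hy1: "height ?y > \<epsilon>" unfolding height_def using low \<epsilon>(1) by (intro real_less_rsqrt) auto
  have hy2: "height ?y \<le> 4 * \<epsilon>" unfolding height_def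
    using up \<epsilon>(1) by (intro real_le_lsqrt) (auto simp: power2_eq_square)
  have hz2: "0 \<le> height z" "height z < 2 * \<epsilon>" using height_nonneg[OF z(1)] hsq_le_of_rad(2)[OF z(1,2)] by auto
  have nz2: "norm z \<le> 3/2"
  proof (rule power2_le_imp_le)
    show "(norm z)\<^sup>2 \<le> (3/2)\<^sup>2" unfolding nz using hz e(2) by (simp add: power2_eq_square)
  qed simp
  have "norm (?y - z) = norm ((s - 1) *\<^sub>R z + csc \<eta> v)" by (simp add: algebra_simps)
  also have "\<dots> \<le> (s - 1) * norm z + cmod \<eta>"
    using norm_triangle_ineq[of "(s - 1) *\<^sub>R z" "csc \<eta> v"] s(1) z(3) by (simp add: norm_csc)
  also have "\<dots> \<le> \<epsilon>\<^sup>2 * (3/2) + 2 * \<epsilon>"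
    using s2 s(1) nz2 \<eta> e(1) by (intro add_mono mult_mono) auto
  also have "\<dots> \<le> 3 * \<epsilon>" using e(3) \<epsilon>(1) by linarith
  finally have "norm (?y - z) \<le> 3 * \<epsilon>" .
  moreover have "\<bar>height ?y - height z\<bar> \<le> 4 * \<epsilon>" using hy1 hy2 hz2 \<epsilon>(1) by linarith
  ultimately show r9: "rad ?y \<le> 9 * \<epsilon>" using rad_le[of ?y z] z(2) by linarith
  show "?y \<in> W" using ny r9 hy1 rad_ge_height[of ?y] \<kappa>(1) \<epsilon>(1) by (simp add: W_def)
qed

section \<open>Circle means of the coefficients and their independence of the direction\<close>

abbreviation "cmean k v \<equiv> circle_mean (2 * \<epsilon>) (h k) v"

definition circ :: "C2 \<Rightarrow> C2 set" where
  "circ v = {z. \<forall>\<theta>. z + csc (of_real (2 * \<epsilon>) * cis \<theta>) v \<in> W}"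

lemma open_circ: "open (circ v)" unfolding circ_def by (rule open_circle_in[OF open_W])

lemma hol2_cmean: "hol2 (circ v) (cmean k v)"
  by (rule hol2_circle_mean[OF h_hol2 open_W]) (simp add: circ_def)

lemma adm_circ: assumes "adm z v" "1 \<le> s" "s\<^sup>2 \<le> 1 + 2 * \<epsilon>\<^sup>2" shows "s *\<^sub>R z \<in> circ v"
  unfolding circ_def using adm_disc(1)[OF assms] \<epsilon>(1) by (simp add: norm_mult)

text \<open>After this much outward push the whole disc lies in \<open>W\<close>, and the mean value
  property applies.\<close>

lemma cmean_far:
  assumes "adm z v" "1 \<le> s" "s\<^sup>2 \<le> 1 + 2 * \<epsilon>\<^sup>2" "1 + 3/2 * \<epsilon>\<^sup>2 \<le> s\<^sup>2"
  shows "cmean k v (s *\<^sub>R z) = h k (s *\<^sub>R z)"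
proof -
  have "(\<lambda>\<eta>. h k (s *\<^sub>R z + csc \<eta> v)) holomorphic_on cball 0 (2 * \<epsilon>)"
    by (rule holomorphic_on_subset[OF hol2_line[OF h_hol2 open_W]])
      (use adm_disc(1)[OF assms(1-3)] assms(4) in auto)
  from mean_value_circle[OF this] \<epsilon>(1) show ?thesis by (simp add: circle_mean_def csc.zero_left)
qed

text \<open>The radial path runs from factor 1 to sqrt(1 + 2 eps^2). Its last piece, beyond sqrt(1 +
  3/2 eps^2), is where full discs lie in \<open>W\<close>; vanishing there is carried back to factor
  1 by the one-variable identity theorem.\<close>

lemma path_identity:
  assumes g: "hol2 V g" "open V" and V: "\<And>s. 1 \<le> s \<Longrightarrow> s\<^sup>2 \<le> 1 + 2 * \<epsilon>\<^sup>2 \<Longrightarrow> s *\<^sub>R z \<in> V"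
    and z: "\<And>s. 1 \<le> s \<Longrightarrow> s\<^sup>2 \<le> 1 + 2 * \<epsilon>\<^sup>2 \<Longrightarrow> 1 + 3/2 * \<epsilon>\<^sup>2 \<le> s\<^sup>2 \<Longrightarrow> g (s *\<^sub>R z) = 0"
  shows "g z = 0"
proof -
  let ?a = "sqrt (1 + 3/2 * \<epsilon>\<^sup>2)" and ?b = "sqrt (1 + 2 * \<epsilon>\<^sup>2)"
  have ab: "1 < ?a" "?a < ?b" "1 \<le> ?b" using eps_sq(1) by auto
  have sq: "s\<^sup>2 \<le> 1 + 2 * \<epsilon>\<^sup>2" if "1 \<le> s" "s \<le> ?b" for s
    using power_mono[OF that(2), of 2] that(1) eps_sq(1) by simp
  have sa: "1 + 3/2 * \<epsilon>\<^sup>2 \<le> s\<^sup>2" if "?a \<le> s" for s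
    using power_mono[OF that, of 2] eps_sq(1) by simp
  have "g (0 + 1 *\<^sub>R z) = 0"
  proof (rule line_identity[OF g, of "{1..?b}" 0 z "{?a<..<?b}" ?a])
    show "?a islimpt {?a<..<?b}" by (rule islimpt_Ioo_left[OF ab(2)])
    show "0 + s *\<^sub>R z \<in> V" if "s \<in> {1..?b}" for s using V[of s] sq[of s] that by simp
    show "g (0 + s *\<^sub>R z) = 0" if "s \<in> {?a<..<?b}" for s
    proof -
      have s: "1 < s" "?a \<le> s" "s \<le> ?b" using less_trans[OF ab(1), of s] that by simp_all
      then have "1 \<le> s" by linarith
      from z[OF this sq[OF this s(3)] sa[OF s(2)]] show ?thesis by simp
    qed
    show "{?a<..<?b} \<subseteq> {1..?b}"
    proof
      fix s assume "s \<in> {?a<..<?b}"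
      then show "s \<in> {1..?b}" using less_trans[OF ab(1), of s] by simp
    qed
  qed (use ab in auto)
  then show ?thesis by simp
qed

text \<open>Both means reproduce \<open>h k\<close> at the far end of the radial path, and their
  difference is holomorphic along it.\<close>

lemma cmean_indep:
  assumes "adm z v" "adm z v'"
  shows "cmean k v z = cmean k v' z"
proof -
  have "hol2 (circ v \<inter> circ v') (\<lambda>z. cmean k v z - cmean k v' z)"
    by (intro hol2_diff hol2_subset[OF hol2_cmean]) auto
  then have "cmean k v z - cmean k v' z = 0"
    by (rule path_identity[OF _ open_Int[OF open_circ open_circ]])
      (use adm_circ assms cmean_far in auto)
  then show ?thesis by simp
qed

text \<open>The radial path from z stays in \<open>W\<close>: \<open>rad\<close> does not decrease
  below its initial value, which exceeds eps, and displacement and height keep it under 7 eps. At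
  the far end the mean reproduces \<open>h k\<close>.\<close>

lemma cmean_eq:
  assumes "adm z v" "z \<in> W"
  shows "cmean k v z = h k z"
proof -
  have "hol2 (circ v \<inter> W) (\<lambda>z. cmean k v z - h k z)"
    by (intro hol2_diff hol2_subset[OF hol2_cmean] hol2_subset[OF h_hol2]) auto
  then have "cmean k v z - h k z = 0"
  proof (rule path_identity[OF _ open_Int[OF open_circ open_W]])
    fix s :: real assume s: "1 \<le> s" "s\<^sup>2 \<le> 1 + 2 * \<epsilon>\<^sup>2"
    have z: "norm z > 1" "rad z > \<epsilon>" "rad z < 2 * \<epsilon>" using assms by (auto simp: W_def adm_def)
    have n: "norm (s *\<^sub>R z) > 1" using z(1) s(1) mult_mono[of 1 s 1 "norm z"]
      by (simp add: less_1_mult') (metis less_1_mult' mult.commute)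
    note e = eps_sq
    have s2: "s \<le> 1 + \<epsilon>\<^sup>2" by (rule le_of_sq_le[OF s(2)])
    have hz: "hsq z \<le> 4 * \<epsilon>\<^sup>2" "0 \<le> hsq z" "height z < 2 * \<epsilon>" "0 \<le> height z"
      using hsq_le_of_rad[of z] hsq_nonneg[of z] height_nonneg[of z] z by auto
    have nz: "(norm z)\<^sup>2 = 1 + hsq z" by (simp add: hsq_def)
    have "s\<^sup>2 * (1 + hsq z) \<le> (1 + 2 * \<epsilon>\<^sup>2) * (1 + 4 * \<epsilon>\<^sup>2)"
      using s(2) hz e by (intro mult_mono) auto
    also have "\<dots> = 1 + 6 * \<epsilon>\<^sup>2 + 8 * (\<epsilon>\<^sup>2 * \<epsilon>\<^sup>2)" by (simp add: algebra_simps)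
    also have "\<dots> \<le> 1 + 8 * \<epsilon>\<^sup>2" using e(4) by simp
    finally have "s\<^sup>2 * (1 + hsq z) \<le> 1 + 8 * \<epsilon>\<^sup>2" .
    moreover have "hsq (s *\<^sub>R z) = s\<^sup>2 * (1 + hsq z) - 1"
      by (simp add: hsq_def[of "s *\<^sub>R z"] power_mult_distrib nz)
    ultimately have "hsq (s *\<^sub>R z) \<le> 16 * \<epsilon>\<^sup>2" using e(1) by linarith
    then have h4: "height (s *\<^sub>R z) \<le> 4 * \<epsilon>" unfolding height_def
      using \<epsilon>(1) by (intro real_le_lsqrt) (auto simp: power2_eq_square)
    have h0: "0 \<le> height (s *\<^sub>R z)" using height_nonneg[of "s *\<^sub>R z"] n by simp
    have nz2: "norm z \<le> 3/2"
      by (rule power2_le_imp_le) (use nz hz(1) e(2) in \<open>auto simp: power2_eq_square\<close>)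
    have "s *\<^sub>R z - z = (s - 1) *\<^sub>R z" by (simp add: algebra_simps)
    then have "norm (s *\<^sub>R z - z) = (s - 1) * norm z" using s(1) by simp
    also have "\<dots> \<le> \<epsilon>\<^sup>2 * (3/2)" using s2 s(1) nz2 e(1) by (intro mult_mono) auto
    also have "\<dots> \<le> \<epsilon>" using e(3) \<epsilon>(1) by linarith
    finally have "rad (s *\<^sub>R z) \<le> rad z + \<epsilon> + 4 * \<epsilon>"
      using rad_le[of "s *\<^sub>R z" z] h4 h0 hz by linarith
    moreover have "rad z \<le> rad (s *\<^sub>R z)" using rad_mono[of z s] z s by simp
    ultimately have "s *\<^sub>R z \<in> W" using n z \<kappa>(1) \<epsilon>(1) by (simp add: W_def)
    then show "s *\<^sub>R z \<in> circ v \<inter> W" using adm_circ[OF assms(1) s] by blast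
    show "cmean k v (s *\<^sub>R z) - h k (s *\<^sub>R z) = 0" if "1 + 3/2 * \<epsilon>\<^sup>2 \<le> s\<^sup>2"
      using cmean_far[OF assms(1) s that] by simp
  qed
  then show ?thesis by simp
qed

lemma adm_perp:
  assumes "norm z \<ge> 1" "rad z < 2 * \<epsilon>"
  shows "adm z (perp z)"
proof -
  have "z \<noteq> 0" using assms(1) by auto
  from norm_perp[OF this] show ?thesis unfolding adm_def using assms \<epsilon>(1) by (simp add: herm_perp)
qed

lemma adm_perp_near:
  assumes "norm z \<ge> 1" "rad z < 2 * \<epsilon>" "z0 \<noteq> 0" "norm (z - z0) \<le> \<epsilon> / 8"
  shows "adm z (perp z0)"
proof -
  have "herm z (perp z0) = herm (z - z0) (perp z0) + herm z0 (perp z0)"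
    by (simp add: herm_def algebra_simps)
  then have "cmod (herm z (perp z0)) \<le> norm (z - z0)"
    using cmod_herm_le[of "z - z0" "perp z0"] norm_perp[OF assms(3)] by (simp add: herm_perp)
  then show ?thesis unfolding adm_def using assms norm_perp[OF assms(3)] by simp
qed

subsection \<open>The extension near \<open>K\<close>\<close>

text \<open>The direction \<open>perp z\<close> is always admissible but not holomorphic in z; by
  independence of the direction it can be frozen near any point.\<close>

definition H :: "nat \<Rightarrow> C2 \<Rightarrow> complex" where
  "H n z = cmean (int n) (perp z) z"

definition F :: "complex^3 \<Rightarrow> complex" where
  "F p = (\<Sum>n. H n (proj2 p) * (p $ 3) ^ n)"

text \<open>Bounds the ratio of the height at a centre to that on its circle: x / (x + 3 eps^2) is
  at most 4/7 for x = \<open>hsq z\<close> at most 4 eps^2.\<close>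

definition \<theta> :: real where "\<theta> = sqrt (4/7)"

lemma theta: "0 < \<theta>" "\<theta> < 1" by (auto simp: \<theta>_def)

lemma powr_neg_half: "x > 0 \<Longrightarrow> x powr (- real n / 2) = inverse (sqrt x ^ n)"
proof -
  assume x: "x > 0"
  have "sqrt x ^ n = sqrt x powr real n" using x by (simp add: powr_realpow)
  also have "\<dots> = x powr (real n / 2)" using x by (simp add: powr_half_sqrt[symmetric] powr_powr)
  finally show ?thesis by (simp add: powr_minus)
qed

lemma norm_fcoef_nat_le:
  assumes "z \<in> W" "\<And>t. norm (f (qpt z t)) \<le> B"
  shows "norm (h (int n) z) \<le> B * inverse (height z ^ n)"
proof -
  have "hsq z > 0" using assms(1) W_norm hsq_pos by blast
  from norm_fcoef_le[OF assms, of "int n"] powr_neg_half[OF this, of n] show ?thesis by (simp add: height_def)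
qed

text \<open>The points in question lie in a compact part of \<open>D\<close>. The factor 5/4 keeps
  strictly away from the removed neighbourhood, yet stays below sqrt 3, the height over eps that the
  circles attain.\<close>

lemma bound_exists: "\<exists>B\<ge>0. \<forall>z. z \<in> W \<and> 5/4 * \<epsilon> \<le> rad z \<and> rad z \<le> 9 * \<epsilon> \<longrightarrow> (\<forall>t. norm (f (qpt z t)) \<le> B)"
proof -
  define C where "C = quadric \<inter> {p. 5/4 * \<epsilon> \<le> infdist p K} \<inter> {p. infdist p K \<le> 9 * \<epsilon>}"
  have cl: "closed quadric" unfolding quadric_def by (intro closed_Collect_eq continuous_intros)
  have "closed {p. 5/4 * \<epsilon> \<le> infdist p K}" by (intro closed_Collect_le continuous_on_infdist continuous_intros)
  moreover have "compact {p. infdist p K \<le> 9 * \<epsilon>}" using compact_infdist_le[OF K(2,1)] \<epsilon>(1) by simp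
  ultimately have "compact C" unfolding C_def using cl by (intro closed_Int_compact closed_Int) auto
  moreover have "C \<subseteq> D" using \<kappa> \<epsilon>(1) by (auto simp: C_def closed_nhd_def)
  ultimately have "compact (f ` C)" using f_cont continuous_on_subset compact_continuous_image by blast
  then obtain B where B: "\<And>p. p \<in> C \<Longrightarrow> norm (f p) \<le> B"
    using compact_imp_bounded bounded_iff by (metis imageI)
  have "norm (f (qpt z t)) \<le> max 0 B" if "z \<in> W" "5/4 * \<epsilon> \<le> rad z" "rad z \<le> 9 * \<epsilon>" for z t
  proof -
    have n: "norm z \<ge> 1" using that(1) W_norm by auto
    have "qpt z t \<in> C" using qpt_in_quadric[OF n] infdist_qpt[OF n] that(2,3) by (simp add: C_def)
    from B[OF this] show ?thesis by simp
  qed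
  then show ?thesis by (intro exI[of _ "max 0 B"]) auto
qed

definition bnd :: real where
  "bnd = (SOME B. B \<ge> 0 \<and> (\<forall>z. z \<in> W \<and> 5/4 * \<epsilon> \<le> rad z \<and> rad z \<le> 9 * \<epsilon> \<longrightarrow> (\<forall>t. norm (f (qpt z t)) \<le> B)))"

lemma bnd: "bnd \<ge> 0"
    "z \<in> W \<Longrightarrow> 5/4 * \<epsilon> \<le> rad z \<Longrightarrow> rad z \<le> 9 * \<epsilon> \<Longrightarrow> norm (f (qpt z t)) \<le> bnd"
proof -
  have "bnd \<ge> 0 \<and> (\<forall>z. z \<in> W \<and> 5/4 * \<epsilon> \<le> rad z \<and> rad z \<le> 9 * \<epsilon> \<longrightarrow> (\<forall>t. norm (f (qpt z t)) \<le> bnd))"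
    unfolding bnd_def by (rule someI_ex[OF bound_exists])
  then show "bnd \<ge> 0" "z \<in> W \<Longrightarrow> 5/4 * \<epsilon> \<le> rad z \<Longrightarrow> rad z \<le> 9 * \<epsilon> \<Longrightarrow> norm (f (qpt z t)) \<le> bnd" by blast+
qed

text \<open>A Cauchy estimate: on the circle the coefficient is at most \<open>bnd\<close> / R^n
  with R^2 = \<open>hsq z\<close> + 3 eps^2, while |z_3| is at most \<open>\<theta>\<close> R. The
  resulting geometric decay is uniform up to the sphere.\<close>

lemma H_bound:
  assumes "norm z \<ge> 1" "rad z < 2 * \<epsilon>" "cmod w = height z"
  shows "norm (H n z * w ^ n) \<le> bnd * \<theta> ^ n"
proof -
  let ?R = "sqrt (hsq z + 3 * \<epsilon>\<^sup>2)"
  have a: "adm z (perp z)" by (rule adm_perp[OF assms(1,2)])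
  have hz: "0 \<le> hsq z" "hsq z \<le> 4 * \<epsilon>\<^sup>2" using hsq_nonneg[OF assms(1)] hsq_le_of_rad(1)[OF assms(1,2)] by auto
  have Rp: "?R > 0" using hz eps_sq(1) by (simp add: add_nonneg_pos)
  let ?y = "\<lambda>t. z + csc (of_real (2 * \<epsilon>) * cis t) (perp z)"
  have c: "cmod (of_real (2 * \<epsilon>) * cis t) = 2 * \<epsilon>" for t using \<epsilon>(1) by (simp add: norm_mult)
  have s1: "(1::real) \<le> 1" "1\<^sup>2 \<le> 1 + 2 * \<epsilon>\<^sup>2" by simp_all
  note d = adm_disc[OF a s1 eq_refl[OF c] disjI1[OF c], simplified scaleR_one]
  have yW: "?y t \<in> W" for t by (rule d(1))
  have "norm (h (int n) (?y t)) \<le> bnd * inverse (?R ^ n)" for t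
  proof -
    have yn: "norm (?y t) \<ge> 1" using yW[of t] W_norm by auto
    have hy: "hsq z + 3 * \<epsilon>\<^sup>2 \<le> hsq (?y t)" by (rule d(3)[OF c])
    then have R: "?R \<le> height (?y t)" unfolding height_def by simp
    have "5/4 * \<epsilon> \<le> height (?y t)" unfolding height_def
      by (rule real_le_rsqrt) (use hy hz eps_sq(1) in \<open>simp add: power_mult_distrib power_divide\<close>)
    then have "5/4 * \<epsilon> \<le> rad (?y t)" using rad_ge_height[OF yn] by linarith
    from norm_fcoef_nat_le[OF yW bnd(2)[OF yW this d(2)], of n]
    have "norm (h (int n) (?y t)) \<le> bnd * inverse (height (?y t) ^ n)" .
    also have "\<dots> \<le> bnd * inverse (?R ^ n)"
      by (intro mult_left_mono le_imp_inverse_le power_mono R bnd(1) zero_less_power Rp) (use Rp in simp)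
    finally show ?thesis .
  qed
  then have "norm (H n z) \<le> bnd * inverse (?R ^ n)"
    unfolding H_def by (rule circle_mean_norm_le[OF hol2_continuous_on[OF h_hol2 open_W] yW])
  moreover have "height z ^ n \<le> (\<theta> * ?R) ^ n"
  proof (rule power_mono)
    show "height z \<le> \<theta> * ?R"
      unfolding height_def \<theta>_def real_sqrt_mult[symmetric] using hz by simp
  qed (rule height_nonneg[OF assms(1)])
  ultimately have "norm (H n z) * height z ^ n \<le> (bnd * inverse (?R ^ n)) * (\<theta> * ?R) ^ n"
    using height_nonneg[OF assms(1)] bnd(1) Rp by (intro mult_mono) auto
  also have "\<dots> = bnd * \<theta> ^ n" using Rp by (simp add: power_mult_distrib)
  finally show ?thesis by (simp add: norm_mult norm_power assms(3))
qed

lemma summable_theta: "summable (\<lambda>n. bnd * \<theta> ^ n)"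
  using theta by (intro summable_mult summable_geometric) auto

text \<open>Over a fixed z both sides are continuous on the circle with the same Fourier
  coefficients: for nonnegative index because the means reproduce those of \<open>f\<close>, for
  negative index because those of \<open>f\<close> vanish.\<close>

lemma F_eq_f_off_sphere:
  assumes z: "z \<in> W" "rad z < 2 * \<epsilon>"
  shows "F (qpt z s) = f (qpt z s)"
proof -
  have nz: "norm z > 1" using z(1) W_norm by auto
  have n1: "norm z \<ge> 1" using nz by simp
  have hp: "height z > 0" "hsq z > 0" using height_pos[OF nz] hsq_pos[OF nz] by auto
  have Hh: "H n z = h (int n) z" for n
    unfolding H_def by (rule cmean_eq[OF adm_perp[OF n1 z(2)] z(1)])
  define a where "a n = h (int n) z * of_real (height z) ^ n" for n
  have ab: "norm (a n * w ^ n) \<le> bnd * \<theta> ^ n" if "w \<in> sphere 0 1" for n w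
    using H_bound[OF n1 z(2), of "of_real (height z) * w" n] that hp(1)
    by (simp add: a_def Hh norm_mult power_mult_distrib mult_ac)
  define S where "S w = (\<Sum>n. a n * w ^ n)" for w
  have ul: "uniform_limit (sphere 0 1) (\<lambda>N w. \<Sum>n<N. a n * w ^ n) S sequentially"
    unfolding S_def by (rule Weierstrass_m_test[OF ab summable_theta])
  have Sc: "continuous_on (sphere 0 1) S"
    by (rule uniform_limit_theorem[OF _ ul]) (auto intro!: always_eventually continuous_intros)
  \<comment> \<open>Replaces the angle by a point of the unit circle, the form in which Fourier
    uniqueness is stated.\<close>
  define Q where "Q w = (vector [fst z, snd z, of_real (height z) * w] :: complex^3)" for w
  have Qcis: "Q (cis t) = qpt z t" for t by (simp add: Q_def qpt_def)
  have sph: "\<exists>t. w = cis t" if "w \<in> sphere 0 1" for w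
    using rcis_cmod_Arg[of w] that by (intro exI[of _ "Arg w"]) (simp add: rcis_def)
  have QD: "Q ` sphere 0 1 \<subseteq> D"
  proof
    fix p assume "p \<in> Q ` sphere 0 1"
    then obtain w where w: "w \<in> sphere 0 1" "p = Q w" by blast
    then obtain t where "w = cis t" using sph by blast
    with w(2) show "p \<in> D" using qpt_W[OF z(1), of t] by (simp only: Qcis)
  qed
  have "continuous_on A (\<lambda>w. vec_lambda (\<lambda>i. Q w $ i))" for A
  proof (rule continuous_on_vec_lambda)
    fix i :: 3
    show "continuous_on A (\<lambda>w. Q w $ i)"
      using exhaust_3[of i] by (elim disjE) (simp_all add: Q_def continuous_on_mult_left)
  qed
  then have Qc: "continuous_on A Q" for A by simp
  define G where "G w = f (Q w) - S w" for w
  have Gc: "continuous_on (sphere 0 1) G"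
    unfolding G_def by (intro continuous_on_diff continuous_on_compose2[OF f_cont Qc QD] Sc)
  have cisint: "integral {0..2*pi} (\<lambda>t. cis (of_int j * t)) = (if j = 0 then 2 * of_real pi else 0)" for j :: int
  proof (cases "j = 0")
    case False
    have "((\<lambda>t. cis (of_int j * t)) has_integral
        (cis (of_int j * (2*pi)) / (\<i> * of_int j) - cis (of_int j * 0) / (\<i> * of_int j))) {0..2*pi}"
    proof (rule fundamental_theorem_of_calculus)
      fix t :: real
      have "((\<lambda>t. exp (\<i> * of_int j * of_real t) / (\<i> * of_int j)) has_vector_derivative exp (\<i> * of_int j * of_real t)) (at t within {0..2*pi})"
        by (rule has_vector_derivative_real_field) (use False in \<open>auto intro!: derivative_eq_intros\<close>)
      then show "((\<lambda>t. cis (of_int j * t) / (\<i> * of_int j)) has_vector_derivative cis (of_int j * t)) (at t within {0..2*pi})"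
        by (simp add: cis_conv_exp mult.assoc)
    qed simp
    then show ?thesis using False by (simp add: cis_int_2pi integral_unique)
  qed (simp add: scaleR_conv_of_real)
  have co: "integral {0..2*pi} (\<lambda>t. G (cis t) * cis (of_int k * t)) = 0" for k :: int
  proof -
    \<comment> \<open>Integration against \<open>cis (k t)\<close> picks the index -k, so positive
      \<open>k\<close> meets exactly the negative coefficients that vanish.\<close>
    have f1: "integral {0..2*pi} (\<lambda>t. f (qpt z t) * cis (of_int k * t)) = 2 * of_real pi * (if k \<le> 0 then a (nat (-k)) else 0)"
    proof -
      have e: "(\<lambda>t. f (qpt z t) * efac (of_int (-k)) z t) = (\<lambda>t. of_real (hsq z powr (of_int k / 2)) * (f (qpt z t) * cis (of_int k * t)))"
        by (simp add: efac_def mult_ac)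
      have "integral {0..2*pi} (\<lambda>t. f (qpt z t) * efac (of_int (-k)) z t) = 2 * of_real pi * h (-k) z"
        by (simp add: fcoef_def scaleR_conv_of_real)
      then have i: "of_real (hsq z powr (of_int k / 2)) * integral {0..2*pi} (\<lambda>t. f (qpt z t) * cis (of_int k * t)) = 2 * of_real pi * h (-k) z"
        unfolding e by simp
      have p: "hsq z powr (of_int k / 2) \<noteq> 0" using hp(2) by simp
      show ?thesis
      proof (cases "k \<le> 0")
        case True
        define n where "n = nat (-k)"
        have kn: "k = - int n" using True by (simp add: n_def)
        have "complex_of_real (hsq z powr (of_int k / 2)) = inverse (of_real (height z) ^ n)"
          using powr_neg_half[OF hp(2), of n] unfolding kn by (simp add: height_def)
        with i have "inverse (of_real (height z) ^ n) * integral {0..2*pi} (\<lambda>t. f (qpt z t) * cis (of_int k * t)) = 2 * of_real pi * h (int n) z"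
          unfolding kn by simp
        then have "integral {0..2*pi} (\<lambda>t. f (qpt z t) * cis (of_int k * t)) = 2 * of_real pi * a n"
          using hp(1) by (simp add: a_def field_simps)
        then show ?thesis using True by (simp add: n_def)
      next
        case False
        then show ?thesis using i p negative_coefficients_vanish[of "-k" z] z(1) by simp
      qed
    qed
    have f2: "integral {0..2*pi} (\<lambda>t. S (cis t) * cis (of_int k * t)) = 2 * of_real pi * (if k \<le> 0 then a (nat (-k)) else 0)"
    proof -
      define g where "g n t = a n * cis (of_int (int n + k) * t)" for n t
      have gt: "g n t = a n * cis t ^ n * cis (of_int k * t)" for n t
      proof -
        have "cis t ^ n * cis (of_int k * t) = cis (real n * t + of_int k * t)"
          using Complex.DeMoivre[of t n] cis_mult[of "real n * t" "of_int k * t"] by metis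
        then show ?thesis by (simp add: g_def mult.assoc distrib_right)
      qed
      have gb: "norm (g n t) \<le> bnd * \<theta> ^ n" for n t
        using ab[of "cis t" n] by (simp add: gt norm_mult)
      have gS: "(\<Sum>n. g n t) = S (cis t) * cis (of_int k * t)" for t
      proof -
        have "summable (\<lambda>n. a n * cis t ^ n)"
          by (rule summable_comparison_test'[OF summable_theta]) (use ab[of "cis t"] in auto)
        then show ?thesis unfolding gt S_def by (rule suminf_mult2[symmetric])
      qed
      have ulg: "uniform_limit (cbox 0 (2*pi)) (\<lambda>N t. \<Sum>n<N. g n t) (\<lambda>t. \<Sum>n. g n t) sequentially"
        by (rule Weierstrass_m_test[OF gb summable_theta])
      have gc: "continuous_on A (g n)" for A n unfolding g_def by (intro continuous_intros)
      obtain I J where I: "\<And>N. ((\<lambda>t. \<Sum>n<N. g n t) has_integral I N) (cbox 0 (2*pi))"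
        and J: "((\<lambda>t. \<Sum>n. g n t) has_integral J) (cbox 0 (2*pi))" and IJ: "I \<longlonglongrightarrow> J"
        by (rule uniform_limit_integral_cbox[OF ulg]) (auto intro!: continuous_intros gc)
      have gi: "integral {0..2*pi} (g n) = (if n = nat (-k) \<and> k \<le> 0 then 2 * of_real pi * a n else 0)" for n
        unfolding g_def using cisint[of "int n + k"] by auto
      have "I N = (\<Sum>n<N. if n = nat (-k) \<and> k \<le> 0 then 2 * of_real pi * a n else 0)" for N
      proof -
        have "I N = integral (cbox 0 (2*pi)) (\<lambda>t. \<Sum>n<N. g n t)" using integral_unique[OF I] by simp
        also have "\<dots> = (\<Sum>n<N. integral (cbox 0 (2*pi)) (g n))"
          by (rule integral_sum) (auto intro!: integrable_continuous_interval gc)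
        finally show ?thesis by (simp add: gi)
      qed
      \<comment> \<open>The partial sums are constant once \<open>N\<close> passes the one index
        that can contribute, so the limit can be read off.\<close>
      then have IN: "I N = 2 * of_real pi * (if k \<le> 0 then a (nat (-k)) else 0)" if "N > nat (-k)" for N
        using that by (cases "k \<le> 0") (simp_all add: sum.delta)
      have "I \<longlonglongrightarrow> 2 * of_real pi * (if k \<le> 0 then a (nat (-k)) else 0)"
        by (rule tendsto_eventually) (use IN in \<open>auto simp: eventually_sequentially intro!: exI[of _ "Suc (nat (-k))"]\<close>)
      from LIMSEQ_unique[OF IJ this] J show ?thesis
        unfolding gS by (simp add: integral_unique)
    qed
    have i1: "(\<lambda>t. f (qpt z t) * cis (of_int k * t)) integrable_on {0..2*pi}"
      by (intro integrable_continuous_interval continuous_on_mult continuous_on_compose2[OF f_cont continuous_on_qpt])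
        (use qpt_W[OF z(1)] in \<open>auto intro!: continuous_intros\<close>)
    have i2: "(\<lambda>t. S (cis t) * cis (of_int k * t)) integrable_on {0..2*pi}"
      by (intro integrable_continuous_interval continuous_on_mult continuous_on_compose2[OF Sc])
        (auto intro!: continuous_intros)
    have "(\<lambda>t. G (cis t) * cis (of_int k * t)) = (\<lambda>t. f (qpt z t) * cis (of_int k * t) - S (cis t) * cis (of_int k * t))"
      by (simp add: G_def Qcis left_diff_distrib)
    then show ?thesis using integral_diff[OF i1 i2] f1 f2 by simp
  qed
  have "G (cis s) = 0" by (rule fourier_unique[OF Gc co])
  then have "f (qpt z s) = S (cis s)" by (simp add: G_def Qcis)
  moreover have "F (qpt z s) = S (cis s)"
    unfolding F_def S_def by (simp add: Hh a_def power_mult_distrib mult.assoc)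
  ultimately show ?thesis by simp
qed

end

section \<open>Local approximation and continuity of the extension\<close>

lemma norm_proj2_le: "norm (proj2 u) \<le> norm u"
  by (rule power2_le_imp_le) (simp_all add: norm_vec3)

lemma proj2_diff: "proj2 (p - q) = proj2 p - proj2 q"
  by (simp add: proj2_def)

lemma bounded_linear_proj2: "bounded_linear proj2"
  unfolding proj2_def[abs_def] by (intro bounded_linear_Pair bounded_linear_vec_nth)

lemmas continuous_on_proj2 [continuous_intros] = bounded_linear.continuous_on[OF bounded_linear_proj2]

context hartogs
begin

lemma infdist_eq_rad: assumes "p \<in> quadric" shows "infdist p K = rad (proj2 p)"
  using infdist_qpt[OF quadric_norm_ge[OF assms], of "Arg (p $ 3)"] quadric_eq_qpt[OF assms] by simp

text \<open>With the direction frozen at \<open>perp z0\<close>, every coefficient is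
  \<open>hol2\<close> near z0; a tail of the series is dropped and the finitely many remaining
  coefficients are replaced by \<open>C1hol\<close> approximants. The radius \<open>\<rho>\<close>
  precedes \<open>\<delta>\<close>, so one ball serves all accuracies.\<close>

lemma F_approx:
  assumes p0: "p0 \<in> quadric" "rad (proj2 p0) < 2 * \<epsilon>"
  shows "\<exists>\<rho>>0. \<forall>\<delta>>0. \<exists>N U u. open U \<and> (\<forall>n<N. C1hol U (u n)) \<and>
    (\<forall>p\<in>quadric \<inter> ball p0 \<rho>. proj2 p \<in> U \<and> norm (F p - (\<Sum>n<N. u n (proj2 p) * (p $ 3) ^ n)) \<le> \<delta>)"
proof -
  define z0 where "z0 = proj2 p0"
  have n0: "norm z0 \<ge> 1" unfolding z0_def by (rule quadric_norm_ge[OF p0(1)])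
  then have z0: "z0 \<noteq> 0" by auto
  define v where "v = perp z0"
  have "z0 \<in> circ v" using adm_circ[OF adm_perp[OF n0], of 1] p0(2) by (simp add: z0_def v_def)
  moreover have "open (circ v \<inter> {z. rad z < 2 * \<epsilon>})"
    by (intro open_Int open_circ open_Collect_less rad_continuous continuous_intros)
  ultimately obtain r where r: "r > 0" "cball z0 r \<subseteq> circ v \<inter> {z. rad z < 2 * \<epsilon>}"
    using p0(2) unfolding z0_def open_contains_cball by blast
  define \<rho> where "\<rho> = min r (\<epsilon> / 8)"
  have \<rho>: "\<rho> > 0" "\<rho> \<le> r" "\<rho> \<le> \<epsilon> / 8" using r(1) \<epsilon>(1) by (auto simp: \<rho>_def)
  have pt: "norm (proj2 p) \<ge> 1" "proj2 p \<in> cball z0 r" "rad (proj2 p) < 2 * \<epsilon>" "adm (proj2 p) v"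
      "cmod (p $ 3) = height (proj2 p)" "cmod (p $ 3) \<le> 1"
    if p: "p \<in> quadric \<inter> ball p0 \<rho>" for p
  proof -
    have d: "norm (proj2 p - z0) < \<rho>"
      using norm_proj2_le[of "p - p0"] p by (simp add: proj2_diff z0_def dist_norm norm_minus_commute)
    show 1: "norm (proj2 p) \<ge> 1" using p quadric_norm_ge by blast
    show 2: "proj2 p \<in> cball z0 r" using d \<rho>(2) by (simp add: dist_norm norm_minus_commute)
    then show 3: "rad (proj2 p) < 2 * \<epsilon>" using r(2) by blast
    show "adm (proj2 p) v" unfolding v_def
      by (rule adm_perp_near[OF 1 3 z0]) (use d \<rho>(3) in simp)
    show 4: "cmod (p $ 3) = height (proj2 p)" using p quadric_cmod3 by blast
    \<comment> \<open>The height is below 2 eps, hence below 1, so powers of z_3 do not amplify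
      errors in the coefficients.\<close>
    show "cmod (p $ 3) \<le> 1" unfolding 4 using hsq_le_of_rad(2)[OF 1 3] \<epsilon>(2) by simp
  qed
  have "\<exists>N U u. open U \<and> (\<forall>n<N. C1hol U (u n)) \<and>
    (\<forall>p\<in>quadric \<inter> ball p0 \<rho>. proj2 p \<in> U \<and> norm (F p - (\<Sum>n<N. u n (proj2 p) * (p $ 3) ^ n)) \<le> \<delta>)"
    if \<delta>: "\<delta> > 0" for \<delta>
  proof -
    obtain N where N: "norm (\<Sum>i. bnd * \<theta> ^ (i + N)) < \<delta> / 2"
      using suminf_exist_split[OF _ summable_theta, of "\<delta> / 2"] \<delta> by auto
    \<comment> \<open>\<open>N\<close> coefficients, each off by at most \<open>e\<close>,
      contribute at most \<open>\<delta> / 2\<close>; \<open>Suc N\<close> keeps the denominator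
      positive for \<open>N = 0\<close>.\<close>
    define e where "e = \<delta> / (2 * real (Suc N))"
    have e: "e > 0" "real N * e \<le> \<delta> / 2" using \<delta> by (auto simp: e_def field_simps)
    have "\<exists>U u. open U \<and> cball z0 r \<subseteq> U \<and> C1hol U u \<and> (\<forall>z\<in>cball z0 r. norm (cmean (int n) v z - u z) \<le> e)" for n
      using hol2_cmean[of v "int n"] r(2) e(1) unfolding hol2_def by (meson compact_cball le_inf_iff)
    then obtain U u where U: "\<And>n. open (U n)" "\<And>n. cball z0 r \<subseteq> U n" "\<And>n. C1hol (U n) (u n)"
      "\<And>n z. z \<in> cball z0 r \<Longrightarrow> norm (cmean (int n) v z - u n z) \<le> e" by metis
    define U' where "U' = (\<Inter>n\<in>{..<N}. U n)"
    have "open U'" unfolding U'_def by (intro open_INT) (auto simp: U)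
    moreover have "C1hol U' (u n)" if "n < N" for n
      by (rule C1hol_subset[OF U(3)]) (use that in \<open>auto simp: U'_def\<close>)
    moreover have "proj2 p \<in> U' \<and> norm (F p - (\<Sum>n<N. u n (proj2 p) * (p $ 3) ^ n)) \<le> \<delta>"
      if p: "p \<in> quadric \<inter> ball p0 \<rho>" for p
    proof
      note P = pt[OF p]
      show "proj2 p \<in> U'" unfolding U'_def using P(2) U(2) by blast
      let ?t = "\<lambda>n. H n (proj2 p) * (p $ 3) ^ n"
      have tb: "norm (?t n) \<le> bnd * \<theta> ^ n" for n by (rule H_bound[OF P(1,3,5)])
      have st: "summable ?t" by (rule summable_comparison_test'[OF summable_theta]) (use tb in auto)
      have "F p - (\<Sum>n<N. ?t n) = (\<Sum>n. ?t (n + N))"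
        unfolding F_def using suminf_split_initial_segment[OF st, of N] by simp
      moreover have "norm (\<Sum>n. ?t (n + N)) \<le> (\<Sum>n. bnd * \<theta> ^ (n + N))"
        by (rule norm_suminf_le[OF tb]) (rule summable_ignore_initial_segment[OF summable_theta])
      ultimately have 1: "norm (F p - (\<Sum>n<N. ?t n)) \<le> \<delta> / 2" using N by simp
      have Hu: "H n (proj2 p) = cmean (int n) v (proj2 p)" for n
        unfolding H_def by (rule cmean_indep[OF adm_perp[OF P(1,3)] P(4)])
      have "(\<Sum>n<N. ?t n) - (\<Sum>n<N. u n (proj2 p) * (p $ 3) ^ n) =
          (\<Sum>n<N. (cmean (int n) v (proj2 p) - u n (proj2 p)) * (p $ 3) ^ n)"
        by (simp add: Hu sum_subtractf left_diff_distrib)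
      also have "norm \<dots> \<le> (\<Sum>n<N. e)"
      proof (rule sum_norm_le)
        fix n assume "n \<in> {..<N}"
        have "norm ((cmean (int n) v (proj2 p) - u n (proj2 p)) * (p $ 3) ^ n) \<le> e * 1"
          unfolding norm_mult norm_power
          by (intro mult_mono U(4)[OF P(2)] power_le_one P(6)) (use e(1) in auto)
        then show "norm ((cmean (int n) v (proj2 p) - u n (proj2 p)) * (p $ 3) ^ n) \<le> e" by simp
      qed
      also have "\<dots> \<le> \<delta> / 2" using e(2) by simp
      finally show "norm (F p - (\<Sum>n<N. u n (proj2 p) * (p $ 3) ^ n)) \<le> \<delta>"
        using 1 norm_triangle_ineq[of "F p - (\<Sum>n<N. ?t n)" "(\<Sum>n<N. ?t n) - (\<Sum>n<N. u n (proj2 p) * (p $ 3) ^ n)"]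
        by simp
    qed
    ultimately show ?thesis by blast
  qed
  with \<rho>(1) show ?thesis by blast
qed

text \<open>Radius 2 \<open>\<epsilon>\<close> against \<open>\<epsilon>\<close> for the removed
  set: the overlap with \<open>D\<close> is the shell on which \<open>F\<close> and \<open>f\<close>
  are compared.\<close>

definition nearK :: "(complex^3) set" where "nearK = {p\<in>quadric. infdist p K < 2 * \<epsilon>}"

lemma nearK_rad: "p \<in> nearK \<Longrightarrow> rad (proj2 p) < 2 * \<epsilon>" "p \<in> nearK \<Longrightarrow> p \<in> quadric"
  using infdist_eq_rad by (auto simp: nearK_def)

lemma F_continuous: "continuous_on nearK F"
  unfolding continuous_on_iff
proof (intro ballI allI impI)
  fix p0 and e :: real assume p0: "p0 \<in> nearK" and e: "e > 0"
  obtain \<rho> where \<rho>: "\<rho> > 0" "\<And>\<delta>. \<delta> > 0 \<Longrightarrow> \<exists>N U u. open U \<and> (\<forall>n<N. C1hol U (u n)) \<and>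
    (\<forall>p\<in>quadric \<inter> ball p0 \<rho>. proj2 p \<in> U \<and> norm (F p - (\<Sum>n<N. u n (proj2 p) * (p $ 3) ^ n)) \<le> \<delta>)"
    using F_approx nearK_rad[OF p0] by blast
  obtain N U u where U: "\<forall>n<N. C1hol U (u n)"
    "\<And>p. p \<in> quadric \<inter> ball p0 \<rho> \<Longrightarrow> proj2 p \<in> U"
    "\<And>p. p \<in> quadric \<inter> ball p0 \<rho> \<Longrightarrow> norm (F p - (\<Sum>n<N. u n (proj2 p) * (p $ 3) ^ n)) \<le> e / 4"
    using \<rho>(2)[of "e / 4"] e by auto
  define g where "g p = (\<Sum>n<N. u n (proj2 p) * (p $ 3) ^ n)" for p
  have gc: "continuous_on (quadric \<inter> ball p0 \<rho>) g"
    unfolding g_def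
  proof (intro continuous_on_sum continuous_on_mult continuous_on_power)
    fix n assume "n \<in> {..<N}"
    then have "continuous_on U (u n)" using U(1) C1hol_continuous_on by blast
    then show "continuous_on (quadric \<inter> ball p0 \<rho>) (\<lambda>p. u n (proj2 p))"
      by (rule continuous_on_compose2) (use U(2) in \<open>auto intro!: continuous_intros\<close>)
  qed (intro continuous_intros)
  have p0b: "p0 \<in> quadric \<inter> ball p0 \<rho>" using nearK_rad(2)[OF p0] \<rho>(1) by simp
  have "\<exists>d>0. \<forall>p\<in>quadric \<inter> ball p0 \<rho>. dist p p0 < d \<longrightarrow> dist (g p) (g p0) < e / 4"
    using gc[unfolded continuous_on_iff, rule_format, OF p0b, of "e / 4"] e by simp
  then obtain d where d: "d > 0" "\<And>p. p \<in> quadric \<inter> ball p0 \<rho> \<Longrightarrow> dist p p0 < d \<Longrightarrow> dist (g p) (g p0) < e / 4"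
    by blast
  have "dist (F p) (F p0) < e" if p: "p \<in> nearK" "dist p p0 < min d \<rho>" for p
  proof -
    have pb: "p \<in> quadric \<inter> ball p0 \<rho>" using nearK_rad(2)[OF p(1)] p(2) by (simp add: dist_commute)
    have "norm (F p - g p) \<le> e / 4" "norm (F p0 - g p0) \<le> e / 4" "norm (g p - g p0) < e / 4"
      using U(3)[OF pb] U(3)[OF p0b] d(2)[OF pb] p(2) by (auto simp: g_def dist_norm)
    moreover have "norm (F p - F p0) \<le> norm (F p - g p) + norm (g p - g p0) + norm (F p0 - g p0)"
      using norm_triangle_ineq4[of "(F p - g p) + (g p - g p0)" "F p0 - g p0"]
        norm_triangle_ineq[of "F p - g p" "g p - g p0"] by simp
    ultimately show ?thesis using e by (simp add: dist_norm)
  qed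
  then show "\<exists>d>0. \<forall>p\<in>nearK. dist p p0 < d \<longrightarrow> dist (F p) (F p0) < e"
    using d(1) \<rho>(1) by (intro exI[of _ "min d \<rho>"]) auto
qed

text \<open>Points of the sphere itself lie outside \<open>W\<close>. There both functions are
  limits of their values at points pushed radially outward, where equality is known.\<close>

lemma F_eq_f:
  assumes p: "p \<in> nearK" "\<epsilon> < infdist p K"
  shows "F p = f p"
proof -
  define z where "z = proj2 p"
  have pq: "p \<in> quadric" by (rule nearK_rad(2)[OF p(1)])
  have z: "norm z \<ge> 1" "\<epsilon> < rad z" "rad z < 2 * \<epsilon>"
    using quadric_norm_ge[OF pq] p nearK_rad(1)[OF p(1)] infdist_eq_rad[OF pq] by (auto simp: z_def)
  have k2: "2 * \<epsilon> < \<kappa>" using \<kappa>(1) \<epsilon>(1) by linarith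
  have peq: "p = qpt z (Arg (p $ 3))" using quadric_eq_qpt[OF pq] by (simp add: z_def)
  show ?thesis
  proof (cases "norm z > 1")
    case True
    then have "z \<in> W" using z k2 by (simp add: W_def)
    from F_eq_f_off_sphere[OF this z(3)] show ?thesis by (subst (1 2) peq)
  next
    case False
    then have nz: "norm z = 1" using z(1) by simp
    have p0: "p = qpt z 0"
      using peq nz by (simp add: qpt_def height_def hsq_def)
    define s where "s j = 1 + inverse (real (Suc j))" for j
    have s1: "s j > 1" for j by (simp add: s_def)
    have sl: "s \<longlonglongrightarrow> 1" unfolding s_def
      using tendsto_add[OF tendsto_const LIMSEQ_inverse_real_of_nat, of 1] by simp
    define P where "P j = qpt (s j *\<^sub>R z) 0" for j
    have "(\<lambda>j. s j *\<^sub>R z) \<longlonglongrightarrow> 1 *\<^sub>R z" by (intro tendsto_intros sl)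
    then have zl: "(\<lambda>j. s j *\<^sub>R z) \<longlonglongrightarrow> z" by simp
    have qc: "continuous_on UNIV (\<lambda>y. qpt y 0)" by (intro continuous_intros)
    have Pl: "P \<longlonglongrightarrow> p" unfolding P_def p0
      by (rule continuous_on_tendsto_compose[OF qc zl]) auto
    have rl: "(\<lambda>j. rad (s j *\<^sub>R z)) \<longlonglongrightarrow> rad z"
      by (rule continuous_on_tendsto_compose[OF rad_continuous[of UNIV] zl]) auto
    have ev: "\<forall>\<^sub>F j in sequentially. \<epsilon> < rad (s j *\<^sub>R z) \<and> rad (s j *\<^sub>R z) < 2 * \<epsilon>"
      using order_tendstoD[OF rl] z by (intro eventually_conj) auto
    have in': "P j \<in> nearK \<and> P j \<in> D \<and> F (P j) = f (P j)"
      if "\<epsilon> < rad (s j *\<^sub>R z) \<and> rad (s j *\<^sub>R z) < 2 * \<epsilon>" for j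
    proof -
      have n: "norm (s j *\<^sub>R z) > 1" using s1[of j] nz by simp
      then have n1: "norm (s j *\<^sub>R z) \<ge> 1" by simp
      have w: "s j *\<^sub>R z \<in> W" using n that k2 by (simp add: W_def)
      have "P j \<in> nearK"
        using qpt_in_quadric[OF n1] infdist_qpt[OF n1] that by (simp add: nearK_def P_def)
      then show ?thesis
        using qpt_W[OF w] F_eq_f_off_sphere[OF w] that unfolding P_def by blast
    qed
    have pD: "p \<in> D" unfolding p0 by (rule qpt_in_D) (use z k2 in auto)
    have *: "(\<lambda>j. f (P j)) \<longlonglongrightarrow> f p"
      by (rule continuous_on_tendsto_compose[OF f_cont Pl pD]) (rule eventually_mono[OF ev], use in' in blast)
    have "(\<lambda>j. F (P j)) \<longlonglongrightarrow> F p"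
      by (rule continuous_on_tendsto_compose[OF F_continuous Pl p(1)]) (rule eventually_mono[OF ev], use in' in blast)
    moreover have "\<forall>\<^sub>F j in sequentially. F (P j) = f (P j)"
      by (rule eventually_mono[OF ev]) (use in' in blast)
    ultimately have "(\<lambda>j. f (P j)) \<longlonglongrightarrow> F p" by (rule Lim_transform_eventually)
    from LIMSEQ_unique[OF this *] show ?thesis .
  qed
qed

end

subsection \<open>Weak annihilation of the extension\<close>

lemma local_param_subset:
  assumes "local_param M V X" "open V'" "V' \<subseteq> V"
  shows "local_param M V' X"
proof -
  obtain Y where Y: "homeomorphism V (X ` V) X Y" using assms(1) by (auto simp: local_param_def)
  have "openin (top_of_set V) V'" using assms(2,3) by (simp add: open_subset)
  then have "openin (top_of_set (X ` V)) (X ` V')" by (rule homeomorphism_imp_open_map[OF Y])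
  then have "openin (top_of_set M) (X ` V')"
    using assms(1) openin_trans unfolding local_param_def by blast
  moreover have "homeomorphism V' (X ` V') X Y"
    by (rule homeomorphism_of_subsets[OF Y assms(3)]) (use assms(3) in auto)
  ultimately show ?thesis
    using assms smooth_on_subset unfolding local_param_def by blast
qed

lemma CR_vector_field_subset: "CR_vector_field V X c \<Longrightarrow> V' \<subseteq> V \<Longrightarrow> CR_vector_field V' X c"
  unfolding CR_vector_field_def using smooth_on_subset by blast

lemma LINT_test_restrict:
  assumes "tsupp \<phi> \<subseteq> B" "B \<subseteq> V" "\<And>x. x \<in> B \<Longrightarrow> g x = g' x"
  shows "(LINT x:V|lborel. g x * transposed c \<phi> x) = (LINT x:B|lborel. g' x * transposed c \<phi> x)"
proof -
  have "(\<lambda>x. indicator V x *\<^sub>R (g x * transposed c \<phi> x)) = (\<lambda>x. indicator B x *\<^sub>R (g' x * transposed c \<phi> x))"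
  proof
    fix x
    show "indicator V x *\<^sub>R (g x * transposed c \<phi> x) = indicator B x *\<^sub>R (g' x * transposed c \<phi> x)"
    proof (cases "x \<in> B")
      case True
      then show ?thesis using assms by auto
    next
      case False
      then have "transposed c \<phi> x = 0" using assms(1) transposed_eq_0 by blast
      then show ?thesis by simp
    qed
  qed
  then show ?thesis by (simp add: set_lebesgue_integral_def)
qed

text \<open>The field kills the components of \<open>X\<close>, and derivatives of the coefficients
  are complex linear; by the chain rule it kills the polynomial classically, and integration by
  parts gives the weak form.\<close>

lemma weak_polynomial_C1hol:
  assumes B: "open B" "smooth_on B X" and c: "CR_vector_field B X c" and \<phi>: "test_function B \<phi>"
    and u: "\<And>n. n < N \<Longrightarrow> C1hol U (u n)" "\<And>x. x \<in> B \<Longrightarrow> proj2 (X x) \<in> U"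
  shows "(LINT x:B|lborel. (\<Sum>n<N. u n (proj2 (X x)) * (X x $ 3) ^ n) * transposed c \<phi> x) = 0"
proof -
  have "\<forall>n<N. \<exists>u'. continuous_on U u' \<and> (\<forall>z\<in>U. (u n has_derivative blinfun_apply (u' z)) (at z) \<and>
      (\<forall>v. blinfun_apply (u' z) (csc \<i> v) = \<i> * blinfun_apply (u' z) v))"
    using u(1) unfolding C1hol_def by blast
  then obtain u' where u': "\<And>n. n < N \<Longrightarrow> continuous_on U (u' n)"
    "\<And>n z. n < N \<Longrightarrow> z \<in> U \<Longrightarrow> (u n has_derivative blinfun_apply (u' n z)) (at z)"
    "\<And>n z v. n < N \<Longrightarrow> z \<in> U \<Longrightarrow> blinfun_apply (u' n z) (csc \<i> v) = \<i> * blinfun_apply (u' n z) v"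
    by metis
  define DX where "DX x = frechet_derivative X (at x)" for x
  have DX: "(X has_derivative DX x) (at x)" if "x \<in> B" for x
    unfolding DX_def by (rule smooth_on_has_derivative[OF B(2) that])
  have DXc: "continuous_on B (\<lambda>x. DX x v)" for v
    unfolding DX_def by (intro smooth_on_imp_continuous_on smooth_on_frechet_derivative B)
  have Xc: "continuous_on B X" by (rule smooth_on_imp_continuous_on[OF B(2)])
  define w' where "w' x v = (\<Sum>n<N. u n (proj2 (X x)) * (of_nat n * (DX x v $ 3) * (X x $ 3) ^ (n - 1))
      + blinfun_apply (u' n (proj2 (X x))) (proj2 (DX x v)) * (X x $ 3) ^ n)" for x v
  show ?thesis
  proof (rule weak_of_strong[OF B(1) _ \<phi> B(1) test_functionD(3)[OF \<phi>] subset_refl, of _ _ w'])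
    show "smooth_on B c" using c by (simp add: CR_vector_field_def)
    show "((\<lambda>x. \<Sum>n<N. u n (proj2 (X x)) * (X x $ 3) ^ n) has_derivative w' x) (at x)" if x: "x \<in> B" for x
      unfolding w'_def[abs_def]
    proof (rule has_derivative_sum)
      fix n assume "n \<in> {..<N}"
      then have n: "n < N" by simp
      have 1: "((\<lambda>x. u n (proj2 (X x))) has_derivative (\<lambda>v. blinfun_apply (u' n (proj2 (X x))) (proj2 (DX x v)))) (at x)"
        by (rule has_derivative_compose[OF bounded_linear.has_derivative[OF bounded_linear_proj2 DX[OF x]] u'(2)[OF n u(2)[OF x]]])
      have 2: "((\<lambda>x. (X x $ 3) ^ n) has_derivative (\<lambda>v. of_nat n * (DX x v $ 3) * (X x $ 3) ^ (n - 1))) (at x)"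
        by (rule has_derivative_power[OF bounded_linear.has_derivative[OF bounded_linear_vec_nth DX[OF x]]])
      show "((\<lambda>x. u n (proj2 (X x)) * (X x $ 3) ^ n) has_derivative
          (\<lambda>v. u n (proj2 (X x)) * (of_nat n * (DX x v $ 3) * (X x $ 3) ^ (n - 1))
          + blinfun_apply (u' n (proj2 (X x))) (proj2 (DX x v)) * (X x $ 3) ^ n)) (at x)"
        by (rule has_derivative_mult[OF 1 2])
    qed
    show "continuous_on B (\<lambda>x. w' x v)" for v
      unfolding w'_def
    proof (intro continuous_on_sum continuous_on_add continuous_on_mult continuous_on_power continuous_on_const)
      fix n assume "n \<in> {..<N}"
      then have n: "n < N" by simp
      have pc: "continuous_on B (\<lambda>x. proj2 (X x))" by (intro continuous_intros Xc)
      show "continuous_on B (\<lambda>x. u n (proj2 (X x)))"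
        by (rule continuous_on_compose2[OF C1hol_continuous_on[OF u(1)[OF n]] pc]) (use u(2) in auto)
      show "continuous_on B (\<lambda>x. blinfun_apply (u' n (proj2 (X x))) (proj2 (DX x v)))"
        by (intro blinfun.continuous_on continuous_on_compose2[OF u'(1)[OF n] pc] continuous_on_proj2 DXc)
          (use u(2) in auto)
    qed (intro continuous_intros DXc Xc)+
    show "(\<Sum>i\<in>UNIV. c x $ i * w' x (axis i 1)) = 0" if x: "x \<in> B" for x
    proof -
      have L: "(\<Sum>i\<in>UNIV. c x $ i * DX x (axis i 1) $ j) = 0" for j
        using c x unfolding CR_vector_field_def partial_deriv_def DX_def by blast
      have L2: "(\<Sum>i\<in>UNIV. c x $ i * blinfun_apply (u' n (proj2 (X x))) (proj2 (DX x (axis i 1)))) = 0"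
        if n: "n < N" for n
      proof -
        let ?l = "blinfun_apply (u' n (proj2 (X x)))"
        have lin: "linear ?l" by (simp add: blinfun.bounded_linear_right bounded_linear.linear)
        have "(\<Sum>i\<in>UNIV. c x $ i * ?l (proj2 (DX x (axis i 1)))) = (\<Sum>i\<in>UNIV. ?l (csc (c x $ i) (proj2 (DX x (axis i 1)))))"
          by (rule sum.cong[OF refl]) (rule complex_linear_csc[OF lin u'(3)[OF n u(2)[OF x]], symmetric])
        also have "\<dots> = ?l (\<Sum>i\<in>UNIV. csc (c x $ i) (proj2 (DX x (axis i 1))))"
          by (rule linear_sum[OF lin, symmetric])
        also have "(\<Sum>i\<in>UNIV. csc (c x $ i) (proj2 (DX x (axis i 1)))) = 0"
          using L[of 1] L[of 2] by (simp add: prod_eq_iff csc_def proj2_def fst_sum snd_sum)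
        finally show ?thesis by (simp add: blinfun.zero_right)
      qed
      have "(\<Sum>i\<in>UNIV. c x $ i * w' x (axis i 1)) =
        (\<Sum>n<N. u n (proj2 (X x)) * of_nat n * (X x $ 3) ^ (n - 1) * (\<Sum>i\<in>UNIV. c x $ i * DX x (axis i 1) $ 3)
          + (X x $ 3) ^ n * (\<Sum>i\<in>UNIV. c x $ i * blinfun_apply (u' n (proj2 (X x))) (proj2 (DX x (axis i 1)))))"
        unfolding w'_def sum_distrib_left
        by (subst sum.swap) (simp add: sum.distrib sum_distrib_left algebra_simps)
      also have "\<dots> = 0" using L[of 3] L2 by simp
      finally show ?thesis .
    qed
  qed
qed

subsection \<open>The H-principle\<close>

lemma CR_restrict:
  assumes "g \<in> CR M \<Omega>" "D \<subseteq> \<Omega>"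
  shows "restrict g D \<in> CR M D"
proof -
  have "weakly_annihilates V c (restrict g D \<circ> X)"
    if h: "local_param M V X \<and> X ` V \<subseteq> D \<and> CR_vector_field V X c" for V X c
  proof -
    have "weakly_annihilates V c (g \<circ> X)" using assms h unfolding CR_def by blast
    moreover have "open V" using h by (simp add: local_param_def)
    moreover have "(LINT x:V|lborel. (restrict g D \<circ> X) x * transposed c \<phi> x) = (LINT x:V|lborel. (g \<circ> X) x * transposed c \<phi> x)"
      if "open V" for \<phi>
      by (rule set_lebesgue_integral_cong) (use that h in \<open>auto simp: restrict_def image_subset_iff\<close>)
    ultimately show ?thesis by (simp add: weakly_annihilates_iff)
  qed
  moreover have "continuous_on D (restrict g D)"
    using assms continuous_on_subset by (fastforce simp: CR_def cong: continuous_on_cong)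
  ultimately show ?thesis unfolding CR_def by simp
qed

lemma zero_in_CR: "restrict (\<lambda>_. 0) D \<in> CR M D"
proof -
  have "weakly_annihilates V c ((\<lambda>_. 0) \<circ> X)" for V X c
    by (simp add: weakly_annihilates_iff)
  then have "(\<lambda>_. 0) \<in> CR M UNIV" unfolding CR_def by simp
  then show ?thesis by (rule CR_restrict) simp
qed

context hartogs
begin

section \<open>The glued function\<close>

lemma D_open: "\<Omega> \<subseteq> quadric \<Longrightarrow> D = \<Omega> \<inter> {p. \<epsilon> < infdist p K}"
  using K(2) by (auto simp: closed_nhd_def)

lemma nearK_subset: "nearK \<subseteq> \<Omega>"
  using \<kappa> \<epsilon>(1) by (auto simp: nearK_def)

text \<open>The value \<open>undefined\<close> off \<open>\<Omega>\<close> is what membership in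
  \<open>extensional \<Omega>\<close> demands.\<close>

definition ext :: "complex^3 \<Rightarrow> complex" where
  "ext p = (if p \<in> D then f p else if p \<in> \<Omega> then F p else undefined)"

lemma ext_near: "p \<in> nearK \<Longrightarrow> ext p = F p"
  using F_eq_f[of p] nearK_subset nearK_rad(2)[of p] K(2) by (auto simp: ext_def closed_nhd_def not_le)

lemma union_D_nearK: "\<Omega> \<subseteq> quadric \<Longrightarrow> \<Omega> = D \<union> nearK"
  using nearK_subset \<epsilon>(1) by (auto simp: closed_nhd_def nearK_def)

lemma open_parts:
  assumes "\<Omega> \<subseteq> quadric"
  shows "openin (top_of_set \<Omega>) D" "openin (top_of_set \<Omega>) nearK"
proof -
  have "open {p. \<epsilon> < infdist p K}" "open {p. infdist p K < 2 * \<epsilon>}"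
    by (intro open_Collect_less continuous_on_infdist continuous_intros)+
  moreover have "nearK = \<Omega> \<inter> {p. infdist p K < 2 * \<epsilon>}"
    using nearK_subset assms by (auto simp: nearK_def)
  ultimately show "openin (top_of_set \<Omega>) D" "openin (top_of_set \<Omega>) nearK"
    using D_open[OF assms] by (auto simp: openin_open_Int)
qed

lemma ext_continuous:
  assumes "\<Omega> \<subseteq> quadric"
  shows "continuous_on \<Omega> ext"
proof -
  have "continuous_on (D \<union> nearK) ext"
  proof (rule continuous_on_Un_local_open)
    show "continuous_on D ext" by (rule continuous_on_eq[OF f_cont]) (simp add: ext_def)
    show "continuous_on nearK ext" by (rule continuous_on_eq[OF F_continuous]) (simp add: ext_near)
  qed (use open_parts[OF assms] union_D_nearK[OF assms] in auto)
  then show ?thesis using union_D_nearK[OF assms] by simp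
qed

text \<open>The equation is local: away from \<open>nearK\<close> it is the one for
  \<open>f\<close>, and on \<open>nearK\<close> it is the limit of the equations for the
  approximating polynomials. The chart is arbitrary here, so only the components of \<open>X\<close>
  are used, not the circle bundle charts.\<close>

lemma ext_weak:
  assumes Om: "\<Omega> \<subseteq> quadric" and X: "local_param quadric V X" "X ` V \<subseteq> \<Omega>" "CR_vector_field V X c"
  shows "weakly_annihilates V c (ext \<circ> X)"
proof (rule weakly_annihilates_local)
  show oV: "open V" using X(1) by (simp add: local_param_def)
  show sc: "smooth_on V c" using X(3) by (simp add: CR_vector_field_def)
  have sX: "smooth_on V X" using X(1) by (simp add: local_param_def)
  have Xc: "continuous_on V X" by (rule smooth_on_imp_continuous_on[OF sX])
  show "continuous_on V (ext \<circ> X)"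
    by (rule continuous_on_compose[OF Xc continuous_on_subset[OF ext_continuous[OF Om] X(2)]])
  have ball_in: "\<exists>r>0. ball a r \<subseteq> V \<and> X ` ball a r \<subseteq> G" if a: "a \<in> V" "X a \<in> G" "open G" for a G
  proof -
    have "open (V \<inter> X -` G)" by (rule continuous_open_preimage[OF Xc oV a(3)])
    moreover have "a \<in> V \<inter> X -` G" using a by simp
    ultimately obtain r where "r > 0" "ball a r \<subseteq> V \<inter> X -` G" unfolding open_contains_ball by blast
    then show ?thesis by (intro exI[of _ r]) auto
  qed
  fix a assume a: "a \<in> V"
  show "\<exists>r>0. \<forall>\<phi>. test_function V \<phi> \<and> tsupp \<phi> \<subseteq> ball a r \<longrightarrow>
      (LINT x:V|lborel. (ext \<circ> X) x * transposed c \<phi> x) = 0"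
  proof (cases "X a \<in> nearK")
    case False
    then have "X a \<in> D" using union_D_nearK[OF Om] a X(2) by blast
    then have i: "X a \<in> {p. \<epsilon> < infdist p K}" using D_open[OF Om] by blast
    have "open {p. \<epsilon> < infdist p K}" by (intro open_Collect_less continuous_on_infdist continuous_intros)
    from ball_in[OF a i this] obtain r where r: "r > 0" "ball a r \<subseteq> V" "X ` ball a r \<subseteq> {p. \<epsilon> < infdist p K}" by blast
    have rD: "X ` ball a r \<subseteq> D" using r X(2) D_open[OF Om] by blast
    have wk: "weakly_annihilates (ball a r) c (f \<circ> X)"
      using f local_param_subset[OF X(1) open_ball r(2)] CR_vector_field_subset[OF X(3) r(2)] rD
      unfolding CR_def by blast
    have "(LINT x:V|lborel. (ext \<circ> X) x * transposed c \<phi> x) = 0"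
      if \<phi>: "test_function V \<phi>" "tsupp \<phi> \<subseteq> ball a r" for \<phi>
    proof -
      have "test_function (ball a r) \<phi>" using \<phi> by (simp add: test_function_def tsupp_def)
      then have "(LINT x:ball a r|lborel. (f \<circ> X) x * transposed c \<phi> x) = 0"
        using wk by (simp add: weakly_annihilates_iff)
      moreover have "(LINT x:V|lborel. (ext \<circ> X) x * transposed c \<phi> x) = (LINT x:ball a r|lborel. (f \<circ> X) x * transposed c \<phi> x)"
      proof (rule LINT_test_restrict[OF \<phi>(2) r(2)])
        fix x assume "x \<in> ball a r"
        then have "X x \<in> D" using rD by blast
        then show "(ext \<circ> X) x = (f \<circ> X) x" by (simp add: ext_def)
      qed
      ultimately show ?thesis by simp
    qed
    then show ?thesis using r(1) by blast
  next
    case True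
    obtain \<rho> where \<rho>: "\<rho> > 0" "\<And>\<delta>. \<delta> > 0 \<Longrightarrow> \<exists>N U u. open U \<and> (\<forall>n<N. C1hol U (u n)) \<and>
      (\<forall>p\<in>quadric \<inter> ball (X a) \<rho>. proj2 p \<in> U \<and> norm (F p - (\<Sum>n<N. u n (proj2 p) * (p $ 3) ^ n)) \<le> \<delta>)"
      using F_approx nearK_rad[OF True] by blast
    have i: "X a \<in> ball (X a) \<rho> \<inter> {p. infdist p K < 2 * \<epsilon>}" using True \<rho>(1) by (simp add: nearK_def)
    have "open (ball (X a) \<rho> \<inter> {p. infdist p K < 2 * \<epsilon>})"
      by (intro open_Int open_ball open_Collect_less continuous_on_infdist continuous_intros)
    from ball_in[OF a i this] obtain r where r: "r > 0" "ball a r \<subseteq> V"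
      "X ` ball a r \<subseteq> ball (X a) \<rho> \<inter> {p. infdist p K < 2 * \<epsilon>}" by blast
    have XB: "X x \<in> quadric \<inter> ball (X a) \<rho>" "X x \<in> nearK" if x: "x \<in> ball a r" for x
    proof -
      have "X x \<in> quadric" using x r(2) X(2) Om by blast
      moreover have "X x \<in> ball (X a) \<rho> \<inter> {p. infdist p K < 2 * \<epsilon>}" using x r(3) by blast
      ultimately show "X x \<in> quadric \<inter> ball (X a) \<rho>" "X x \<in> nearK" by (simp_all add: nearK_def)
    qed
    have "(LINT x:V|lborel. (ext \<circ> X) x * transposed c \<phi> x) = 0"
      if \<phi>: "test_function V \<phi>" "tsupp \<phi> \<subseteq> ball a r" for \<phi>
    proof -
      let ?B = "ball a r"
      have tB: "test_function ?B \<phi>" using \<phi> by (simp add: test_function_def tsupp_def)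
      have sB: "smooth_on ?B c" "smooth_on ?B X" using smooth_on_subset[OF sc r(2)] smooth_on_subset[OF sX r(2)] by auto
      have XcB: "continuous_on ?B X" by (rule smooth_on_imp_continuous_on[OF sB(2)])
      have "continuous_on ?B (\<lambda>x. F (X x))"
        by (rule continuous_on_compose2[OF F_continuous XcB]) (use XB in blast)
      then have "(LINT x:?B|lborel. F (X x) * transposed c \<phi> x) = 0"
      proof (rule weak_limit[OF open_ball sB(1) tB])
        fix \<delta> :: real assume \<delta>: "\<delta> > 0"
        obtain N U u where U0: "\<forall>n<N. C1hol U (u n)"
          "\<forall>p\<in>quadric \<inter> ball (X a) \<rho>. proj2 p \<in> U \<and> norm (F p - (\<Sum>n<N. u n (proj2 p) * (p $ 3) ^ n)) \<le> \<delta>"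
          using \<rho>(2)[OF \<delta>] by blast
        have U: "\<And>n. n < N \<Longrightarrow> C1hol U (u n)"
          "\<And>p. p \<in> quadric \<inter> ball (X a) \<rho> \<Longrightarrow> proj2 p \<in> U"
          "\<And>p. p \<in> quadric \<inter> ball (X a) \<rho> \<Longrightarrow> norm (F p - (\<Sum>n<N. u n (proj2 p) * (p $ 3) ^ n)) \<le> \<delta>"
          using U0 by auto
        let ?w = "\<lambda>x. \<Sum>n<N. u n (proj2 (X x)) * (X x $ 3) ^ n"
        have wc: "continuous_on ?B ?w"
        proof (intro continuous_on_sum continuous_on_mult continuous_on_power)
          fix n assume "n \<in> {..<N}"
          then have n: "n < N" by simp
          have pc: "continuous_on ?B (\<lambda>x. proj2 (X x))" by (rule continuous_on_proj2[OF XcB])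
          have sub: "(\<lambda>x. proj2 (X x)) ` ?B \<subseteq> U" using U(2)[OF XB(1)] by blast
          show "continuous_on ?B (\<lambda>x. u n (proj2 (X x)))"
            by (rule continuous_on_compose2[OF C1hol_continuous_on[OF U(1)[OF n]] pc sub])
        next
          show "continuous_on ?B (\<lambda>x. X x $ 3)"
            by (rule bounded_linear.continuous_on[OF bounded_linear_vec_nth XcB])
        qed
        have w0: "(LINT x:?B|lborel. ?w x * transposed c \<phi> x) = 0"
          using weak_polynomial_C1hol[of ?B X c \<phi> N U u, OF open_ball sB(2) CR_vector_field_subset[OF X(3) r(2)] tB]
            U(1) U(2)[OF XB(1)] by blast
        show "\<exists>w. set_integrable lborel (tsupp \<phi>) (\<lambda>x. w x * transposed c \<phi> x) \<and>
            (LINT x:tsupp \<phi>|lborel. w x * transposed c \<phi> x) = 0 \<and> (\<forall>x\<in>tsupp \<phi>. norm (F (X x) - w x) \<le> \<delta>)"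
        proof (intro exI[of _ ?w] conjI ballI)
          show "set_integrable lborel (tsupp \<phi>) (\<lambda>x. ?w x * transposed c \<phi> x)"
            by (rule integrand_props(3)[OF open_ball sB(1) tB wc])
          show "(LINT x:tsupp \<phi>|lborel. ?w x * transposed c \<phi> x) = 0"
            using integrand_props(2)[OF open_ball sB(1) tB wc] w0 by simp
          fix x assume "x \<in> tsupp \<phi>"
          then have "x \<in> ?B" using \<phi>(2) by blast
          from U(3)[OF XB(1)[OF this]] show "norm (F (X x) - ?w x) \<le> \<delta>" .
        qed
      qed
      moreover have "(LINT x:V|lborel. (ext \<circ> X) x * transposed c \<phi> x) = (LINT x:?B|lborel. F (X x) * transposed c \<phi> x)"
        by (rule LINT_test_restrict[OF \<phi>(2) r(2)]) (simp add: ext_near XB(2))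
      ultimately show ?thesis by simp
    qed
    then show ?thesis using r(1) by blast
  qed
qed

lemma ext_in_CR:
  assumes "\<Omega> \<subseteq> quadric"
  shows "ext \<in> CR quadric \<Omega>" "restrict ext D = f"
proof -
  have "ext \<in> extensional \<Omega>" by (auto simp: ext_def extensional_def)
  then show "ext \<in> CR quadric \<Omega>"
    unfolding CR_def using ext_continuous[OF assms] ext_weak[OF assms] by blast
  have "f \<in> extensional D" using f by (simp add: CR_def)
  then show "restrict ext D = f" by (auto simp: fun_eq_iff restrict_def ext_def extensional_def)
qed

text \<open>A locally constant function on the complement of the neighbourhood of \<open>K\<close> extends across it:
  pull it back by the retraction \<open>\<sigma>\<close> of \<open>nearK\<close> onto points with \<open>z\<^sub>3 = 2 \<epsilon>\<close>.\<close>

lemma connected_complement: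
  assumes Om: "\<Omega> \<subseteq> quadric" "connected \<Omega>"
  shows "connected D"
  unfolding continuous_finite_range_constant_eq[where ?'b=real]
proof (intro allI impI)
  fix c :: "complex^3 \<Rightarrow> real" assume c: "continuous_on D c \<and> finite (c ` D)"
  \<comment> \<open>The radial factor that lifts the unit sphere to height 2
    \<open>\<epsilon>\<close>.\<close>
  let ?s = "sqrt (1 + 4 * \<epsilon>\<^sup>2)"
  define q where "q p = inverse (norm (proj2 p)) *\<^sub>R proj2 p" for p
  define \<sigma> where "\<sigma> p = qpt (?s *\<^sub>R q p) 0" for p
  have s: "?s > 1" using \<epsilon>(1) by simp
  have s2: "?s \<le> 1 + 2 * \<epsilon>"
    by (rule real_le_lsqrt) (use \<epsilon>(1) in \<open>auto simp: power2_sum\<close>)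
  have k2: "10 * \<epsilon> \<le> \<kappa>" by (rule \<kappa>(1))
  have n0: "norm (proj2 p) \<ge> 1" "norm (proj2 p) \<noteq> 0" if "p \<in> quadric" for p
    using quadric_norm_ge[OF that] by auto
  have q1: "norm (q p) = 1" "norm (proj2 p) *\<^sub>R q p = proj2 p" if "p \<in> quadric" for p
    using n0(2)[OF that] by (simp_all add: q_def)
  have hs: "height (?s *\<^sub>R q p) = 2 * \<epsilon>" if "p \<in> quadric" for p
    using s q1(1)[OF that] \<epsilon>(1) by (simp add: height_def hsq_def power_mult_distrib real_sqrt_mult)
  have ns: "norm (?s *\<^sub>R q p) \<ge> 1" if "p \<in> quadric" for p using s q1(1)[OF that] by simp
  have rs: "2 * \<epsilon> \<le> rad (?s *\<^sub>R q p)" "rad (?s *\<^sub>R q p) < \<kappa>" if p: "p \<in> nearK" for p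
  proof -
    have pq: "p \<in> quadric" by (rule nearK_rad(2)[OF p])
    show "2 * \<epsilon> \<le> rad (?s *\<^sub>R q p)" using rad_ge_height[OF ns[OF pq]] hs[OF pq] by simp
    have r: "rad (proj2 p) < 2 * \<epsilon>" by (rule nearK_rad(1)[OF p])
    have h: "0 \<le> height (proj2 p)" "height (proj2 p) < 2 * \<epsilon>"
      using height_nonneg[OF n0(1)[OF pq]] hsq_le_of_rad(2)[OF n0(1)[OF pq] r] by auto
    have "norm (proj2 p) \<le> 1 + 2 * \<epsilon>"
    proof (rule power2_le_imp_le)
      have "(norm (proj2 p))\<^sup>2 \<le> 1 + 4 * \<epsilon>\<^sup>2"
        using hsq_le_of_rad(1)[OF n0(1)[OF pq] r] by (simp add: hsq_def)
      also have "\<dots> \<le> (1 + 2 * \<epsilon>)\<^sup>2" using \<epsilon>(1) by (simp add: power2_sum power_mult_distrib)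
      finally show "(norm (proj2 p))\<^sup>2 \<le> (1 + 2 * \<epsilon>)\<^sup>2" .
    qed (use \<epsilon>(1) in simp)
    then have a: "\<bar>?s - norm (proj2 p)\<bar> \<le> 2 * \<epsilon>" using s s2 n0(1)[OF pq] by linarith
    have "?s *\<^sub>R q p - proj2 p = (?s - norm (proj2 p)) *\<^sub>R q p"
      using q1(2)[OF pq] by (simp add: scaleR_left_diff_distrib)
    then have "norm (?s *\<^sub>R q p - proj2 p) \<le> 2 * \<epsilon>" using a q1(1)[OF pq] by simp
    moreover have "\<bar>height (?s *\<^sub>R q p) - height (proj2 p)\<bar> \<le> 2 * \<epsilon>" using h hs[OF pq] by simp
    ultimately show "rad (?s *\<^sub>R q p) < \<kappa>"
      using rad_le[of "?s *\<^sub>R q p" "proj2 p"] r k2 \<epsilon>(1) by linarith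
  qed
  have qD: "qpt (?s *\<^sub>R q p) t \<in> D" if p: "p \<in> nearK" for p t
    by (rule qpt_in_D[OF ns[OF nearK_rad(2)[OF p]]]) (use rs[OF p] \<epsilon>(1) in linarith)+
  then have \<sigma>D: "\<sigma> p \<in> D" if "p \<in> nearK" for p using that by (simp only: \<sigma>_def)
  have qc: "continuous_on nearK q"
    unfolding q_def using n0(2) nearK_rad(2) by (intro continuous_intros) auto
  have \<sigma>c: "continuous_on nearK \<sigma>" unfolding \<sigma>_def by (intro continuous_intros qc)
  have const: "c x = c y" if "connected A" "A \<subseteq> D" "x \<in> A" "y \<in> A" for A x y
  proof -
    have "continuous_on A c" "finite (c ` A)"
      using c that(2) continuous_on_subset finite_subset[OF image_mono[OF that(2)]] by blast+
    then have "c constant_on A"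
      using that(1) unfolding continuous_finite_range_constant_eq[where ?'b=real] by blast
    then show ?thesis using that(3,4) unfolding constant_on_def by metis
  qed
  \<comment> \<open>A path in \<open>D\<close> from \<open>p\<close> to \<open>\<sigma> p\<close>:
    radially at fixed angle to height 2 \<open>\<epsilon>\<close>, and from there along the circle
    to angle 0.\<close>
  have c\<sigma>: "c p = c (\<sigma> p)" if p: "p \<in> nearK" "p \<in> D" for p
  proof -
    have pq: "p \<in> quadric" by (rule nearK_rad(2)[OF p(1)])
    define t where "t = Arg (p $ 3)"
    have peq: "qpt (norm (proj2 p) *\<^sub>R q p) t = p"
      unfolding t_def q1(2)[OF pq] by (rule quadric_eq_qpt[OF pq])
    define I where "I = closed_segment (norm (proj2 p)) ?s"
    let ?A = "(\<lambda>s. qpt (s *\<^sub>R q p) t) ` I"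
    let ?B = "(\<lambda>t. qpt (?s *\<^sub>R q p) t) ` (UNIV :: real set)"
    have "connected ?A" unfolding I_def by (intro connected_continuous_image connected_segment continuous_intros)
    moreover have "connected ?B" by (intro connected_continuous_image connected_UNIV continuous_intros)
    moreover have "qpt (?s *\<^sub>R q p) t \<in> ?A" unfolding I_def by (rule imageI) simp
    then have "?A \<inter> ?B \<noteq> {}" by blast
    ultimately have conn: "connected (?A \<union> ?B)" by (rule connected_Un)
    have rp: "\<epsilon> < rad (proj2 p)" "rad (proj2 p) < 2 * \<epsilon>"
      using p(2) D_open[OF Om(1)] infdist_eq_rad[OF pq] nearK_rad(1)[OF p(1)] by auto
    have "?A \<subseteq> D"
    proof
      fix y assume "y \<in> ?A"
      then obtain s where s': "s \<in> I" "y = qpt (s *\<^sub>R q p) t" by blast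
      have "?s \<le> s \<or> norm (proj2 p) \<le> s"
        using s'(1) by (auto simp: I_def closed_segment_eq_real_ivl split: if_splits)
      then have s1: "s \<ge> 1" using s n0(1)[OF pq] by linarith
      have mono: "rad (x *\<^sub>R q p) \<le> rad (y *\<^sub>R q p)" if "1 \<le> x" "x \<le> y" for x y
        using rad_mono[of "x *\<^sub>R q p" "y / x"] q1(1)[OF pq] that by (simp add: field_simps)
      \<comment> \<open>Monotonicity along the ray bounds \<open>rad\<close> on the segment by its
        values at the ends, whichever end is farther out.\<close>
      have "min (rad (proj2 p)) (rad (?s *\<^sub>R q p)) \<le> rad (s *\<^sub>R q p) \<and>
          rad (s *\<^sub>R q p) \<le> max (rad (proj2 p)) (rad (?s *\<^sub>R q p))"
      proof (cases "norm (proj2 p) \<le> ?s")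
        case True
        then have "norm (proj2 p) \<le> s" "s \<le> ?s" using s'(1) by (auto simp: I_def closed_segment_eq_real_ivl)
        then show ?thesis
          using mono[OF n0(1)[OF pq], of s] mono[OF s1, of ?s] q1(2)[OF pq] by (simp add: min_def max_def)
      next
        case False
        then have "?s \<le> s" "s \<le> norm (proj2 p)" using s'(1) by (auto simp: I_def closed_segment_eq_real_ivl)
        then show ?thesis
          using mono[OF less_imp_le[OF s], of s] mono[OF s1, of "norm (proj2 p)"] q1(2)[OF pq] by (simp add: min_def max_def)
      qed
      then have "\<epsilon> < rad (s *\<^sub>R q p)" "rad (s *\<^sub>R q p) < \<kappa>"
        using rp rs[OF p(1)] k2 \<epsilon>(1) by (auto simp: min_def max_def split: if_splits)
      then show "y \<in> D" unfolding s'(2) using s1 q1(1)[OF pq] by (intro qpt_in_D) auto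
    qed
    moreover have "?B \<subseteq> D" using qD[OF p(1)] by blast
    ultimately have AB: "?A \<union> ?B \<subseteq> D" by blast
    have "p \<in> ?A" by (rule image_eqI[of _ _ "norm (proj2 p)"]) (simp_all add: peq I_def)
    moreover have "\<sigma> p \<in> ?B" unfolding \<sigma>_def by blast
    ultimately show ?thesis using const[OF conn AB] by blast
  qed
  define c' where "c' p = (if p \<in> D then c p else c (\<sigma> p))" for p
  have "continuous_on (D \<union> nearK) c'"
  proof (rule continuous_on_Un_local_open)
    show "continuous_on D c'" by (rule continuous_on_eq[OF conjunct1[OF c]]) (simp add: c'_def)
    have "continuous_on nearK (\<lambda>p. c (\<sigma> p))"
      by (rule continuous_on_compose2[OF conjunct1[OF c] \<sigma>c]) (use \<sigma>D in blast)
    then show "continuous_on nearK c'" by (rule continuous_on_eq) (use c\<sigma> in \<open>auto simp: c'_def\<close>)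
  qed (use open_parts[OF Om(1)] union_D_nearK[OF Om(1)] in auto)
  then have "continuous_on \<Omega> c'" using union_D_nearK[OF Om(1)] by simp
  moreover have "c' ` \<Omega> \<subseteq> c ` D"
  proof
    fix y assume "y \<in> c' ` \<Omega>"
    then obtain p where p: "p \<in> \<Omega>" "y = c' p" by blast
    show "y \<in> c ` D"
    proof (cases "p \<in> D")
      case False
      then have "p \<in> nearK" using union_D_nearK[OF Om(1)] p(1) by blast
      then show ?thesis using \<sigma>D False p(2) by (simp add: c'_def)
    qed (simp add: p(2) c'_def)
  qed
  then have "finite (c' ` \<Omega>)" using c finite_subset by blast
  ultimately have "c' constant_on \<Omega>"
    using Om(2) unfolding continuous_finite_range_constant_eq[where ?'b=real] by blast
  then obtain y where "\<And>p. p \<in> \<Omega> \<Longrightarrow> c' p = y" unfolding constant_on_def by blast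
  then have "c p = y" if "p \<in> D" for p using that by (metis DiffD1 c'_def)
  then show "c constant_on D" unfolding constant_on_def by blast
qed

text \<open>The outward ray at a point of \<open>K\<close> enters the shell \<open>W\<close>, over
  which all points of the quadric belong to \<open>D\<close>.\<close>

lemma complement_nonempty: "D \<noteq> {}"
proof -
  obtain k where k: "k \<in> K" using K(2) by blast
  then have kS: "k \<in> S3" using K(3) by blast
  have n: "norm (proj2 k) = 1" "k $ 3 = 0" using kS by (auto simp: S3_iff)
  have "qpt (proj2 k) 0 = k" using n by (simp add: vec_eq_iff forall_3 proj2_def height_def hsq_def)
  then have "rad (proj2 k) = 0" using k by (simp add: rad_def)
  then have "sqrt (1 + 4 * \<epsilon>\<^sup>2) *\<^sub>R proj2 k \<in> W" using ray_enters_W(2)[OF n(1)] \<epsilon>(1) by simp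
  then show ?thesis using qpt_W by blast
qed

end

section \<open>Choice of the width and conclusion\<close>

lemma compact_S3: "compact S3"
proof -
  have "closed S3" unfolding S3_def quadric_def
    by (intro closed_Int closed_Collect_eq continuous_intros)
  moreover have "bounded S3"
  proof (rule boundedI)
    fix p assume "p \<in> S3"
    then have "(norm p)\<^sup>2 = 1" by (simp add: norm_vec3 S3_iff)
    then show "norm p \<le> 1" by (simp add: power2_eq_1_iff) (use norm_ge_zero[of p] in linarith)
  qed
  ultimately show ?thesis by (simp add: compact_eq_bounded_closed)
qed

theorem mainTheorem2:
  fixes \<omega> \<Omega> :: "(complex^3) set"
  assumes "openin (top_of_set S3) \<omega>" and "\<omega> \<noteq> {}"
    and "openin (top_of_set quadric) \<Omega>" and "connected \<Omega>"
    and "S3 - \<omega> \<subseteq> \<Omega>"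
    and "connected (\<Omega> - (S3 - \<omega>))" and "\<Omega> - (S3 - \<omega>) \<noteq> {}"
  shows "\<exists>\<epsilon>>0. H_principle quadric \<Omega> (closed_nhd quadric (S3 - \<omega>) \<epsilon>)"
proof (cases "S3 - \<omega> = {}")
  case True
  have "restrict g \<Omega> = g" if "g \<in> CR quadric \<Omega>" for g
    using that extensional_restrict by (auto simp: CR_def)
  then have "(\<lambda>g. restrict g \<Omega>) ` CR quadric \<Omega> = CR quadric \<Omega>" by force
  then have "H_principle quadric \<Omega> {}"
    using assms True by (auto simp: H_principle_def H_pair_def)
  \<comment> \<open>For empty \<open>K\<close> every closed neighbourhood is empty, so any width
    would do.\<close>
  moreover have "closed_nhd quadric (S3 - \<omega>) 1 = {}" using True by (simp add: closed_nhd_def)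
  ultimately show ?thesis by (intro exI[of _ 1]) simp
next
  case False
  define K where "K = S3 - \<omega>"
  have "closedin (top_of_set S3) K" unfolding K_def using assms(1) by (intro closedin_diff) auto
  then have K: "compact K" using closedin_compact[OF compact_S3] by blast
  have KS: "K \<subseteq> S3" "K \<noteq> {}" using False by (auto simp: K_def)
  have Om: "\<Omega> \<subseteq> quadric" using assms(3) openin_imp_subset by blast
  obtain T where T: "open T" "\<Omega> = quadric \<inter> T" using assms(3) by (auto simp: openin_open)
  have "K \<subseteq> T" using assms(5) T(2) by (auto simp: K_def)
  \<comment> \<open>A uniform distance from the compact \<open>K\<close> to the complement of the
    open set \<open>T\<close> that cuts out \<open>\<Omega>\<close>.\<close>
  then obtain \<kappa> where \<kappa>: "\<kappa> > 0" "(\<Union>x\<in>K. ball x \<kappa>) \<subseteq> T"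
    using compact_subset_open_imp_ball_epsilon_subset[OF K T(1)] by blast
  have near: "p \<in> \<Omega>" if p: "p \<in> quadric" "infdist p K < \<kappa>" for p
  proof -
    obtain k where "k \<in> K" "infdist p K = dist p k"
      using infdist_attains_inf[OF compact_imp_closed[OF K] KS(2)] by blast
    then have "p \<in> ball k \<kappa>" using p(2) by (simp add: dist_commute)
    then have "p \<in> T" using \<kappa>(2) \<open>k \<in> K\<close> by blast
    then show ?thesis using p(1) T(2) by simp
  qed
  obtain q where q: "q \<in> \<omega>" using assms(2) by blast
  have qS: "q \<in> S3" using q assms(1) openin_imp_subset by blast
  have "q \<notin> K" using q by (simp add: K_def)
  then have qK: "infdist q K > 0" using in_closed_iff_infdist_zero[OF compact_imp_closed[OF K] KS(2)] infdist_nonneg[of q K]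
    by (simp add: order_less_le)
  \<comment> \<open>The three bounds give room for the tangent circles, control of powers of
    \<open>\<epsilon>\<close>, and a point \<open>q\<close> of the sphere strictly outside the
    closed neighbourhood.\<close>
  define \<epsilon> where "\<epsilon> = min (\<kappa> / 10) (min (1/2) (infdist q K / 2))"
  have \<epsilon>: "\<epsilon> > 0" "\<epsilon> \<le> 1/2" "10 * \<epsilon> \<le> \<kappa>" "\<epsilon> < infdist q K"
    using \<kappa>(1) qK by (auto simp: \<epsilon>_def min_def)
  let ?N = "closed_nhd quadric K \<epsilon>"
  have loc: "hartogs K \<Omega> \<epsilon> \<kappa> f" if "f \<in> CR quadric (\<Omega> - ?N)" for f
    by unfold_locales (use K KS \<epsilon> near that qS in auto)
  \<comment> \<open>Connectedness and non-emptiness of the complement concern only \<open>K\<close>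
    and \<open>\<Omega>\<close>; the zero function gives access to them before any CR function is
    fixed.\<close>
  interpret z: hartogs K \<Omega> \<epsilon> \<kappa> "restrict (\<lambda>_. 0) (\<Omega> - ?N)" by (rule loc[OF zero_in_CR])
  have "H_pair quadric \<Omega> ?N"
    unfolding H_pair_def
  proof (intro conjI)
    have "?N = quadric \<inter> {p. infdist p K \<le> \<epsilon>}" using KS(2) by (auto simp: closed_nhd_def)
    moreover have "closed quadric" unfolding quadric_def by (intro closed_Collect_eq continuous_intros)
    ultimately show "compact ?N" using closed_Int_compact[OF _ compact_infdist_le[OF KS(2) K \<epsilon>(1)]] by simp
    show "?N \<subseteq> \<Omega>" using near \<epsilon> by (auto simp: closed_nhd_def)
    show "connected (\<Omega> - ?N)" by (rule z.connected_complement[OF Om assms(4)])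
    show "\<Omega> - ?N \<noteq> {}" by (rule z.complement_nonempty)
  qed (use assms in auto)
  moreover have "(\<lambda>g. restrict g (\<Omega> - ?N)) ` CR quadric \<Omega> = CR quadric (\<Omega> - ?N)"
  proof
    show "(\<lambda>g. restrict g (\<Omega> - ?N)) ` CR quadric \<Omega> \<subseteq> CR quadric (\<Omega> - ?N)"
      using CR_restrict by blast
    show "CR quadric (\<Omega> - ?N) \<subseteq> (\<lambda>g. restrict g (\<Omega> - ?N)) ` CR quadric \<Omega>"
    proof
      fix f assume "f \<in> CR quadric (\<Omega> - ?N)"
      then interpret hartogs K \<Omega> \<epsilon> \<kappa> f by (rule loc)
      show "f \<in> (\<lambda>g. restrict g (\<Omega> - ?N)) ` CR quadric \<Omega>"
        using ext_in_CR[OF Om] by (metis image_eqI)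
    qed
  qed
  ultimately have "H_principle quadric \<Omega> ?N" by (simp add: H_principle_def)
  then show ?thesis using \<epsilon>(1) unfolding K_def by blast
qed

end
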